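(* Let $\mathbb{T}$ be a time scale with $\sup\mathbb{T}=+\infty$ and $\bar\mu_\mathbb{T}<+\infty$, and let $A=(a_{ij})\in\mathbb{R}^{n\times n}$, $b=(b_1,\dots,b_n)^T\in\mathbb{R}^n$ be such that the single-input system $x^\Delta=Ax+bu$ on $\mathbb{T}$ is positive. Let $k=\operatorname{rank}[b,Ab,\dots,A^{n-1}b]$, let $a_1,\dots,a_k\in\mathbb{R}$ satisfy $A^kb=-a_1b-a_2Ab-\dots-a_kA^{k-1}b$, and for $i=0,\dots,k-1$ set $v_{k-i}:=A^ib+a_kA^{i-1}b+\dots+a_{k-i+1}b$ (so $v_k=b$). For $j=1,\dots,n$ let $\alpha_j$ be the maximum of the numbers $-a_{ij}/b_i$ over $i\ne j$ with $b_i\neq0$, together with the number $(-a_{jj}-\gamma(\mathbb{T}))/b_j$ if $b_j\ne0$ and $\gamma(\mathbb{T})<+\infty$ (with $\alpha_j=-\infty$ if there are no such numbers). Then the system is positively stabilizable if and only if (1) for every $\lambda\in\operatorname{spec}(A)$ with $\lambda\notin\mathcal{S}_\mathbb{T}$ one has $\operatorname{rank}[\lambda I-A,\ b]=n$, and (2) there exists a row vector $K=(k_1,\dots,k_n)\in\mathbb{R}^{1\times n}$ with $k_j\ge\alpha_j$ for $j=1,\dots,n$ and $Kv_i<a_i$ for $i=1,\dots,k$.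
   Context: $\mathbb{T}$ is a time scale (closed nonempty subset of $\mathbb{R}$) with graininess $\mu_\mathbb{T}(t)=\inf\{s\in\mathbb{T}:s>t\}-t$, $\bar\mu_\mathbb{T}=\sup_t\mu_\mathbb{T}(t)$, $\gamma(\mathbb{T})=1/\bar\mu_\mathbb{T}\in(0,+\infty]$ (with $1/0=+\infty$); $x^\Delta$ is the delta derivative. The control system is positive if for every $t_0\in\mathbb{T}$, every piecewise continuous control with values in $\mathbb{R}_+$ and every initial state in $\mathbb{R}^n_+$, the trajectory stays in $\mathbb{R}^n_+$. An autonomous system $x^\Delta=Mx$ is positive if trajectories from $\mathbb{R}^n_+$ stay in $\mathbb{R}^n_+$; it is uniformly exponentially stable (resp. positively uniformly exponentially stable) if there exist $K\ge1,\alpha>0$ and an open neighborhood $V$ of $0$ with $\|x(t)\|\le Ke^{-\alpha(t-t_0)}\|x_0\|$ for all $t_0\le t$ in $\mathbb{T}$ and all $x_0\in V$ (resp. $x_0\in V\cap\mathbb{R}^n_+$). The system is positively stabilizable if there is a row vector $K$ such that $x^\Delta=(A+bK)x$ is positive and positively uniformly exponentially stable. $\mathcal{S}_\mathbb{T}$ is the set of $\lambda\in\mathbb{C}$ for which $x^\Delta=\lambda x$ is uniformly exponentially stable. *)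

theory Defs
  imports Complex_Main "HOL-Library.Extended_Real" "Jordan_Normal_Form.Spectral_Radius"
    "Jordan_Normal_Form.DL_Rank"
begin

definition time_scale :: "real set \<Rightarrow> bool" where
  "time_scale T \<longleftrightarrow> closed T \<and> T \<noteq> {}"

definition fjump :: "real set \<Rightarrow> real \<Rightarrow> real" where
  "fjump T t = (if {s \<in> T. s > t} = {} then t else Inf {s \<in> T. s > t})"

definition graininess :: "real set \<Rightarrow> real \<Rightarrow> real" where
  "graininess T t = fjump T t - t"

text \<open>sup of the graininess (meaningful when it is bounded)\<close>
definition mubar :: "real set \<Rightarrow> real" where
  "mubar T = Sup (graininess T ` T)"

definition gammaT :: "real set \<Rightarrow> ereal" where
  "gammaT T = (if mubar T = 0 then PInfty else ereal (1 / mubar T))"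

text \<open>Hilger delta derivative of f at t in T (for an unbounded-above T every point
  is in T^kappa)\<close>
definition has_delta :: "real set \<Rightarrow> (real \<Rightarrow> 'a::real_normed_vector) \<Rightarrow> 'a \<Rightarrow> real \<Rightarrow> bool" where
  "has_delta T f D t \<longleftrightarrow> t \<in> T \<and> (\<forall>\<epsilon>>0. \<exists>\<delta>>0. \<forall>s\<in>T. \<bar>s - t\<bar> < \<delta> \<longrightarrow>
      norm (f (fjump T t) - f s - (fjump T t - s) *\<^sub>R D) \<le> \<epsilon> * \<bar>fjump T t - s\<bar>)"

text \<open>the part of T to the right of t0 (itself a time scale); solutions starting at t0
  live on it\<close>
definition tsfrom :: "real set \<Rightarrow> real \<Rightarrow> real set" where
  "tsfrom T t0 = {s \<in> T. t0 \<le> s}"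

definition vnorm :: "'a::real_normed_vector vec \<Rightarrow> real" where
  "vnorm x = sqrt (\<Sum>i<dim_vec x. (norm (x $ i))\<^sup>2)"

definition nonneg_vec :: "nat \<Rightarrow> real vec \<Rightarrow> bool" where
  "nonneg_vec n x \<longleftrightarrow> x \<in> carrier_vec n \<and> (\<forall>i<n. x $ i \<ge> 0)"

definition vec_open :: "nat \<Rightarrow> real vec set \<Rightarrow> bool" where
  "vec_open n V \<longleftrightarrow> V \<subseteq> carrier_vec n \<and>
     (\<forall>x\<in>V. \<exists>e>0. \<forall>y\<in>carrier_vec n. vnorm (y - x) < e \<longrightarrow> y \<in> V)"

definition has_delta_vec :: "real set \<Rightarrow> nat \<Rightarrow> (real \<Rightarrow> real vec) \<Rightarrow> real vec \<Rightarrow> real \<Rightarrow> bool" where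
  "has_delta_vec T n x D t \<longleftrightarrow> (\<forall>i<n. has_delta T (\<lambda>s. x s $ i) (D $ i) t)"

definition pw_cont :: "real set \<Rightarrow> (real \<Rightarrow> real) \<Rightarrow> bool" where
  "pw_cont T u \<longleftrightarrow>
     (\<forall>a c. \<exists>S. finite S \<and> (\<forall>t\<in>T \<inter> {a..c}. t \<notin> S \<longrightarrow> continuous (at t within T) u)) \<and>
     (\<forall>t\<in>T. (\<exists>l. (u \<longlongrightarrow> l) (at t within {s\<in>T. s > t})) \<and>
             (\<exists>l. (u \<longlongrightarrow> l) (at t within {s\<in>T. s < t})))"

definition ctrl_sol :: "real set \<Rightarrow> nat \<Rightarrow> real mat \<Rightarrow> real vec \<Rightarrow> (real \<Rightarrow> real)
    \<Rightarrow> real \<Rightarrow> real vec \<Rightarrow> (real \<Rightarrow> real vec) \<Rightarrow> bool" where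
  "ctrl_sol T n A b u t0 x0 x \<longleftrightarrow> x t0 = x0 \<and>
     (\<forall>t\<in>tsfrom T t0. x t \<in> carrier_vec n \<and>
        has_delta_vec (tsfrom T t0) n x (A *\<^sub>v x t + u t \<cdot>\<^sub>v b) t)"

definition positive_ctrl_system :: "real set \<Rightarrow> nat \<Rightarrow> real mat \<Rightarrow> real vec \<Rightarrow> bool" where
  "positive_ctrl_system T n A b \<longleftrightarrow>
     (\<forall>t0\<in>T. \<forall>u x0 x. pw_cont T u \<and> (\<forall>t. u t \<ge> 0) \<and> nonneg_vec n x0 \<and>
        ctrl_sol T n A b u t0 x0 x \<longrightarrow> (\<forall>t\<in>tsfrom T t0. nonneg_vec n (x t)))"

definition aut_sol :: "real set \<Rightarrow> nat \<Rightarrow> real mat \<Rightarrow> real \<Rightarrow> real vec \<Rightarrow> (real \<Rightarrow> real vec) \<Rightarrow> bool" where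
  "aut_sol T n M t0 x0 x \<longleftrightarrow> x t0 = x0 \<and>
     (\<forall>t\<in>tsfrom T t0. x t \<in> carrier_vec n \<and> has_delta_vec (tsfrom T t0) n x (M *\<^sub>v x t) t)"

definition positive_aut :: "real set \<Rightarrow> nat \<Rightarrow> real mat \<Rightarrow> bool" where
  "positive_aut T n M \<longleftrightarrow>
     (\<forall>t0\<in>T. \<forall>x0 x. nonneg_vec n x0 \<and> aut_sol T n M t0 x0 x \<longrightarrow>
        (\<forall>t\<in>tsfrom T t0. nonneg_vec n (x t)))"

definition pos_unif_exp_stable :: "real set \<Rightarrow> nat \<Rightarrow> real mat \<Rightarrow> bool" where
  "pos_unif_exp_stable T n M \<longleftrightarrow>
     (\<exists>K \<alpha> V. K \<ge> 1 \<and> \<alpha> > 0 \<and> vec_open n V \<and> 0\<^sub>v n \<in> V \<and>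
        (\<forall>t0\<in>T. \<forall>x0 x. x0 \<in> V \<and> nonneg_vec n x0 \<and> aut_sol T n M t0 x0 x \<longrightarrow>
           (\<forall>t\<in>tsfrom T t0. vnorm (x t) \<le> K * exp (- \<alpha> * (t - t0)) * vnorm x0)))"

definition outer :: "real vec \<Rightarrow> real vec \<Rightarrow> real mat" where
  "outer b K = mat (dim_vec b) (dim_vec K) (\<lambda>(i,j). b $ i * K $ j)"

definition positively_stabilizable :: "real set \<Rightarrow> nat \<Rightarrow> real mat \<Rightarrow> real vec \<Rightarrow> bool" where
  "positively_stabilizable T n A b \<longleftrightarrow>
     (\<exists>K\<in>carrier_vec n. positive_aut T n (A + outer b K) \<and>
        pos_unif_exp_stable T n (A + outer b K))"

definition stab_region :: "real set \<Rightarrow> complex set" where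
  "stab_region T = {z. \<exists>K \<alpha> V. K \<ge> 1 \<and> \<alpha> > 0 \<and> open V \<and> (0::complex) \<in> V \<and>
      (\<forall>t0\<in>T. \<forall>x0 x. x0 \<in> V \<and> x t0 = x0 \<and>
         (\<forall>t\<in>tsfrom T t0. has_delta (tsfrom T t0) x (z * x t) t) \<longrightarrow>
         (\<forall>t\<in>tsfrom T t0. cmod (x t) \<le> K * exp (- \<alpha> * (t - t0)) * cmod x0))}"

definition krylov :: "nat \<Rightarrow> real mat \<Rightarrow> real vec \<Rightarrow> real mat" where
  "krylov n A b = mat n n (\<lambda>(i,j). ((A ^\<^sub>m j) *\<^sub>v b) $ i)"

definition hautus :: "nat \<Rightarrow> real mat \<Rightarrow> real vec \<Rightarrow> complex \<Rightarrow> complex mat" where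
  "hautus n A b z = mat n (Suc n) (\<lambda>(i,j). if j < n
      then (if i = j then z else 0) - complex_of_real (A $$ (i,j))
      else complex_of_real (b $ i))"

definition vv :: "nat \<Rightarrow> real mat \<Rightarrow> real vec \<Rightarrow> (nat \<Rightarrow> real) \<Rightarrow> nat \<Rightarrow> nat \<Rightarrow> real vec" where
  "vv n A b a k m = (let i = k - m in
     vec n (\<lambda>r. ((A ^\<^sub>m i) *\<^sub>v b) $ r +
        (\<Sum>j\<in>{1..i}. a (k - j + 1) * ((A ^\<^sub>m (i - j)) *\<^sub>v b) $ r)))"

text \<open>alpha_j (0-based index j < n), as an extended real; Sup of the empty set is -infinity\<close>
definition alpha_bound :: "real set \<Rightarrow> nat \<Rightarrow> real mat \<Rightarrow> real vec \<Rightarrow> nat \<Rightarrow> ereal" where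
  "alpha_bound T n A b j = Sup (
      {ereal (- A $$ (i,j) / b $ i) | i. i < n \<and> i \<noteq> j \<and> b $ i \<noteq> 0} \<union>
      (if b $ j \<noteq> 0 \<and> gammaT T < PInfty
         then {ereal ((- A $$ (j,j) - 1 / mubar T) / b $ j)} else {}))"

end

theory Submission
  imports "HOL-Analysis.Equivalence_Measurable_On_Borel" Defs
begin

text \<open>
  Put \<open>M = A + b K\<close>. Positivity of the closed loop is the entrywise condition \<open>M + \<gamma>(T) I \<ge> 0\<close>,
  which is \<open>k\<^sub>j \<ge> \<alpha>\<^sub>j\<close>. For such an \<open>M\<close> a Perron-Frobenius alternative holds: either some positive \<open>w\<close>
  has \<open>w\<^sup>T M < 0\<close>, or some nonzero \<open>w \<ge> 0\<close> has \<open>w\<^sup>T M = s w\<^sup>T\<close> with \<open>s \<ge> 0\<close>. In the first case \<open>w\<^sup>T x\<close> decays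
  exponentially along nonnegative solutions and every eigenvalue \<open>\<lambda>\<close> of \<open>M\<close> satisfies
  \<open>|1 + \<mu> \<lambda>| \<le> 1 - \<epsilon> \<mu>\<close> for all graininess values \<open>\<mu>\<close>, so it lies in the stability region; in the
  second case \<open>w\<^sup>T x\<close> does not decrease.

  With \<open>c\<^sub>m = a\<^sub>m - K v\<^sub>m\<close> and \<open>v\<^sub>0 = 0\<close> one has \<open>M v\<^sub>m = v\<^sub>m\<^sub>-\<^sub>1 - c\<^sub>m b\<close>. Hence \<open>z\<^sup>k + \<Sum> c\<^sub>m z\<^sup>m\<^sup>-\<^sup>1\<close> is the
  characteristic polynomial of \<open>M\<close> on the Krylov space; if \<open>M\<close> is stable it is Hurwitz and so has
  positive coefficients. Conversely, let all \<open>c\<^sub>m\<close> be positive and \<open>w\<^sup>T M = s w\<^sup>T\<close> as above. If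
  \<open>w\<^sup>T b > 0\<close>, then \<open>w\<^sup>T v\<^sub>m > 0\<close> for \<open>m = k, \<dots>, 0\<close>, contradicting \<open>v\<^sub>0 = 0\<close>; so \<open>w\<^sup>T b = 0\<close> and \<open>s\<close> is an
  eigenvalue of \<open>A\<close> outside the stability region that violates the rank condition.
\<close>

text \<open>Positivity and stability are claims about every solution and would hold vacuously if
  there were none. Deriving entrywise conditions from positivity, or instability from an
  eigenvector, therefore requires solutions on an arbitrary time scale; they are built as power
  series in generalised Taylor monomials. Estimates of solutions have to pass jumps, right-dense
  points and left limits alike, so comparison functions carry a small strict perturbation: touching
  the barrier at a right-dense point then already forces a positive derivative. The rank condition
  acts through left eigenvectors: if y^T A = z y^T and y^T b = 0, then y^T M = z y^T for every gain
  K, so feedback cannot move z. Since condition (1) contains no gain, the equivalence can be shown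
  for each K separately and K quantified at the end.\<close>

no_notation Finite_Cartesian_Product.vec_nth (infixl \<open>$\<close> 90)
hide_const (open) Finite_Cartesian_Product.vec Finite_Cartesian_Product.mat

section \<open>Half-lines of a time scale\<close>

text \<open>The scale as seen from one initial time: solutions from \<open>t0\<close> live on the
  points to its right, and \<open>t0\<close> as minimum gives inductions a base point. Unboundedness
  keeps \<open>fjump\<close> away from its default case of an empty future.\<close>

locale half_time_scale =
  fixes X :: "real set" and t0 :: real
  assumes closed_X: "closed X" and start_in: "t0 \<in> X"
    and start_le: "\<And>t. t \<in> X \<Longrightarrow> t0 \<le> t" and unbounded: "\<not> bdd_above X"
begin

lemma later_nonempty: "{s \<in> X. s > t} \<noteq> {}"
  using unbounded by (auto simp: bdd_above_def not_le)

lemma later_bdd_below: "bdd_below {s \<in> X. s > t}"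
  by (auto intro: bdd_belowI[of _ t])

lemma fjump_eq: "fjump X t = Inf {s \<in> X. s > t}"
  using later_nonempty[of t] by (auto simp: fjump_def)

lemma fjump_ge: "t \<le> fjump X t"
  unfolding fjump_eq by (rule cInf_greatest[OF later_nonempty]) auto

lemma fjump_le: "s \<in> X \<Longrightarrow> t < s \<Longrightarrow> fjump X t \<le> s"
  unfolding fjump_eq by (rule cInf_lower[OF _ later_bdd_below]) auto

lemma fjump_in: "fjump X t \<in> X"
proof -
  have "fjump X t \<in> closure {s \<in> X. s > t}"
    unfolding fjump_eq by (rule closure_contains_Inf[OF later_nonempty later_bdd_below])
  also have "\<dots> \<subseteq> closure X" by (rule closure_mono) auto
  finally show ?thesis using closed_X by simp
qed

lemma graininess_nonneg: "0 \<le> graininess X t"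
  using fjump_ge by (simp add: graininess_def)

text \<open>The choice s = t is admissible for every \<epsilon>, so the error, a fixed vector, is at
  most \<epsilon> times the graininess for all \<epsilon> and vanishes.\<close>

lemma has_delta_jump:
  fixes f :: "real \<Rightarrow> 'a::real_normed_vector"
  assumes "has_delta X f D t"
  shows "f (fjump X t) = f t + graininess X t *\<^sub>R D"
proof -
  have "norm (f (fjump X t) - f t - graininess X t *\<^sub>R D) \<le> \<epsilon> * graininess X t" if "\<epsilon> > 0" for \<epsilon>
    using assms that fjump_ge[of t] unfolding has_delta_def graininess_def by force
  then have "norm (f (fjump X t) - f t - graininess X t *\<^sub>R D) \<le> 0 + e" if "e > 0" for e
  proof -
    have "e / (graininess X t + 1) * graininess X t \<le> e"
      using that graininess_nonneg[of t] by (simp add: field_simps)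
    moreover have "e / (graininess X t + 1) > 0"
      using that graininess_nonneg[of t] by (simp add: field_simps)
    ultimately show ?thesis
      using \<open>\<And>\<epsilon>. 0 < \<epsilon> \<Longrightarrow> _ \<le> \<epsilon> * graininess X t\<close> by fastforce
  qed
  then have "norm (f (fjump X t) - f t - graininess X t *\<^sub>R D) \<le> 0"
    by (rule field_le_epsilon)
  then show ?thesis by (simp add: algebra_simps)
qed

lemma has_delta_dense:
  fixes f :: "real \<Rightarrow> 'a::real_normed_vector"
  assumes "has_delta X f D t" and "fjump X t = t"
  shows "(f has_vector_derivative D) (at t within X)"
proof -
  have "\<exists>d>0. \<forall>s\<in>X. norm (s - t) < d \<longrightarrow>
      norm (f s - f t - (s - t) *\<^sub>R D) \<le> e * norm (s - t)" if e: "e > 0" for e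
  proof -
    obtain d where "d > 0" and d: "\<forall>s\<in>X. \<bar>s - t\<bar> < d \<longrightarrow>
        norm (f t - f s - (t - s) *\<^sub>R D) \<le> e * \<bar>t - s\<bar>"
      using assms(1) e unfolding has_delta_def assms(2) by blast
    have "norm (f s - f t - (s - t) *\<^sub>R D) = norm (f t - f s - (t - s) *\<^sub>R D)" for s
      by (metis (no_types, lifting) add_diff_eq diff_diff_eq2 minus_diff_eq norm_minus_commute
          scaleR_minus_left uminus_add_conv_diff diff_diff_add add.commute)
    with d have "\<forall>s\<in>X. norm (s - t) < d \<longrightarrow>
        norm (f s - f t - (s - t) *\<^sub>R D) \<le> e * norm (s - t)"
      by (simp add: abs_minus_commute)
    with \<open>d > 0\<close> show ?thesis by blast
  qed
  then show ?thesis
    unfolding has_vector_derivative_def has_derivative_within_alt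
    by (auto intro: bounded_linear_scaleR_left)
qed

text \<open>The definition compares f s with the value at \<open>fjump X t\<close>, not at t. The
  jump formula moves the comparison to t; the remaining error is only \<epsilon> times (graininess +
  1), not o(s - t), but that is enough for continuity.\<close>

lemma has_delta_continuous:
  fixes f :: "real \<Rightarrow> 'a::real_normed_vector"
  assumes "has_delta X f D t"
  shows "continuous (at t within X) f"
  unfolding continuous_within_eps_delta
proof (intro allI impI)
  fix e :: real assume "e > 0"
  define \<mu> where "\<mu> = graininess X t"
  have \<mu>: "\<mu> \<ge> 0" "fjump X t = t + \<mu>"
    using graininess_nonneg by (auto simp: \<mu>_def graininess_def)
  define \<epsilon> where "\<epsilon> = e / (2 * (\<mu> + 1))"
  have "\<epsilon> > 0" using \<open>e > 0\<close> \<mu> by (simp add: \<epsilon>_def)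
  then obtain d where "d > 0" and d: "\<And>s. s \<in> X \<Longrightarrow> \<bar>s - t\<bar> < d \<Longrightarrow>
      norm (f (fjump X t) - f s - (fjump X t - s) *\<^sub>R D) \<le> \<epsilon> * \<bar>fjump X t - s\<bar>"
    using assms unfolding has_delta_def by metis
  define d' where "d' = min (min d 1) (e / (2 * (norm D + 1)))"
  have "d' > 0" using \<open>d > 0\<close> \<open>e > 0\<close> by (simp add: d'_def add_nonneg_pos)
  moreover have "dist (f s) (f t) < e" if s: "s \<in> X" "dist s t < d'" for s
  proof -
    have lt: "\<bar>s - t\<bar> < d" "\<bar>s - t\<bar> < 1" "\<bar>s - t\<bar> < e / (2 * (norm D + 1))"
      using s by (auto simp: d'_def dist_real_def)
    have pos: "0 < 2 * (norm D + 1)" by (simp add: add_nonneg_pos)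
    have "\<bar>s - t\<bar> * norm D \<le> \<bar>s - t\<bar> * (norm D + 1)"
      by (simp add: mult_left_mono)
    also have "\<dots> < e / 2"
      using lt(3) unfolding pos_less_divide_eq[OF pos] by (simp add: algebra_simps)
    finally have D: "\<bar>s - t\<bar> * norm D < e / 2" .
    have "norm (f t - f s - (t - s) *\<^sub>R D) \<le> \<epsilon> * \<bar>fjump X t - s\<bar>"
      using d[OF s(1) lt(1)] has_delta_jump[OF assms] \<mu> by (simp add: \<mu>_def[symmetric] algebra_simps)
    also have "\<dots> \<le> \<epsilon> * (\<mu> + 1)"
      using lt(2) \<mu> \<open>\<epsilon> > 0\<close> by (intro mult_left_mono) auto
    also have "\<dots> = e / 2" using \<mu> by (simp add: \<epsilon>_def field_simps)
    finally have E: "norm (f t - f s - (t - s) *\<^sub>R D) \<le> e / 2" .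
    have "norm (f t - f s) \<le> norm (f t - f s - (t - s) *\<^sub>R D) + norm ((t - s) *\<^sub>R D)"
      by (metis norm_triangle_sub add.commute)
    also have "\<dots> < e"
      using E D by (simp add: abs_minus_commute)
    finally show ?thesis by (simp add: dist_norm norm_minus_commute)
  qed
  ultimately show "\<exists>d>0. \<forall>x'\<in>X. dist x' t < d \<longrightarrow> dist (f x') (f t) < e" by blast
qed

text \<open>Consider the infimum m of the points where P fails. P holds at m itself: by
  \<open>start\<close>, by \<open>limit\<close> if points accumulate from the left, or by
  \<open>jump\<close> from an immediate predecessor. It then holds a bit to the right of m, by
  \<open>dense\<close> or because a gap follows, which contradicts the infimum.\<close>

lemma time_scale_induct [consumes 1, case_names start jump dense limit]:
  assumes "t \<in> X"
    and start: "P t0"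
    and jump: "\<And>t. t \<in> X \<Longrightarrow> P t \<Longrightarrow> t < fjump X t \<Longrightarrow> P (fjump X t)"
    and dense: "\<And>t. t \<in> X \<Longrightarrow> P t \<Longrightarrow> fjump X t = t \<Longrightarrow>
      \<exists>d>0. \<forall>s\<in>X. t < s \<and> s < t + d \<longrightarrow> P s"
    and limit: "\<And>t. t \<in> X \<Longrightarrow> (\<And>s. s \<in> X \<Longrightarrow> s < t \<Longrightarrow> P s) \<Longrightarrow>
      (\<And>d. d > 0 \<Longrightarrow> \<exists>s\<in>X. t - d < s \<and> s < t) \<Longrightarrow> P t"
  shows "P t"
proof (rule ccontr)
  assume "\<not> P t"
  define N where "N = {t \<in> X. \<not> P t}"
  have ne: "N \<noteq> {}" using \<open>t \<in> X\<close> \<open>\<not> P t\<close> by (auto simp: N_def)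
  have bdd: "bdd_below N" using start_le by (auto simp: N_def intro: bdd_belowI[of _ t0])
  define m where "m = Inf N"
  have "m \<in> closure N" unfolding m_def by (rule closure_contains_Inf[OF ne bdd])
  moreover have "closure N \<subseteq> closure X" by (rule closure_mono) (auto simp: N_def)
  ultimately have mX: "m \<in> X" using closed_X by auto
  have before: "P s" if "s \<in> X" "s < m" for s
    using cInf_lower[OF _ bdd, of s] that by (auto simp: N_def m_def)
  have "P m"
  proof (cases "m = t0")
    case False
    then have "t0 < m" using start_le[OF mX] by simp
    show ?thesis
    proof (cases "\<forall>d>0. \<exists>s\<in>X. m - d < s \<and> s < m")
      case True
      then show ?thesis using limit[OF mX] before by blast
    next
      case False
      then obtain d where d: "d > 0" "\<And>s. s \<in> X \<Longrightarrow> s < m \<Longrightarrow> s \<le> m - d"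
        by (meson linorder_not_less)
      \<comment> \<open>The predecessor of m: with a gap of length d on the left, the supremum of
        the earlier points belongs to the scale, is below m, and jumps to m.\<close>
      define r where "r = Sup {s \<in> X. s < m}"
      have ne': "{s \<in> X. s < m} \<noteq> {}" using start_in \<open>t0 < m\<close> by auto
      have bdd': "bdd_above {s \<in> X. s < m}" by (auto intro: bdd_aboveI[of _ m])
      have "r \<in> closure {s \<in> X. s < m}"
        unfolding r_def by (rule closure_contains_Sup[OF ne' bdd'])
      moreover have "closure {s \<in> X. s < m} \<subseteq> closure X" by (rule closure_mono) auto
      ultimately have rX: "r \<in> X" using closed_X by auto
      have "r \<le> m - d" unfolding r_def using d(2) by (intro cSup_least[OF ne']) auto
      then have "r < m" using d(1) by simp
      have "fjump X r \<le> m" using fjump_le mX \<open>r < m\<close> by blast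
      moreover have "\<not> fjump X r < m"
      proof
        assume lt: "fjump X r < m"
        then have "fjump X r \<le> r"
          unfolding r_def using fjump_in by (intro cSup_upper[OF _ bdd']) (auto simp: r_def)
        then have "fjump X r = r" using fjump_ge[of r] by simp
        moreover have "fjump X r \<ge> m"
          unfolding fjump_eq
        proof (rule cInf_greatest[OF later_nonempty])
          fix x assume "x \<in> {s \<in> X. r < s}"
          then show "m \<le> x"
            using cSup_upper[OF _ bdd', of x] by (fastforce simp: r_def[symmetric])
        qed
        ultimately show False using lt by simp
      qed
      ultimately have "fjump X r = m" by simp
      then show ?thesis using jump[OF rX] before[OF rX \<open>r < m\<close>] \<open>r < m\<close> by simp
    qed
  qed (use start in simp)
  have "\<exists>d>0. \<forall>s\<in>X. m < s \<and> s < m + d \<longrightarrow> P s"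
  proof (cases "fjump X m = m")
    case True
    then show ?thesis using dense[OF mX \<open>P m\<close>] by simp
  next
    case False
    then have "fjump X m - m > 0" using fjump_ge[of m] by simp
    moreover have "\<forall>s\<in>X. m < s \<and> s < m + (fjump X m - m) \<longrightarrow> P s"
      using fjump_le by fastforce
    ultimately show ?thesis by blast
  qed
  then obtain d where "d > 0" and d: "\<And>s. s \<in> X \<Longrightarrow> m < s \<Longrightarrow> s < m + d \<Longrightarrow> P s" by blast
  have "m + d \<le> Inf N"
  proof (rule cInf_greatest[OF ne])
    fix s assume s: "s \<in> N"
    then have "m \<le> s" unfolding m_def by (rule cInf_lower[OF _ bdd])
    moreover have "s \<noteq> m" using s \<open>P m\<close> by (auto simp: N_def)
    ultimately show "m + d \<le> s" using d[of s] s by (force simp: N_def not_le[symmetric])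
  qed
  then show False using \<open>d > 0\<close> by (simp add: m_def)
qed

text \<open>A finite family stays nonnegative if no member can cross zero first. At a right-dense
  point a vanishing member rises because of its positive derivative, while positive members stay
  positive by continuity; at left limits continuity suffices. The family is treated jointly because
  each hypothesis may use the signs of all members.\<close>

lemma barrier:
  fixes f :: "'i \<Rightarrow> real \<Rightarrow> real"
  assumes "finite I" "t \<in> X" "i \<in> I"
    and cont: "\<And>i t. i \<in> I \<Longrightarrow> t \<in> X \<Longrightarrow> continuous (at t within X) (f i)"
    and init: "\<And>i. i \<in> I \<Longrightarrow> 0 \<le> f i t0"
    and jump: "\<And>i t. i \<in> I \<Longrightarrow> t \<in> X \<Longrightarrow> t < fjump X t \<Longrightarrow> (\<And>j. j \<in> I \<Longrightarrow> 0 \<le> f j t) \<Longrightarrow>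
      0 \<le> f i (fjump X t)"
    and dense: "\<And>i t. i \<in> I \<Longrightarrow> t \<in> X \<Longrightarrow> fjump X t = t \<Longrightarrow> (\<And>j. j \<in> I \<Longrightarrow> 0 \<le> f j t) \<Longrightarrow>
      f i t = 0 \<Longrightarrow> \<exists>D>0. (f i has_real_derivative D) (at t within X)"
  shows "0 \<le> f i t"
proof -
  have "\<forall>i\<in>I. 0 \<le> f i t"
    using \<open>t \<in> X\<close>
  proof (induction t rule: time_scale_induct)
    case start
    then show ?case using init by blast
  next
    case (jump t)
    then show ?case using assms(6) by blast
  next
    case (dense t)
    have "eventually (\<lambda>s. 0 \<le> f i s) (at t within X \<inter> {t<..})" if i: "i \<in> I" for i
    proof (cases "f i t = 0")
      case True
      then obtain D where D: "D > 0" "(f i has_real_derivative D) (at t within X)"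
        using assms(7)[OF i dense.hyps] dense.IH by auto
      obtain d where "d > 0" and d: "\<And>h. h > 0 \<Longrightarrow> t + h \<in> X \<Longrightarrow> h < d \<Longrightarrow> f i t < f i (t + h)"
        using has_real_derivative_pos_inc_right[OF D(2,1)] by blast
      have "0 \<le> f i s" if "s \<in> X" "t < s" "dist s t < d" for s
        using d[of "s - t"] that True by (auto simp: dist_real_def)
      then show ?thesis unfolding eventually_at using \<open>d > 0\<close> by auto
    next
      case False
      then have "0 < f i t" using dense.IH i by force
      have "(f i \<longlongrightarrow> f i t) (at t within X \<inter> {t<..})"
        using cont[OF i dense.hyps(1)] unfolding continuous_within
        by (rule tendsto_within_subset) auto
      then have "eventually (\<lambda>s. 0 < f i s) (at t within X \<inter> {t<..})"
        using \<open>0 < f i t\<close> by (rule order_tendstoD)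
      then show ?thesis by (rule eventually_mono) auto
    qed
    then have "eventually (\<lambda>s. \<forall>i\<in>I. 0 \<le> f i s) (at t within X \<inter> {t<..})"
      using \<open>finite I\<close> by (simp add: eventually_ball_finite)
    then obtain d where "d > 0"
      and d: "\<And>s. s \<in> X \<inter> {t<..} \<Longrightarrow> s \<noteq> t \<Longrightarrow> dist s t < d \<Longrightarrow> \<forall>i\<in>I. 0 \<le> f i s"
      unfolding eventually_at by blast
    have "\<forall>i\<in>I. 0 \<le> f i s" if "s \<in> X" "t < s" "s < t + d" for s
      using that by (intro d) (auto simp: dist_real_def)
    then show ?case using \<open>d > 0\<close> by blast
  next
    case (limit t)
    show ?case
    proof (rule ballI, rule ccontr)
      fix i assume i: "i \<in> I" "\<not> 0 \<le> f i t"
      have "(f i \<longlongrightarrow> f i t) (at t within X)"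
        using cont[OF i(1) limit.hyps(1)] by (simp add: continuous_within)
      then have "eventually (\<lambda>s. f i s < 0) (at t within X)"
        using i(2) by (intro order_tendstoD) auto
      then obtain d where "d > 0" and d: "\<And>s. s \<in> X \<Longrightarrow> s \<noteq> t \<Longrightarrow> dist s t < d \<Longrightarrow> f i s < 0"
        unfolding eventually_at by blast
      obtain s where "s \<in> X" "t - d < s" "s < t" using limit.hyps(2)[OF \<open>d > 0\<close>] by blast
      then show False using d[of s] limit.IH[of s] i by (force simp: dist_real_def)
    qed
  qed
  then show ?thesis using \<open>i \<in> I\<close> by blast
qed

end

section \<open>Existence of solutions\<close>

context half_time_scale
begin

text \<open>The delta integral over the scale is the ordinary integral of the step extension
  \<open>u \<mapsto> f (pred_point u)\<close>, so \<open>ts_poly k\<close> is the generalised Taylor monomial at \<open>t0\<close>.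
  All integrands are nondecreasing, hence integrable.\<close>

definition pred_point :: "real \<Rightarrow> real" where
  "pred_point s = Sup (X \<inter> {..s})"

primrec ts_poly :: "nat \<Rightarrow> real \<Rightarrow> real" where
  "ts_poly 0 s = 1"
| "ts_poly (Suc k) s = integral {t0..s} (\<lambda>u. ts_poly k (pred_point u))"

lemma pred_point_le: "t0 \<le> s \<Longrightarrow> pred_point s \<le> s"
  unfolding pred_point_def using start_in by (intro cSup_least) auto

lemma pred_point_ge: "t \<in> X \<Longrightarrow> t \<le> s \<Longrightarrow> t \<le> pred_point s"
  unfolding pred_point_def by (rule cSup_upper) (auto intro: bdd_aboveI[of _ s])

lemma pred_point_mono: "t0 \<le> s \<Longrightarrow> s \<le> u \<Longrightarrow> pred_point s \<le> pred_point u"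
  unfolding pred_point_def using start_in
  by (intro cSup_subset_mono) (auto intro: bdd_aboveI[of _ u])

lemma pred_point_gap:
  assumes "t \<in> X" "t \<le> s" "s < fjump X t"
  shows "pred_point s = t"
  unfolding pred_point_def using assms fjump_le[of _ t]
  by (intro cSup_eq_maximum) (auto simp: not_le[symmetric], meson leD le_less_trans not_le_imp_less)

text \<open>Both properties go into one induction: monotonicity makes the next integrand integrable,
  and nonnegativity makes its integral monotone.\<close>

lemma ts_poly_mono_nonneg:
  "mono_on {t0..} (ts_poly k) \<and> (\<forall>s\<ge>t0. 0 \<le> ts_poly k s)"
proof (induction k)
  case 0
  then show ?case by (simp add: mono_on_def)
next
  case (Suc k)
  let ?g = "\<lambda>u. ts_poly k (pred_point u)"
  have ge: "t0 \<le> pred_point u" if "t0 \<le> u" for u using pred_point_ge[OF start_in that] .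
  have mono: "mono_on {t0..} ?g"
    using Suc ge pred_point_mono by (auto simp: mono_on_def)
  have int: "?g integrable_on {a..b}" if "t0 \<le> a" for a b
    by (rule integrable_on_mono_on, rule mono_on_subset[OF mono]) (use that in auto)
  have nonneg: "0 \<le> ?g u" if "t0 \<le> u" for u using Suc ge[OF that] by simp
  have "ts_poly (Suc k) s \<le> ts_poly (Suc k) u" if "t0 \<le> s" "s \<le> u" for s u
  proof -
    have "integral {t0..s} ?g + integral {s..u} ?g = integral {t0..u} ?g"
      by (rule Henstock_Kurzweil_Integration.integral_combine) (use that int in auto)
    moreover have "0 \<le> integral {s..u} ?g"
      by (rule integral_nonneg[OF int]) (use that nonneg in auto)
    ultimately show ?thesis by simp
  qed
  moreover have "0 \<le> ts_poly (Suc k) s" if "t0 \<le> s" for s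
    unfolding ts_poly.simps by (rule integral_nonneg[OF int]) (use nonneg in auto)
  ultimately show ?case by (auto simp: mono_on_def simp del: ts_poly.simps)
qed

lemma ts_poly_mono: "t0 \<le> s \<Longrightarrow> s \<le> u \<Longrightarrow> ts_poly k s \<le> ts_poly k u"
  using ts_poly_mono_nonneg[of k] by (auto simp: mono_on_def)

lemma ts_poly_nonneg: "t0 \<le> s \<Longrightarrow> 0 \<le> ts_poly k s"
  using ts_poly_mono_nonneg[of k] by auto

lemma ts_poly_integrable: "t0 \<le> a \<Longrightarrow> (\<lambda>u. ts_poly k (pred_point u)) integrable_on {a..b}"
  by (rule integrable_on_mono_on)
    (auto simp: mono_on_def intro!: ts_poly_mono pred_point_mono pred_point_ge[OF start_in])

lemma ts_poly_diff:
  assumes "t0 \<le> t" "t \<le> s"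
  shows "ts_poly (Suc k) s - ts_poly (Suc k) t = integral {t..s} (\<lambda>u. ts_poly k (pred_point u))"
  using Henstock_Kurzweil_Integration.integral_combine[OF assms ts_poly_integrable[of t0 k s]] by simp

text \<open>The integrand is nondecreasing and its argument \<open>pred_point u\<close> stays
  between t and s, so the increment lies between two rectangles.\<close>

lemma ts_poly_diff_bounds:
  assumes "t \<in> X" "s \<in> X" "t \<le> s"
  shows "(s - t) * ts_poly k t \<le> ts_poly (Suc k) s - ts_poly (Suc k) t"
    and "ts_poly (Suc k) s - ts_poly (Suc k) t \<le> (s - t) * ts_poly k s"
proof -
  have t0: "t0 \<le> t" using start_le assms by blast
  have "integral {t..s} (\<lambda>u. ts_poly k t) \<le> integral {t..s} (\<lambda>u. ts_poly k (pred_point u))"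
    using t0 assms by (intro integral_le ts_poly_integrable ts_poly_mono pred_point_ge) auto
  then show "(s - t) * ts_poly k t \<le> ts_poly (Suc k) s - ts_poly (Suc k) t"
    using ts_poly_diff[OF t0 assms(3)] assms by (simp del: ts_poly.simps)
  have "integral {t..s} (\<lambda>u. ts_poly k (pred_point u)) \<le> integral {t..s} (\<lambda>u. ts_poly k s)"
    using t0 assms pred_point_le pred_point_ge[OF start_in]
    by (intro integral_le ts_poly_integrable ts_poly_mono) (auto intro: order_trans)
  then show "ts_poly (Suc k) s - ts_poly (Suc k) t \<le> (s - t) * ts_poly k s"
    using ts_poly_diff[OF t0 assms(3)] assms by (simp del: ts_poly.simps)
qed

lemma ts_poly_jump:
  assumes "t \<in> X"
  shows "ts_poly (Suc k) (fjump X t) = ts_poly (Suc k) t + graininess X t * ts_poly k t"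
proof -
  have "integral {t..fjump X t} (\<lambda>u. ts_poly k (pred_point u)) = integral {t..fjump X t} (\<lambda>u. ts_poly k t)"
    \<comment> \<open>On the gap the step extension is constant; only the right endpoint, a null
      set, can take another value.\<close>
    by (rule integral_spike[of "{fjump X t}"]) (use pred_point_gap[OF assms] in auto)
  then show ?thesis
    using ts_poly_diff[OF start_le[OF assms] fjump_ge, of k] fjump_ge[of t]
    by (simp add: graininess_def del: ts_poly.simps)
qed

text \<open>Since \<open>pred_point u\<close> is at most u, replacing it by u only enlarges each
  integral, and the iterated integrals become the ordinary Taylor monomials. This yields convergence
  for all geometrically bounded coefficients.\<close>

lemma ts_poly_le: "t0 \<le> s \<Longrightarrow> ts_poly k s \<le> (s - t0) ^ k / fact k"
proof (induction k arbitrary: s)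
  case 0
  then show ?case by simp
next
  case (Suc k)
  have "((\<lambda>u. (u - t0) ^ k / fact k) has_integral
      ((s - t0) ^ Suc k / fact (Suc k) - (t0 - t0) ^ Suc k / fact (Suc k))) {t0..s}"
    using Suc.prems
  proof (rule fundamental_theorem_of_calculus)
    fix x assume "x \<in> {t0..s}"
    have "((\<lambda>u. u - t0) has_real_derivative 1) (at x within {t0..s})"
      by (auto intro!: derivative_eq_intros)
    from DERIV_cdivide[OF DERIV_power[OF this, of "Suc k"], of "fact (Suc k)"]
    have "((\<lambda>u. (u - t0) ^ Suc k / fact (Suc k)) has_real_derivative (x - t0) ^ k / fact k)
        (at x within {t0..s})"
      by (simp add: fact_Suc del: of_nat_Suc power_Suc)
    then show "((\<lambda>u. (u - t0) ^ Suc k / fact (Suc k)) has_vector_derivative (x - t0) ^ k / fact k)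
        (at x within {t0..s})"
      by (simp add: has_real_derivative_iff_has_vector_derivative)
  qed
  then have I: "((\<lambda>u. (u - t0) ^ k / fact k) has_integral (s - t0) ^ Suc k / fact (Suc k)) {t0..s}"
    by simp
  have "ts_poly (Suc k) s \<le> integral {t0..s} (\<lambda>u. (u - t0) ^ k / fact k)"
    unfolding ts_poly.simps
  proof (rule integral_le[OF ts_poly_integrable has_integral_integrable[OF I]])
    fix u assume "u \<in> {t0..s}"
    then show "ts_poly k (pred_point u) \<le> (u - t0) ^ k / fact k"
      using Suc.IH[of u] ts_poly_mono[of "pred_point u" u k] pred_point_ge[OF start_in, of u] pred_point_le[of u]
      by auto
  qed simp
  then show ?case unfolding integral_unique[OF I] .
qed

text \<open>On a real half-line this is the exponential generating series of c. Delta
  differentiation shifts c by one, so a linear equation turns into a recursion for the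
  coefficients.\<close>

definition ts_series :: "(nat \<Rightarrow> real) \<Rightarrow> real \<Rightarrow> real" where
  "ts_series c s = (\<Sum>k. c k * ts_poly k s)"

lemma ts_series_summable:
  assumes "\<And>k. \<bar>c k\<bar> \<le> C * m ^ k" "t0 \<le> s"
  shows "summable (\<lambda>k. c k * ts_poly k s)"
proof (rule summable_comparison_test')
  show "summable (\<lambda>k. C * (inverse (fact k) * (m * (s - t0)) ^ k))"
    by (intro summable_mult summable_exp)
  fix k :: nat
  have "norm (c k * ts_poly k s) \<le> (C * m ^ k) * ((s - t0) ^ k / fact k)"
    unfolding norm_mult using assms ts_poly_le ts_poly_nonneg
    by (intro mult_mono) (auto intro: order_trans[OF abs_ge_zero])
  then show "norm (c k * ts_poly k s) \<le> C * (inverse (fact k) * (m * (s - t0)) ^ k)"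
    by (simp only: power_mult_distrib divide_inverse mult_ac)
qed

lemma ts_series_start: "ts_series c t0 = c 0"
proof -
  have "ts_poly k t0 = 0" if "k \<noteq> 0" for k using that by (cases k) auto
  then have "(\<lambda>k. c k * ts_poly k t0) = (\<lambda>k. if k = 0 then c 0 else 0)" by auto
  then show ?thesis unfolding ts_series_def by (simp add: sums_single[THEN sums_unique, symmetric])
qed

lemma ts_series_diff:
  assumes c: "\<And>k. \<bar>c k\<bar> \<le> C * m ^ k" and "t0 \<le> s" "t0 \<le> t"
  shows "(\<lambda>k. c (Suc k) * (ts_poly (Suc k) t - ts_poly (Suc k) s)) sums (ts_series c t - ts_series c s)"
proof -
  have "(\<lambda>k. c k * ts_poly k t - c k * ts_poly k s) sums (ts_series c t - ts_series c s)"
    unfolding ts_series_def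
    by (intro sums_diff summable_sums ts_series_summable[OF c]) (use assms in auto)
  from sums_Suc_iff[THEN iffD2, of "\<lambda>k. c k * ts_poly k t - c k * ts_poly k s"] this
  show ?thesis by (simp add: right_diff_distrib del: ts_poly.simps(2))
qed

text \<open>The deviation from the linear term is at most hi - lo times the increment of
  \<open>ts_poly k\<close>, and that increment is itself bounded by hi - lo times a monomial of
  lower index; this is where the square comes from.\<close>

lemma ts_poly_taylor_bound:
  assumes "s \<in> X" "t \<in> X" "s \<le> R" "t \<le> R"
  shows "\<bar>ts_poly (Suc k) t - ts_poly (Suc k) s - (t - s) * ts_poly k t\<bar>
    \<le> (t - s)\<^sup>2 * ((R - t0) ^ (k - 1) / fact (k - 1))"
proof -
  define lo hi where "lo = min s t" and "hi = max s t"
  have lh: "lo \<in> X" "hi \<in> X" "lo \<le> hi" "hi \<le> R" "\<bar>t - s\<bar> = hi - lo"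
    using assms by (auto simp: lo_def hi_def min_def max_def)
  have "t0 \<le> lo" using start_le lh by blast
  have b: "(hi - lo) * ts_poly k lo \<le> ts_poly (Suc k) hi - ts_poly (Suc k) lo"
    "ts_poly (Suc k) hi - ts_poly (Suc k) lo \<le> (hi - lo) * ts_poly k hi"
    using ts_poly_diff_bounds[of lo hi k] lh by auto
  have "\<bar>ts_poly (Suc k) t - ts_poly (Suc k) s - (t - s) * ts_poly k t\<bar>
      \<le> (hi - lo) * (ts_poly k hi - ts_poly k lo)"
    using b ts_poly_mono[OF \<open>t0 \<le> lo\<close> lh(3), of k] lh(3) unfolding lo_def hi_def
    by (cases "s \<le> t") (auto simp: min_def max_def algebra_simps simp del: ts_poly.simps)
  also have "\<dots> \<le> (hi - lo) * ((hi - lo) * ((R - t0) ^ (k - 1) / fact (k - 1)))"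
  proof (rule mult_left_mono)
    show "ts_poly k hi - ts_poly k lo \<le> (hi - lo) * ((R - t0) ^ (k - 1) / fact (k - 1))"
    proof (cases k)
      \<comment> \<open>Here \<open>k - 1\<close> truncates to 0, and the increment of the constant
        monomial is zero.\<close>
      case 0
      then show ?thesis using lh by simp
    next
      case (Suc j)
      have "ts_poly j hi \<le> (hi - t0) ^ j / fact j" using ts_poly_le \<open>t0 \<le> lo\<close> lh by simp
      also have "\<dots> \<le> (R - t0) ^ j / fact j"
        using lh \<open>t0 \<le> lo\<close> by (intro divide_right_mono power_mono) auto
      finally have "(hi - lo) * ts_poly j hi \<le> (hi - lo) * ((R - t0) ^ j / fact j)"
        using lh by (intro mult_left_mono) auto
      then show ?thesis
        using ts_poly_diff_bounds(2)[OF lh(1,2,3), of j] Suc by (simp del: ts_poly.simps)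
    qed
  qed (use lh in auto)
  also have "\<dots> = (t - s)\<^sup>2 * ((R - t0) ^ (k - 1) / fact (k - 1))"
    using lh(5) by (metis mult.assoc power2_abs power2_eq_square)
  finally show ?thesis .
qed

text \<open>The termwise Taylor bounds add up to an exponential series, with a constant uniform in s
  and t up to R. The quadratic remainder is what justifies termwise delta differentiation.\<close>

lemma ts_series_taylor_bound:
  assumes c: "\<And>k. \<bar>c k\<bar> \<le> C * m ^ k"
  shows "\<exists>Q\<ge>0. \<forall>s\<in>X. \<forall>t\<in>X. s \<le> R \<longrightarrow> t \<le> R \<longrightarrow>
    \<bar>ts_series c t - ts_series c s - (t - s) * ts_series (\<lambda>k. c (Suc k)) t\<bar> \<le> Q * (t - s)\<^sup>2"
proof -
  have c': "\<bar>c (Suc k)\<bar> \<le> (C * m) * m ^ k" for k using c[of "Suc k"] by simp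
  define q where "q k = C * m ^ Suc k * ((R - t0) ^ (k - 1) / fact (k - 1))" for k
  have "q (Suc k) = (C * m\<^sup>2) * (inverse (fact k) * (m * (R - t0)) ^ k)" for k
    by (simp add: q_def power_mult_distrib power2_eq_square divide_inverse mult_ac)
  then have "summable (\<lambda>k. q (Suc k))"
    by (simp only:) (intro summable_mult summable_exp)
  then have q: "summable q" by (simp add: summable_Suc_iff)
  \<comment> \<open>The absolute value of the sum gives a nonnegative constant without inspecting
    the signs of C and m.\<close>
  have "\<bar>ts_series c t - ts_series c s - (t - s) * ts_series (\<lambda>k. c (Suc k)) t\<bar> \<le> \<bar>suminf q\<bar> * (t - s)\<^sup>2"
    if "s \<in> X" "t \<in> X" "s \<le> R" "t \<le> R" for s t
  proof -
    have t0: "t0 \<le> s" "t0 \<le> t" using start_le that by auto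
    have "(\<lambda>k. (t - s) * (c (Suc k) * ts_poly k t)) sums ((t - s) * ts_series (\<lambda>k. c (Suc k)) t)"
      unfolding ts_series_def by (intro sums_mult summable_sums ts_series_summable[OF c' t0(2)])
    from sums_diff[OF ts_series_diff[OF c t0] this]
    have S: "(\<lambda>k. c (Suc k) * (ts_poly (Suc k) t - ts_poly (Suc k) s - (t - s) * ts_poly k t)) sums
        (ts_series c t - ts_series c s - (t - s) * ts_series (\<lambda>k. c (Suc k)) t)"
      by (simp add: algebra_simps del: ts_poly.simps)
    have B: "norm (c (Suc k) * (ts_poly (Suc k) t - ts_poly (Suc k) s - (t - s) * ts_poly k t)) \<le> (t - s)\<^sup>2 * q k" for k
    proof -
      have "norm (c (Suc k) * (ts_poly (Suc k) t - ts_poly (Suc k) s - (t - s) * ts_poly k t))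
          \<le> (C * m ^ Suc k) * ((t - s)\<^sup>2 * ((R - t0) ^ (k - 1) / fact (k - 1)))"
        unfolding real_norm_def abs_mult
        using ts_poly_taylor_bound[OF that, of k] c[of "Suc k"]
        by (intro mult_mono) (auto intro: order_trans[OF abs_ge_zero] simp del: ts_poly.simps)
      then show ?thesis by (simp add: q_def mult_ac)
    qed
    have "norm (\<Sum>k. c (Suc k) * (ts_poly (Suc k) t - ts_poly (Suc k) s - (t - s) * ts_poly k t))
        \<le> (\<Sum>k. (t - s)\<^sup>2 * q k)"
      by (rule norm_suminf_le[OF B summable_mult[OF q]])
    also have "\<dots> = (t - s)\<^sup>2 * suminf q" by (rule suminf_mult[OF q])
    also have "\<dots> \<le> (t - s)\<^sup>2 * \<bar>suminf q\<bar>" by (intro mult_left_mono) auto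
    finally show ?thesis using sums_unique[OF S] by (simp add: mult.commute del: ts_poly.simps)
  qed
  then show ?thesis by (intro exI[of _ "\<bar>suminf q\<bar>"]) auto
qed

lemma ts_series_jump:
  assumes c: "\<And>k. \<bar>c k\<bar> \<le> C * m ^ k" and "t \<in> X"
  shows "ts_series c (fjump X t) = ts_series c t + graininess X t * ts_series (\<lambda>k. c (Suc k)) t"
proof -
  have c': "\<bar>c (Suc k)\<bar> \<le> (C * m) * m ^ k" for k using c[of "Suc k"] by simp
  have t0: "t0 \<le> t" "t0 \<le> fjump X t" using start_le assms fjump_in by auto
  have "(\<lambda>k. graininess X t * (c (Suc k) * ts_poly k t)) sums (graininess X t * ts_series (\<lambda>k. c (Suc k)) t)"
    unfolding ts_series_def by (intro sums_mult summable_sums ts_series_summable[OF c' t0(1)])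
  moreover have "(\<lambda>k. graininess X t * (c (Suc k) * ts_poly k t)) sums (ts_series c (fjump X t) - ts_series c t)"
    using ts_series_diff[OF c t0] by (simp add: ts_poly_jump[OF \<open>t \<in> X\<close>] mult_ac del: ts_poly.simps)
  ultimately show ?thesis using sums_unique2 by fastforce
qed

lemma ts_series_has_delta:
  assumes c: "\<And>k. \<bar>c k\<bar> \<le> C * m ^ k" and t: "t \<in> X"
  shows "has_delta X (ts_series c) (ts_series (\<lambda>k. c (Suc k)) t) t"
  unfolding has_delta_def
proof (intro conjI allI impI)
  fix e :: real assume "e > 0"
  define D where "D = ts_series (\<lambda>k. c (Suc k)) t"
  obtain Q where Q: "Q \<ge> 0" "\<And>s. s \<in> X \<Longrightarrow> s \<le> t + 1 \<Longrightarrow>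
      \<bar>ts_series c t - ts_series c s - (t - s) * D\<bar> \<le> Q * (t - s)\<^sup>2"
    using ts_series_taylor_bound[OF c, of "t + 1"] t unfolding D_def by auto
  \<comment> \<open>At a right-scattered t the window is no wider than the gap, so it contains no
    point after t; at a right-dense t the value 1 adds nothing to the bound already present in
    \<open>d\<close>.\<close>
  define g where "g = (if fjump X t = t then 1 else graininess X t)"
  have "g > 0" using fjump_ge[of t] by (auto simp: g_def graininess_def)
  define d where "d = min (min 1 g) (e / (Q + 1))"
  have "d > 0" using \<open>g > 0\<close> \<open>e > 0\<close> Q by (simp add: d_def)
  moreover have "norm (ts_series c (fjump X t) - ts_series c s - (fjump X t - s) *\<^sub>R D)
      \<le> e * \<bar>fjump X t - s\<bar>" if s: "s \<in> X" "\<bar>s - t\<bar> < d" for s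
  proof -
    have lt: "\<bar>s - t\<bar> < 1" "\<bar>s - t\<bar> < g" "\<bar>s - t\<bar> < e / (Q + 1)" using s by (auto simp: d_def)
    have le: "\<bar>t - s\<bar> \<le> \<bar>fjump X t - s\<bar>"
    proof (cases "s \<le> t \<or> fjump X t = t")
      case True
      then show ?thesis using fjump_ge[of t] by auto
    next
      case False
      then have "fjump X t \<le> s" using fjump_le[of s t] s by auto
      then show ?thesis using lt(2) False by (auto simp: g_def graininess_def)
    qed
    have "(Q + 1) * \<bar>t - s\<bar> \<le> e"
      using lt(3) Q(1) by (simp add: pos_less_divide_eq mult.commute abs_minus_commute)
    then have "Q * \<bar>t - s\<bar> \<le> e" by (simp add: algebra_simps)
    \<comment> \<open>The jump formula cancels \<open>fjump X t\<close> from the difference and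
      reduces the claim to the quadratic remainder at t.\<close>
    have "norm (ts_series c (fjump X t) - ts_series c s - (fjump X t - s) *\<^sub>R D)
        = \<bar>ts_series c t - ts_series c s - (t - s) * D\<bar>"
      unfolding ts_series_jump[OF c t] D_def[symmetric] by (simp add: graininess_def algebra_simps)
    also have "\<dots> \<le> Q * (t - s)\<^sup>2" using Q(2) s lt by auto
    also have "\<dots> = (Q * \<bar>t - s\<bar>) * \<bar>t - s\<bar>" by (simp add: power2_eq_square)
    also have "\<dots> \<le> e * \<bar>fjump X t - s\<bar>"
      using \<open>Q * \<bar>t - s\<bar> \<le> e\<close> le \<open>e > 0\<close> by (intro mult_mono) auto
    finally show ?thesis .
  qed
  ultimately show "\<exists>\<delta>>0. \<forall>s\<in>X. \<bar>s - t\<bar> < \<delta> \<longrightarrow>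
      norm (ts_series c (fjump X t) - ts_series c s - (fjump X t - s) *\<^sub>R ts_series (\<lambda>k. c (Suc k)) t)
      \<le> e * \<bar>fjump X t - s\<bar>"
    unfolding D_def by blast
qed (rule t)

end

lemma mult_mat_vec_sum:
  assumes "A \<in> carrier_mat m n" "v \<in> carrier_vec n" "i < m"
  shows "(A *\<^sub>v v) $ i = (\<Sum>j<n. A $$ (i, j) * v $ j)"
  using assms by (simp add: scalar_prod_def atLeast0LessThan)

lemma abs_entry_le_total:
  fixes A :: "real mat"
  assumes "i < n"
  shows "(\<Sum>j<n. \<bar>A $$ (i, j)\<bar>) \<le> (\<Sum>i<n. \<Sum>j<n. \<bar>A $$ (i, j)\<bar>)"
  using assms member_le_sum[of i "{..<n}" "\<lambda>i. \<Sum>j<n. \<bar>A $$ (i, j)\<bar>"] by (simp add: sum_nonneg)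

context half_time_scale
begin

text \<open>The solution is x0 plus the sum of A^j y h_(j+1), with y the initial derivative and h
  the generalised monomials. Input r = 0 yields the autonomous system; r = 1 serves to probe the
  sign of b.\<close>

lemma constant_input_solution:
  fixes A :: "real mat" and b x0 :: "real vec" and r :: real
  assumes A: "A \<in> carrier_mat n n" and b: "b \<in> carrier_vec n" and x0: "x0 \<in> carrier_vec n"
  obtains x where "x t0 = x0"
    and "\<And>t. t \<in> X \<Longrightarrow> x t \<in> carrier_vec n \<and> has_delta_vec X n x (A *\<^sub>v x t + r \<cdot>\<^sub>v b) t"
proof -
  define y where "y = A *\<^sub>v x0 + r \<cdot>\<^sub>v b"
  have y: "y \<in> carrier_vec n" using assms by (simp add: y_def)
  define c where "c k = (case k of 0 \<Rightarrow> x0 | Suc j \<Rightarrow> ((\<lambda>v. A *\<^sub>v v) ^^ j) y)" for k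
  have it: "((\<lambda>v. A *\<^sub>v v) ^^ j) y \<in> carrier_vec n" for j
    using A y by (induction j) auto
  have c: "c k \<in> carrier_vec n" for k using x0 it by (simp add: c_def split: nat.split)
  \<comment> \<open>Dominates every absolute row sum, so one application of A enlarges a bound on
    the entries by at most a factor m; the added 1 makes the powers of m nondecreasing.\<close>
  define m where "m = 1 + (\<Sum>i<n. \<Sum>j<n. \<bar>A $$ (i, j)\<bar>)"
  have m: "m \<ge> 1" by (simp add: m_def sum_nonneg)
  define Y where "Y = (\<Sum>i<n. \<bar>y $ i\<bar>)"
  define Y0 where "Y0 = (\<Sum>i<n. \<bar>x0 $ i\<bar>)"
  have Y: "Y \<ge> 0" "Y0 \<ge> 0" by (simp_all add: Y_def Y0_def sum_nonneg)
  have bound: "\<bar>((\<lambda>v. A *\<^sub>v v) ^^ j) y $ i\<bar> \<le> Y * m ^ j" if "i < n" for i j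
    using that
  proof (induction j arbitrary: i)
    case 0
    then show ?case
      using member_le_sum[of i "{..<n}" "\<lambda>i. \<bar>y $ i\<bar>"] by (simp add: Y_def)
  next
    case (Suc j)
    let ?v = "((\<lambda>v. A *\<^sub>v v) ^^ j) y"
    have "\<bar>(A *\<^sub>v ?v) $ i\<bar> \<le> (\<Sum>l<n. \<bar>A $$ (i, l) * ?v $ l\<bar>)"
      unfolding mult_mat_vec_sum[OF A it Suc.prems] by (rule sum_abs)
    also have "\<dots> \<le> (\<Sum>l<n. \<bar>A $$ (i, l)\<bar> * (Y * m ^ j))"
      using Suc.IH by (intro sum_mono) (auto simp: abs_mult intro!: mult_left_mono)
    also have "\<dots> \<le> m * (Y * m ^ j)"
      unfolding sum_distrib_right[symmetric] using abs_entry_le_total[OF Suc.prems, of A] m Y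
      by (intro mult_right_mono) (auto simp: m_def)
    finally show ?case by (simp add: mult_ac)
  qed
  have cb: "\<bar>c k $ i\<bar> \<le> (Y0 + Y) * m ^ k" if "i < n" for i k
  proof (cases k)
    case 0
    then show ?thesis
      using member_le_sum[of i "{..<n}" "\<lambda>i. \<bar>x0 $ i\<bar>"] that Y by (simp add: c_def Y0_def)
  next
    case (Suc j)
    have "\<bar>c k $ i\<bar> \<le> Y * m ^ j" using bound[OF that] Suc by (simp add: c_def)
    also have "\<dots> \<le> (Y0 + Y) * m ^ k"
      using Y m Suc by (intro mult_mono power_increasing) auto
    finally show ?thesis .
  qed
  define x where "x s = vec n (\<lambda>i. ts_series (\<lambda>k. c k $ i) s)" for s
  have "x t0 = x0"
    using x0 by (intro eq_vecI) (auto simp: x_def ts_series_start c_def)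
  moreover have "x t \<in> carrier_vec n \<and> has_delta_vec X n x (A *\<^sub>v x t + r \<cdot>\<^sub>v b) t" if t: "t \<in> X" for t
    unfolding has_delta_vec_def
  proof (intro conjI allI impI)
    show xc: "x t \<in> carrier_vec n" by (simp add: x_def)
    fix i assume i: "i < n"
    \<comment> \<open>The derivative has to reproduce A x + r b. Since the monomial of index 0 is
      the constant 1, the input enters only for k = 0.\<close>
    have step: "c (Suc k) $ i = (\<Sum>j<n. A $$ (i, j) * c k $ j) + (if k = 0 then r * b $ i else 0)" for k
    proof (cases k)
      case 0
      then show ?thesis
        using i A b x0 by (simp add: c_def y_def mult_mat_vec_sum[OF A x0 i, symmetric] del: index_mult_mat_vec)
    next
      case (Suc l)
      then have "c (Suc k) $ i = (A *\<^sub>v c k) $ i" by (simp add: c_def)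
      then show ?thesis using mult_mat_vec_sum[OF A c i] Suc by simp
    qed
    have "(\<lambda>k. (\<Sum>j<n. A $$ (i, j) * (c k $ j * ts_poly k t)) + (if k = 0 then r * b $ i else 0)) sums
        ((\<Sum>j<n. A $$ (i, j) * ts_series (\<lambda>k. c k $ j) t) + r * b $ i)"
      unfolding ts_series_def
      by (intro sums_add sums_sum sums_mult summable_sums ts_series_summable[OF cb start_le[OF t]]
          sums_single[of 0 "\<lambda>_. r * b $ i"]) auto
    moreover have "(\<Sum>j<n. A $$ (i, j) * (c k $ j * ts_poly k t)) + (if k = 0 then r * b $ i else 0)
        = c (Suc k) $ i * ts_poly k t" for k
      by (cases "k = 0") (simp_all add: step sum_distrib_right mult.assoc)
    ultimately have "(\<lambda>k. c (Suc k) $ i * ts_poly k t) sums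
        ((\<Sum>j<n. A $$ (i, j) * ts_series (\<lambda>k. c k $ j) t) + r * b $ i)" by (simp only:)
    then have "ts_series (\<lambda>k. c (Suc k) $ i) t = (\<Sum>j<n. A $$ (i, j) * ts_series (\<lambda>k. c k $ j) t) + r * b $ i"
      unfolding ts_series_def by (rule sums_unique[symmetric])
    also have "\<dots> = (A *\<^sub>v x t + r \<cdot>\<^sub>v b) $ i"
      using i A b mult_mat_vec_sum[OF A xc i] by (simp add: x_def del: index_mult_mat_vec)
    finally have eq: "(A *\<^sub>v x t + r \<cdot>\<^sub>v b) $ i = ts_series (\<lambda>k. c (Suc k) $ i) t" by simp
    have "(\<lambda>s. x s $ i) = ts_series (\<lambda>k. c k $ i)" using i by (auto simp: x_def)
    then show "has_delta X (\<lambda>s. x s $ i) ((A *\<^sub>v x t + r \<cdot>\<^sub>v b) $ i) t"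
      using ts_series_has_delta[OF cb[OF i] t] unfolding eq by simp
  qed
  ultimately show thesis using that by blast
qed

section \<open>Comparison principles along solutions\<close>

lemma initial_delta_nonneg:
  fixes f :: "real \<Rightarrow> real"
  assumes D: "has_delta X f D t0" and "f t0 = 0" and nonneg: "\<And>t. t \<in> X \<Longrightarrow> 0 \<le> f t"
  shows "0 \<le> D"
proof (cases "fjump X t0 = t0")
  case True
  show ?thesis
  proof (rule ccontr)
    assume "\<not> 0 \<le> D"
    then have "\<exists>d>0. \<forall>h>0. t0 + h \<in> X \<longrightarrow> h < d \<longrightarrow> f (t0 + h) < f t0"
      using has_delta_dense[OF D True]
      by (intro has_real_derivative_neg_dec_right) (auto simp: has_real_derivative_iff_has_vector_derivative)
    then obtain d where "d > 0" and d: "\<And>h. h > 0 \<Longrightarrow> t0 + h \<in> X \<Longrightarrow> h < d \<Longrightarrow> f (t0 + h) < f t0" by blast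
    \<comment> \<open>Right-density of \<open>t0\<close> supplies later points arbitrarily close to
      it, where a negative derivative would make f negative.\<close>
    have "Inf {s \<in> X. s > t0} < t0 + d" using True \<open>d > 0\<close> by (simp add: fjump_eq)
    then obtain s where "s \<in> X" "t0 < s" "s < t0 + d"
      using cInf_lessD[OF later_nonempty] by blast
    then show False using d[of "s - t0"] nonneg[of s] \<open>f t0 = 0\<close> by simp
  qed
next
  case False
  then have "graininess X t0 > 0" using fjump_ge[of t0] by (simp add: graininess_def)
  moreover have "0 \<le> graininess X t0 * D"
    using has_delta_jump[OF D] nonneg[OF fjump_in[of t0]] \<open>f t0 = 0\<close> by simp
  ultimately show ?thesis by (simp add: zero_le_mult_iff)
qed

text \<open>Adding \<eta> exp(L(t - t0)) to each component produces the strict inequalities of the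
  barrier principle: off-diagonal entries push a vanishing component up, L exceeds every row sum,
  and at a jump I + \<mu>M is entrywise nonnegative. Then \<eta> is made small.\<close>

lemma solution_nonneg:
  assumes M: "M \<in> carrier_mat n n"
    and off: "\<And>i j. i < n \<Longrightarrow> j < n \<Longrightarrow> i \<noteq> j \<Longrightarrow> 0 \<le> M $$ (i, j)"
    and diag: "\<And>t j. t \<in> X \<Longrightarrow> j < n \<Longrightarrow> 0 \<le> 1 + graininess X t * M $$ (j, j)"
    and x: "\<And>t. t \<in> X \<Longrightarrow> x t \<in> carrier_vec n"
    and dx: "\<And>t. t \<in> X \<Longrightarrow> has_delta_vec X n x (M *\<^sub>v x t) t"
    and init: "\<And>i. i < n \<Longrightarrow> 0 \<le> x t0 $ i"
    and t: "t \<in> X" and i: "i < n"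
  shows "0 \<le> x t $ i"
proof -
  \<comment> \<open>The extra 1 leaves every row sum at most L - 1, which is the strictness used at
    right-dense points.\<close>
  define L where "L = 1 + (\<Sum>i<n. \<Sum>j<n. \<bar>M $$ (i, j)\<bar>)"
  have row: "(\<Sum>j<n. M $$ (i, j)) \<le> L - 1" if "i < n" for i
    using abs_entry_le_total[OF that, of M] sum_mono[of "{..<n}" "\<lambda>j. M $$ (i, j)" "\<lambda>j. \<bar>M $$ (i, j)\<bar>"]
    unfolding L_def by (smt (verit) abs_ge_self)
  have L: "L \<ge> 1" by (simp add: L_def sum_nonneg)
  have dxi: "has_delta X (\<lambda>s. x s $ i) (\<Sum>j<n. M $$ (i, j) * x t $ j) t" if "t \<in> X" "i < n" for t i
    using dx[OF that(1)] that(2) mult_mat_vec_sum[OF M x[OF that(1)] that(2)]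
    by (auto simp: has_delta_vec_def simp del: index_mult_mat_vec)
  have key: "0 \<le> x t $ i + \<eta> * exp (L * (t - t0))" if "\<eta> > 0" for \<eta>
  proof (rule barrier[where f = "\<lambda>i t. x t $ i + \<eta> * exp (L * (t - t0))" and I = "{..<n}"])
    fix i t assume it: "i \<in> {..<n}" "t \<in> X"
    show "continuous (at t within X) (\<lambda>t. x t $ i + \<eta> * exp (L * (t - t0)))"
      using has_delta_continuous[OF dxi[of t i]] it by (auto intro!: continuous_intros)
  next
    fix i assume "i \<in> {..<n}"
    then show "0 \<le> x t0 $ i + \<eta> * exp (L * (t0 - t0))" using init that by simp
  next
    fix i t assume it: "i \<in> {..<n}" "t \<in> X"
      and nn: "\<And>j. j \<in> {..<n} \<Longrightarrow> 0 \<le> x t $ j + \<eta> * exp (L * (t - t0))"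
    define E where "E = \<eta> * exp (L * (t - t0))"
    define \<mu> where "\<mu> = graininess X t"
    have \<mu>: "\<mu> \<ge> 0" "fjump X t = t + \<mu>"
      using graininess_nonneg by (auto simp: \<mu>_def graininess_def)
    have "E > 0" using that by (simp add: E_def)
    \<comment> \<open>Row i of I + \<mu>M, the one-step transition matrix at a jump.\<close>
    define a where "a j = (if j = i then 1 else 0) + \<mu> * M $$ (i, j)" for j
    have a: "0 \<le> a j" if "j < n" for j
      using off[of i j] diag[OF it(2), of j] that it \<mu> by (auto simp: a_def \<mu>_def)
    have "x (fjump X t) $ i = x t $ i + \<mu> * (\<Sum>j<n. M $$ (i, j) * x t $ j)"
      using has_delta_jump[OF dxi[of t i]] it by (simp add: \<mu>_def)
    also have "\<dots> = (\<Sum>j<n. a j * x t $ j)"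
      using it by (simp add: a_def distrib_right sum.distrib sum_distrib_left mult.assoc if_distrib[of "\<lambda>u. u * _"] cong: if_cong)
    also have "\<dots> \<ge> (\<Sum>j<n. a j * (- E))"
      using a nn by (intro sum_mono mult_left_mono) (force simp: E_def)+
    also have "(\<Sum>j<n. a j * (- E)) = - E * (1 + \<mu> * (\<Sum>j<n. M $$ (i, j)))"
      unfolding sum_distrib_right[symmetric] using it by (simp add: a_def sum.distrib sum_distrib_left)
    finally have "x (fjump X t) $ i \<ge> - E * (1 + \<mu> * (\<Sum>j<n. M $$ (i, j)))" .
    moreover have "E * (1 + \<mu> * (\<Sum>j<n. M $$ (i, j))) \<le> E * (1 + \<mu> * L)"
      using \<open>E > 0\<close> \<mu> row[of i] it by (intro mult_left_mono add_left_mono) auto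
    \<comment> \<open>Across the jump the perturbation grows by exp(L\<mu>), which is at least the 1
      + \<mu>L that the row sum can consume.\<close>
    moreover have "E * (1 + \<mu> * L) \<le> E * exp (L * \<mu>)"
      using \<open>E > 0\<close> exp_ge_add_one_self[of "L * \<mu>"] by (intro mult_left_mono) (auto simp: mult.commute)
    moreover have "\<eta> * exp (L * (fjump X t - t0)) = E * exp (L * \<mu>)"
      unfolding \<mu>(2) E_def by (simp add: exp_add[symmetric] algebra_simps)
    ultimately show "0 \<le> x (fjump X t) $ i + \<eta> * exp (L * (fjump X t - t0))" by simp
  next
    fix i t assume it: "i \<in> {..<n}" "t \<in> X" "fjump X t = t"
      and nn: "\<And>j. j \<in> {..<n} \<Longrightarrow> 0 \<le> x t $ j + \<eta> * exp (L * (t - t0))"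
      and z: "x t $ i + \<eta> * exp (L * (t - t0)) = 0"
    define E where "E = \<eta> * exp (L * (t - t0))"
    have "E > 0" using that by (simp add: E_def)
    define D where "D = (\<Sum>j<n. M $$ (i, j) * x t $ j)"
    have "((\<lambda>t. x t $ i) has_real_derivative D) (at t within X)"
      using has_delta_dense[OF dxi[of t i] it(3)] it
      by (simp add: has_real_derivative_iff_has_vector_derivative D_def)
    then have "((\<lambda>t. x t $ i + \<eta> * exp (L * (t - t0))) has_real_derivative D + L * E) (at t within X)"
      by (auto intro!: derivative_eq_intros simp: E_def)
    moreover have "D + L * E > 0"
    proof -
      \<comment> \<open>The summand j = i vanishes since component i sits on the barrier; all others
        involve nonnegative off-diagonal entries.\<close>
      have "0 \<le> (\<Sum>j<n. M $$ (i, j) * (x t $ j + E))"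
      proof (rule sum_nonneg)
        fix j assume "j \<in> {..<n}"
        then show "0 \<le> M $$ (i, j) * (x t $ j + E)"
          using off[of i j] nn[of j] z it by (cases "j = i") (auto simp: E_def)
      qed
      also have "\<dots> = D + (\<Sum>j<n. M $$ (i, j)) * E"
        by (simp add: D_def distrib_left sum.distrib sum_distrib_right)
      also have "\<dots> \<le> D + (L - 1) * E"
        using row[of i] it \<open>E > 0\<close> by (simp add: mult_right_mono)
      finally show ?thesis using \<open>E > 0\<close> by (simp add: algebra_simps)
    qed
    ultimately show "\<exists>D>0. ((\<lambda>t. x t $ i + \<eta> * exp (L * (t - t0))) has_real_derivative D) (at t within X)"
      by blast
  qed (use t i in auto)
  show ?thesis
  proof (rule ccontr)
    assume neg: "\<not> 0 \<le> x t $ i"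
    \<comment> \<open>With this \<eta> the perturbed value is half of \<open>x t $ i\<close>, hence
      still negative.\<close>
    then have "0 \<le> x t $ i + (- x t $ i / (2 * exp (L * (t - t0)))) * exp (L * (t - t0))"
      by (intro key) (simp add: field_simps)
    then show False using neg by simp
  qed
qed

text \<open>The comparison function is (y(t0) + \<eta>) exp(-\<epsilon>(t - t0)/2). Halving the rate
  leaves a strict gap between the derivatives at a right-dense contact, where \<eta> > 0 guarantees
  y > 0; at jumps 1 - \<epsilon>\<mu> lies below the exponential factor.\<close>

lemma exp_decay:
  fixes y :: "real \<Rightarrow> real"
  assumes "\<epsilon> > 0"
    and cont: "\<And>t. t \<in> X \<Longrightarrow> continuous (at t within X) y"
    and nonneg: "\<And>t. t \<in> X \<Longrightarrow> 0 \<le> y t"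
    and jump: "\<And>t. t \<in> X \<Longrightarrow> y (fjump X t) \<le> (1 - \<epsilon> * graininess X t) * y t"
    and dense: "\<And>t. t \<in> X \<Longrightarrow> fjump X t = t \<Longrightarrow>
      \<exists>D \<le> - \<epsilon> * y t. (y has_real_derivative D) (at t within X)"
    and t: "t \<in> X"
  shows "y t \<le> exp (- (\<epsilon> / 2) * (t - t0)) * y t0"
proof -
  have key: "0 \<le> (y t0 + \<eta>) * exp (- (\<epsilon> / 2) * (t - t0)) - y t" if "\<eta> > 0" for \<eta>
  proof (rule barrier[where f = "\<lambda>_ t. (y t0 + \<eta>) * exp (- (\<epsilon> / 2) * (t - t0)) - y t" and I = "{()}"])
    fix t assume "t \<in> X"
    then show "continuous (at t within X) (\<lambda>t. (y t0 + \<eta>) * exp (- (\<epsilon> / 2) * (t - t0)) - y t)"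
      using cont by (auto intro!: continuous_intros)
  next
    fix t assume t: "t \<in> X"
      and nn: "\<And>j. j \<in> {()} \<Longrightarrow> 0 \<le> (y t0 + \<eta>) * exp (- (\<epsilon> / 2) * (t - t0)) - y t"
    define \<mu> where "\<mu> = graininess X t"
    have \<mu>: "\<mu> \<ge> 0" "fjump X t = t + \<mu>"
      using graininess_nonneg by (auto simp: \<mu>_def graininess_def)
    have "y (fjump X t) \<le> (1 - \<epsilon> * \<mu>) * y t" using jump[OF t] by (simp add: \<mu>_def)
    also have "\<dots> \<le> exp (- (\<epsilon> / 2) * \<mu>) * y t"
    proof (rule mult_right_mono[OF _ nonneg[OF t]])
      have "1 - \<epsilon> * \<mu> \<le> 1 + - (\<epsilon> / 2) * \<mu>" using \<open>\<epsilon> > 0\<close> \<mu> by simp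
      then show "1 - \<epsilon> * \<mu> \<le> exp (- (\<epsilon> / 2) * \<mu>)"
        using exp_ge_add_one_self[of "- (\<epsilon> / 2) * \<mu>"] by linarith
    qed
    also have "\<dots> \<le> exp (- (\<epsilon> / 2) * \<mu>) * ((y t0 + \<eta>) * exp (- (\<epsilon> / 2) * (t - t0)))"
      using nn by (intro mult_left_mono) auto
    also have "\<dots> = (y t0 + \<eta>) * (exp (- (\<epsilon> / 2) * \<mu>) * exp (- (\<epsilon> / 2) * (t - t0)))"
      by (simp only: mult_ac)
    also have "\<dots> = (y t0 + \<eta>) * exp (- (\<epsilon> / 2) * (fjump X t - t0))"
      unfolding exp_add[symmetric] \<mu>(2) by (simp add: right_diff_distrib distrib_left add_divide_distrib diff_divide_distrib)
    finally show "0 \<le> (y t0 + \<eta>) * exp (- (\<epsilon> / 2) * (fjump X t - t0)) - y (fjump X t)" by simp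
  next
    fix t assume t: "t \<in> X" "fjump X t = t"
      and z: "(y t0 + \<eta>) * exp (- (\<epsilon> / 2) * (t - t0)) - y t = 0"
    obtain D where D: "D \<le> - \<epsilon> * y t" "(y has_real_derivative D) (at t within X)"
      using dense[OF t] by blast
    have 1: "((\<lambda>t. (y t0 + \<eta>) * exp (- (\<epsilon> / 2) * (t - t0)) - y t) has_real_derivative
        (y t0 + \<eta>) * (exp (- (\<epsilon> / 2) * (t - t0)) * - (\<epsilon> / 2)) - D) (at t within X)"
      by (auto intro!: derivative_eq_intros D(2))
    have 2: "(y t0 + \<eta>) * (exp (- (\<epsilon> / 2) * (t - t0)) * - (\<epsilon> / 2)) = - (\<epsilon> / 2) * y t"
      using z by (simp add: algebra_simps)
    have 3: "- (\<epsilon> / 2) * y t - D > 0"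
    proof -
      have "(y t0 + \<eta>) * exp (- (\<epsilon> / 2) * (t - t0)) > 0"
        using nonneg[OF start_in] that by (simp add: add_nonneg_pos)
      then have "y t > 0" using z by simp
      have "- \<epsilon> * y t = - (\<epsilon> / 2) * y t - (\<epsilon> / 2) * y t" by simp
      moreover have "(\<epsilon> / 2) * y t > 0" using \<open>y t > 0\<close> \<open>\<epsilon> > 0\<close> by simp
      ultimately show ?thesis using D(1) by linarith
    qed
    show "\<exists>D>0. ((\<lambda>t. (y t0 + \<eta>) * exp (- (\<epsilon> / 2) * (t - t0)) - y t) has_real_derivative D)
        (at t within X)"
      using 1 3 unfolding 2 by blast
  qed (use t that in auto)
  define E where "E = exp (- (\<epsilon> / 2) * (t - t0))"
  have "E > 0" by (simp add: E_def)
  have "y t \<le> E * y t0 + e" if "e > 0" for e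
  proof -
    have "0 \<le> (y t0 + e / E) * E - y t" unfolding E_def using that by (intro key) simp
    then show ?thesis using \<open>E > 0\<close> by (simp add: distrib_right distrib_left mult.commute)
  qed
  then show ?thesis unfolding E_def[symmetric] by (rule field_le_epsilon)
qed

lemma delta_nonneg_imp_ge_start:
  fixes y D :: "real \<Rightarrow> real"
  assumes dy: "\<And>t. t \<in> X \<Longrightarrow> has_delta X y (D t) t" and D: "\<And>t. t \<in> X \<Longrightarrow> 0 \<le> D t" and t: "t \<in> X"
  shows "y t0 \<le> y t"
proof -
  have key: "0 \<le> y t - y t0 + \<eta> * (t - t0)" if "\<eta> > 0" for \<eta>
  proof (rule barrier[where f = "\<lambda>_ t. y t - y t0 + \<eta> * (t - t0)" and I = "{()}"])
    fix t assume "t \<in> X"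
    then show "continuous (at t within X) (\<lambda>t. y t - y t0 + \<eta> * (t - t0))"
      using has_delta_continuous[OF dy] by (auto intro!: continuous_intros)
  next
    fix t assume t: "t \<in> X" "t < fjump X t" and nn: "\<And>j. j \<in> {()} \<Longrightarrow> 0 \<le> y t - y t0 + \<eta> * (t - t0)"
    have "y t \<le> y (fjump X t)"
      using has_delta_jump[OF dy[OF t(1)]] D[OF t(1)] graininess_nonneg[of t] by simp
    moreover have "\<eta> * (t - t0) \<le> \<eta> * (fjump X t - t0)"
      using that t by (intro mult_left_mono) auto
    ultimately show "0 \<le> y (fjump X t) - y t0 + \<eta> * (fjump X t - t0)" using nn by force
  next
    fix t assume t: "t \<in> X" "fjump X t = t"
    have "(y has_real_derivative D t) (at t within X)"
      using has_delta_dense[OF dy[OF t(1)] t(2)] by (simp add: has_real_derivative_iff_has_vector_derivative)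
    then have "((\<lambda>t. y t - y t0 + \<eta> * (t - t0)) has_real_derivative D t + \<eta>) (at t within X)"
      by (auto intro!: derivative_eq_intros)
    then show "\<exists>D>0. ((\<lambda>t. y t - y t0 + \<eta> * (t - t0)) has_real_derivative D) (at t within X)"
      using D[OF t(1)] that by (intro exI[of _ "D t + \<eta>"]) auto
  qed (use t that in auto)
  have "t - t0 \<ge> 0" using start_le[OF t] by simp
  have "y t0 \<le> y t + e" if "e > 0" for e
  proof -
    have "e / (t - t0 + 1) * (t - t0) \<le> e"
      using \<open>t - t0 \<ge> 0\<close> that by (simp add: field_simps)
    then show ?thesis using key[of "e / (t - t0 + 1)"] that \<open>t - t0 \<ge> 0\<close> by simp
  qed
  then show ?thesis by (rule field_le_epsilon)
qed

lemma exp_decay_eventually_less: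
  assumes "\<alpha> > 0" "\<delta> > 0"
  obtains t where "t \<in> X" "C * exp (- \<alpha> * (t - t0)) < \<delta>"
proof -
  \<comment> \<open>Beyond this point the linear lower bound of the exponential already dominates
    C.\<close>
  obtain t where t: "t \<in> X" "t > t0 + \<bar>C\<bar> / (\<delta> * \<alpha>)" using later_nonempty by blast
  then have "\<bar>C\<bar> < \<delta> * (\<alpha> * (t - t0))" using assms by (simp add: field_simps)
  also have "\<dots> \<le> \<delta> * exp (\<alpha> * (t - t0))"
    using assms exp_ge_add_one_self[of "\<alpha> * (t - t0)"] by (intro mult_left_mono) linarith+
  finally have "C < \<delta> * exp (\<alpha> * (t - t0))" by simp
  then have "C / exp (\<alpha> * (t - t0)) < \<delta>" by (simp add: pos_divide_less_eq)
  then have "C * exp (- \<alpha> * (t - t0)) < \<delta>" by (simp add: exp_minus divide_inverse)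
  then show thesis using that t by blast
qed

end

section \<open>Positive linear systems\<close>

lemma fjump_tsfrom: "t0 \<le> t \<Longrightarrow> fjump (tsfrom T t0) t = fjump T t"
proof -
  assume "t0 \<le> t"
  then have "{s \<in> tsfrom T t0. s > t} = {s \<in> T. s > t}" by (auto simp: tsfrom_def)
  then show ?thesis unfolding fjump_def by (simp only:)
qed

lemma tsfromD: "t \<in> tsfrom T t0 \<Longrightarrow> t \<in> T" "t \<in> tsfrom T t0 \<Longrightarrow> t0 \<le> t"
  by (auto simp: tsfrom_def)

lemma graininess_tsfrom: "t \<in> tsfrom T t0 \<Longrightarrow> graininess (tsfrom T t0) t = graininess T t"
  by (simp add: graininess_def fjump_tsfrom tsfromD(2))

lemma tsfrom_half_time_scale:
  assumes "time_scale T" "\<not> bdd_above T" "t0 \<in> T"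
  shows "half_time_scale (tsfrom T t0) t0"
proof
  have "tsfrom T t0 = T \<inter> {t0..}" by (auto simp: tsfrom_def)
  then show "closed (tsfrom T t0)" using assms(1) by (auto simp: time_scale_def)
  show "\<not> bdd_above (tsfrom T t0)"
  proof
    assume "bdd_above (tsfrom T t0)"
    then obtain B where "\<And>t. t \<in> tsfrom T t0 \<Longrightarrow> t \<le> B" by (auto simp: bdd_above_def)
    then have "t \<le> max B t0" if "t \<in> T" for t
      using that by (cases "t0 \<le> t") (force simp: tsfrom_def)+
    then show False using assms(2) by (auto simp: bdd_above_def)
  qed
qed (use assms in \<open>auto simp: tsfrom_def\<close>)

text \<open>The entrywise condition \<open>M + \<gamma>(T) I \<ge> 0\<close>, stated without dividing by the graininess.\<close>

definition ts_metzler :: "real set \<Rightarrow> nat \<Rightarrow> real mat \<Rightarrow> bool" where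
  "ts_metzler T n M \<longleftrightarrow> (\<forall>i<n. \<forall>j<n. i \<noteq> j \<longrightarrow> 0 \<le> M $$ (i, j)) \<and>
     (\<forall>t\<in>T. \<forall>j<n. 0 \<le> 1 + graininess T t * M $$ (j, j))"

lemma aut_sol_nonneg:
  assumes T: "time_scale T" "\<not> bdd_above T" and M: "M \<in> carrier_mat n n" "ts_metzler T n M"
    and "t0 \<in> T" "nonneg_vec n x0" "aut_sol T n M t0 x0 x" "t \<in> tsfrom T t0"
  shows "nonneg_vec n (x t)"
proof -
  interpret half_time_scale "tsfrom T t0" t0 by (rule tsfrom_half_time_scale) fact+
  have "0 \<le> x t $ i" if "i < n" for i
  proof (rule solution_nonneg[OF M(1)])
    show "0 \<le> 1 + graininess (tsfrom T t0) t * M $$ (j, j)" if "t \<in> tsfrom T t0" "j < n" for t j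
      using that M(2) tsfromD(1) by (auto simp: graininess_tsfrom ts_metzler_def)
  qed (use assms that in \<open>auto simp: ts_metzler_def aut_sol_def nonneg_vec_def\<close>)
  then show ?thesis using assms(7,8) by (auto simp: nonneg_vec_def aut_sol_def)
qed

lemma aut_sol_exists:
  assumes T: "time_scale T" "\<not> bdd_above T" and M: "M \<in> carrier_mat n n"
    and "t0 \<in> T" "x0 \<in> carrier_vec n"
  obtains x where "aut_sol T n M t0 x0 x"
proof -
  interpret half_time_scale "tsfrom T t0" t0 by (rule tsfrom_half_time_scale) fact+
  obtain x where x: "x t0 = x0" "\<And>t. t \<in> tsfrom T t0 \<Longrightarrow> x t \<in> carrier_vec n \<and>
      has_delta_vec (tsfrom T t0) n x (M *\<^sub>v x t + 0 \<cdot>\<^sub>v 0\<^sub>v n) t"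
    using constant_input_solution[OF M zero_carrier_vec assms(5), of 0] by blast
  have "M *\<^sub>v x t + 0 \<cdot>\<^sub>v 0\<^sub>v n = M *\<^sub>v x t" if "t \<in> tsfrom T t0" for t
    using M x(2)[OF that] by (intro eq_vecI) auto
  then have "aut_sol T n M t0 x0 x" using x by (auto simp: aut_sol_def)
  then show thesis by (rule that)
qed

text \<open>Necessity is read off from solutions that start at unit vectors: an off-diagonal entry
  is the initial derivative of a component starting at 0, and a diagonal entry shows in the first
  jump, x_j = 1 + \<mu> M_jj. Every point of T serves as initial time, so every graininess value is
  covered.\<close>

lemma positive_aut_iff:
  assumes T: "time_scale T" "\<not> bdd_above T" and M: "M \<in> carrier_mat n n"
  shows "positive_aut T n M \<longleftrightarrow> ts_metzler T n M"
proof
  assume "ts_metzler T n M"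
  then show "positive_aut T n M"
    unfolding positive_aut_def using aut_sol_nonneg[OF T M] by blast
next
  assume pos: "positive_aut T n M"
  have unit: "\<exists>x. aut_sol T n M t0 (unit_vec n j) x \<and> (\<forall>t\<in>tsfrom T t0. nonneg_vec n (x t))"
    if "t0 \<in> T" "j < n" for t0 j
  proof -
    obtain x where x: "aut_sol T n M t0 (unit_vec n j) x"
      using aut_sol_exists[OF T M \<open>t0 \<in> T\<close> unit_vec_carrier] by blast
    moreover have "nonneg_vec n (unit_vec n j)"
      using that by (auto simp: nonneg_vec_def)
    ultimately show ?thesis using pos that unfolding positive_aut_def by blast
  qed
  have col: "(M *\<^sub>v unit_vec n j) $ i = M $$ (i, j)" if "i < n" "j < n" for i j
    using that M by simp
  have start_delta: "has_delta (tsfrom T t0) (\<lambda>s. x s $ i) (M $$ (i, j)) t0"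
    if x: "aut_sol T n M t0 (unit_vec n j) x" and "t0 \<in> T" "i < n" "j < n" for t0 i j x
  proof -
    have "t0 \<in> tsfrom T t0" using \<open>t0 \<in> T\<close> by (simp add: tsfrom_def)
    then have "has_delta (tsfrom T t0) (\<lambda>s. x s $ i) ((M *\<^sub>v unit_vec n j) $ i) t0"
      using x \<open>i < n\<close> by (auto simp: aut_sol_def has_delta_vec_def)
    then show ?thesis unfolding col[OF that(3,4)] .
  qed
  show "ts_metzler T n M"
    unfolding ts_metzler_def
  proof (intro conjI allI impI ballI)
    fix i j assume ij: "i < n" "j < n" "i \<noteq> j"
    obtain t0 where t0: "t0 \<in> T" using T by (auto simp: time_scale_def)
    interpret half_time_scale "tsfrom T t0" t0 by (rule tsfrom_half_time_scale) fact+
    obtain x where x: "aut_sol T n M t0 (unit_vec n j) x" "\<And>t. t \<in> tsfrom T t0 \<Longrightarrow> nonneg_vec n (x t)"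
      using unit[OF t0 ij(2)] by blast
    show "0 \<le> M $$ (i, j)"
    proof (rule initial_delta_nonneg)
      show "has_delta (tsfrom T t0) (\<lambda>s. x s $ i) (M $$ (i, j)) t0"
        by (rule start_delta[OF x(1) t0 ij(1,2)])
      show "x t0 $ i = 0" using x(1) ij by (simp add: aut_sol_def)
    qed (use x(2) ij in \<open>auto simp: nonneg_vec_def\<close>)
  next
    fix t0 j assume t0: "t0 \<in> T" and j: "j < n"
    interpret half_time_scale "tsfrom T t0" t0 by (rule tsfrom_half_time_scale) fact+
    obtain x where x: "aut_sol T n M t0 (unit_vec n j) x" "\<And>t. t \<in> tsfrom T t0 \<Longrightarrow> nonneg_vec n (x t)"
      using unit[OF t0 j] by blast
    have "has_delta (tsfrom T t0) (\<lambda>s. x s $ j) (M $$ (j, j)) t0"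
      by (rule start_delta[OF x(1) t0 j j])
    from has_delta_jump[OF this]
    have "x (fjump (tsfrom T t0) t0) $ j = 1 + graininess T t0 * M $$ (j, j)"
      using x(1) j start_in by (simp add: aut_sol_def graininess_tsfrom)
    then show "0 \<le> 1 + graininess T t0 * M $$ (j, j)"
      using x(2)[OF fjump_in[of t0]] j by (metis nonneg_vec_def)
  qed
qed

text \<open>Zero control gives the autonomous system of A. From the zero state with u = 1 the
  initial derivative is b, and each component has its minimum at the start.\<close>

lemma positive_ctrl_system_imp:
  assumes T: "time_scale T" "\<not> bdd_above T" and A: "A \<in> carrier_mat n n" and b: "b \<in> carrier_vec n"
    and pos: "positive_ctrl_system T n A b"
  shows "ts_metzler T n A" and "\<And>i. i < n \<Longrightarrow> 0 \<le> b $ i"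
proof -
  have pw: "pw_cont T (\<lambda>_. r)" for r :: real
    unfolding pw_cont_def by (auto intro: tendsto_const finite.emptyI)
  have "positive_aut T n A"
    unfolding positive_aut_def
  proof (intro ballI allI impI, elim conjE)
    fix t0 x0 x t
    assume t: "t0 \<in> T" "t \<in> tsfrom T t0" and x0: "nonneg_vec n x0" and x: "aut_sol T n A t0 x0 x"
    have "A *\<^sub>v x s + 0 \<cdot>\<^sub>v b = A *\<^sub>v x s" for s
      using A b by (intro eq_vecI) auto
    then have "ctrl_sol T n A b (\<lambda>_. 0) t0 x0 x" using x by (simp add: ctrl_sol_def aut_sol_def)
    then show "nonneg_vec n (x t)"
      using pos[unfolded positive_ctrl_system_def, rule_format, of t0 "\<lambda>_. 0" x0 x t] pw[of 0] x0 t by simp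
  qed
  then show "ts_metzler T n A" using positive_aut_iff[OF T A] by simp
  fix i assume i: "i < n"
  obtain t0 where t0: "t0 \<in> T" using T by (auto simp: time_scale_def)
  interpret half_time_scale "tsfrom T t0" t0 by (rule tsfrom_half_time_scale) fact+
  obtain x where x: "x t0 = 0\<^sub>v n" "\<And>t. t \<in> tsfrom T t0 \<Longrightarrow> x t \<in> carrier_vec n \<and>
      has_delta_vec (tsfrom T t0) n x (A *\<^sub>v x t + 1 \<cdot>\<^sub>v b) t"
    using constant_input_solution[OF A b zero_carrier_vec, of 1] by blast
  then have "ctrl_sol T n A b (\<lambda>_. 1) t0 (0\<^sub>v n) x" by (simp add: ctrl_sol_def)
  moreover have "nonneg_vec n (0\<^sub>v n)" by (simp add: nonneg_vec_def)
  ultimately have nn: "nonneg_vec n (x t)" if "t \<in> tsfrom T t0" for t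
    using pos[unfolded positive_ctrl_system_def, rule_format, of t0 "\<lambda>_. 1" "0\<^sub>v n" x t] pw[of 1] t0 that by simp
  show "0 \<le> b $ i"
  proof (rule initial_delta_nonneg)
    have "(A *\<^sub>v x t0 + 1 \<cdot>\<^sub>v b) $ i = b $ i" using A b i x(1) by simp
    then show "has_delta (tsfrom T t0) (\<lambda>s. x s $ i) (b $ i) t0"
      using x(2)[OF start_in] i unfolding has_delta_vec_def by fastforce
    show "x t0 $ i = 0" using x(1) i by simp
  qed (use nn i in \<open>auto simp: nonneg_vec_def\<close>)
qed

section \<open>Stability and instability of positive systems\<close>

lemma vnorm_component_le:
  fixes x :: "real vec"
  assumes "i < dim_vec x"
  shows "\<bar>x $ i\<bar> \<le> vnorm x"
proof -
  have "\<bar>x $ i\<bar> = sqrt ((norm (x $ i))\<^sup>2)" by simp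
  also have "\<dots> \<le> vnorm x"
    unfolding vnorm_def using assms member_le_sum[of i "{..<dim_vec x}" "\<lambda>i. (norm (x $ i))\<^sup>2"]
    by (intro real_sqrt_le_mono) auto
  finally show ?thesis .
qed

lemma vnorm_le_sum_abs: "vnorm (x :: real vec) \<le> (\<Sum>i<dim_vec x. \<bar>x $ i\<bar>)"
  using L2_set_le_sum_abs[of "\<lambda>i. x $ i" "{..<dim_vec x}"] by (simp add: vnorm_def L2_set_def)

lemma vnorm_nonneg: "0 \<le> vnorm x"
  by (simp add: vnorm_def sum_nonneg)

lemma finite_pos_lower_bound:
  fixes f :: "nat \<Rightarrow> real"
  assumes "\<And>i. i < n \<Longrightarrow> 0 < f i"
  obtains e where "e > 0" "\<And>i. i < n \<Longrightarrow> e \<le> f i"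
proof
  show "Min (insert 1 (f ` {..<n})) > 0" using assms by (subst Min_gr_iff) auto
qed auto

lemma has_delta_sum:
  fixes f :: "nat \<Rightarrow> real \<Rightarrow> real"
  assumes "t \<in> X" and f: "\<And>i. i < n \<Longrightarrow> has_delta X (f i) (D i) t"
  shows "has_delta X (\<lambda>s. \<Sum>i<n. w i * f i s) (\<Sum>i<n. w i * D i) t"
  unfolding has_delta_def
proof (intro conjI allI impI)
  fix e :: real assume "e > 0"
  define W where "W = (\<Sum>i<n. \<bar>w i\<bar>) + 1"
  have "W > 0" by (simp add: W_def sum_nonneg add_nonneg_pos)
  then have "e / W > 0" using \<open>e > 0\<close> by simp
  then have "\<forall>i\<in>{..<n}. \<exists>d>0. \<forall>s\<in>X. \<bar>s - t\<bar> < d \<longrightarrow>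
      norm (f i (fjump X t) - f i s - (fjump X t - s) *\<^sub>R D i) \<le> e / W * \<bar>fjump X t - s\<bar>"
    using f unfolding has_delta_def by blast
  then obtain d where d: "\<And>i. i < n \<Longrightarrow> d i > 0" "\<And>i s. i < n \<Longrightarrow> s \<in> X \<Longrightarrow> \<bar>s - t\<bar> < d i \<Longrightarrow>
      norm (f i (fjump X t) - f i s - (fjump X t - s) *\<^sub>R D i) \<le> e / W * \<bar>fjump X t - s\<bar>"
    unfolding bchoice_iff by auto
  obtain d0 where d0: "d0 > 0" "\<And>i. i < n \<Longrightarrow> d0 \<le> d i" using finite_pos_lower_bound[of n d] d(1) by blast
  have "norm ((\<Sum>i<n. w i * f i (fjump X t)) - (\<Sum>i<n. w i * f i s) - (fjump X t - s) *\<^sub>R (\<Sum>i<n. w i * D i))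
      \<le> e * \<bar>fjump X t - s\<bar>" if s: "s \<in> X" "\<bar>s - t\<bar> < d0" for s
  proof -
    have "(\<Sum>i<n. w i * f i (fjump X t)) - (\<Sum>i<n. w i * f i s) - (fjump X t - s) *\<^sub>R (\<Sum>i<n. w i * D i)
        = (\<Sum>i<n. w i * (f i (fjump X t) - f i s - (fjump X t - s) *\<^sub>R D i))"
      by (simp add: sum_distrib_left sum_subtractf[symmetric] algebra_simps)
    also have "norm \<dots> \<le> (\<Sum>i<n. \<bar>w i\<bar> * (e / W * \<bar>fjump X t - s\<bar>))"
    proof (rule sum_norm_le)
      fix i assume "i \<in> {..<n}"
      then have i: "i < n" "\<bar>s - t\<bar> < d i" using d0(2)[of i] s by auto
      show "norm (w i * (f i (fjump X t) - f i s - (fjump X t - s) *\<^sub>R D i)) \<le> \<bar>w i\<bar> * (e / W * \<bar>fjump X t - s\<bar>)"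
        unfolding norm_mult real_norm_def[of "w i"] by (rule mult_left_mono[OF d(2)[OF i(1) s(1) i(2)]]) simp
    qed
    also have "\<dots> = (W - 1) * (e / W * \<bar>fjump X t - s\<bar>)"
      unfolding sum_distrib_right[symmetric] by (simp add: W_def)
    also have "\<dots> \<le> W * (e / W * \<bar>fjump X t - s\<bar>)"
      using \<open>W > 0\<close> \<open>e > 0\<close> by (intro mult_right_mono) auto
    also have "\<dots> = e * \<bar>fjump X t - s\<bar>" using \<open>W > 0\<close> by simp
    finally show ?thesis .
  qed
  then show "\<exists>\<delta>>0. \<forall>s\<in>X. \<bar>s - t\<bar> < \<delta> \<longrightarrow> norm ((\<Sum>i<n. w i * f i (fjump X t)) - (\<Sum>i<n. w i * f i s)
      - (fjump X t - s) *\<^sub>R (\<Sum>i<n. w i * D i)) \<le> e * \<bar>fjump X t - s\<bar>"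
    using d0(1) by blast
qed (rule assms(1))

text \<open>Reduces the vector system to a scalar one: column inequalities for w^T M become
  delta-differential inequalities for w^T x.\<close>

lemma aut_sol_functional:
  assumes M: "M \<in> carrier_mat n n" and x: "aut_sol T n M t0 x0 x" and t: "t \<in> tsfrom T t0"
  shows "has_delta (tsfrom T t0) (\<lambda>s. \<Sum>i<n. w i * x s $ i) (\<Sum>j<n. (\<Sum>i<n. w i * M $$ (i, j)) * x t $ j) t"
proof -
  have xt: "x t \<in> carrier_vec n" using x t by (simp add: aut_sol_def)
  have "has_delta (tsfrom T t0) (\<lambda>s. \<Sum>i<n. w i * x s $ i) (\<Sum>i<n. w i * (M *\<^sub>v x t) $ i) t"
    using x t by (intro has_delta_sum) (auto simp: aut_sol_def has_delta_vec_def)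
  also have "(\<Sum>i<n. w i * (M *\<^sub>v x t) $ i) = (\<Sum>i<n. \<Sum>j<n. w i * M $$ (i, j) * x t $ j)"
    using mult_mat_vec_sum[OF M xt] by (simp add: sum_distrib_left mult.assoc del: index_mult_mat_vec)
  also have "\<dots> = (\<Sum>j<n. (\<Sum>i<n. w i * M $$ (i, j)) * x t $ j)"
    by (subst sum.swap) (simp add: sum_distrib_right)
  finally show ?thesis .
qed

text \<open>On the nonnegative orthant w^T x is equivalent to the norm, and its delta derivative w^T
  M x is at most -\<epsilon> w^T x.\<close>

lemma metzler_stable:
  fixes w :: "nat \<Rightarrow> real"
  assumes T: "time_scale T" "\<not> bdd_above T" and M: "M \<in> carrier_mat n n" "ts_metzler T n M"
    and w: "\<And>i. i < n \<Longrightarrow> 0 < w i" and "\<epsilon> > 0"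
    and dec: "\<And>j. j < n \<Longrightarrow> (\<Sum>i<n. w i * M $$ (i, j)) \<le> - \<epsilon> * w j"
  shows "pos_unif_exp_stable T n M"
proof -
  obtain e where e: "e > 0" "\<And>i. i < n \<Longrightarrow> e \<le> w i" using finite_pos_lower_bound[of n w] w by blast
  define W where "W = (\<Sum>i<n. w i)"
  \<comment> \<open>Ratio of the equivalence constants in e |x| \<le> w^T x \<le> W |x| on the
    orthant; the definition of stability asks for a constant of at least 1.\<close>
  define K where "K = max 1 (W / e)"
  have main: "vnorm (x t) \<le> K * exp (- (\<epsilon> / 2) * (t - t0)) * vnorm x0"
    if t0: "t0 \<in> T" and x0: "nonneg_vec n x0" and x: "aut_sol T n M t0 x0 x" and t: "t \<in> tsfrom T t0"
    for t0 x0 x t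
  proof -
    interpret half_time_scale "tsfrom T t0" t0 by (rule tsfrom_half_time_scale) fact+
    have nn: "nonneg_vec n (x t)" if "t \<in> tsfrom T t0" for t
      by (rule aut_sol_nonneg[OF T M t0 x0 x that])
    define y where "y s = (\<Sum>i<n. w i * x s $ i)" for s
    have D: "has_delta (tsfrom T t0) y (\<Sum>j<n. (\<Sum>i<n. w i * M $$ (i, j)) * x t $ j) t" if "t \<in> tsfrom T t0" for t
      unfolding y_def by (rule aut_sol_functional[OF M(1) x that])
    have Dle: "(\<Sum>j<n. (\<Sum>i<n. w i * M $$ (i, j)) * x t $ j) \<le> - \<epsilon> * y t" if "t \<in> tsfrom T t0" for t
    proof -
      have "(\<Sum>j<n. (\<Sum>i<n. w i * M $$ (i, j)) * x t $ j) \<le> (\<Sum>j<n. (- \<epsilon> * w j) * x t $ j)"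
        using dec nn[OF that] by (intro sum_mono mult_right_mono) (auto simp: nonneg_vec_def)
      then show ?thesis by (simp add: y_def sum_distrib_left sum_negf mult.assoc)
    qed
    have "y t \<le> exp (- (\<epsilon> / 2) * (t - t0)) * y t0"
    proof (rule exp_decay[OF \<open>\<epsilon> > 0\<close>])
      fix t assume t: "t \<in> tsfrom T t0"
      show "continuous (at t within tsfrom T t0) y" by (rule has_delta_continuous[OF D[OF t]])
      show "0 \<le> y t"
        unfolding y_def using nn[OF t] w by (intro sum_nonneg mult_nonneg_nonneg) (auto simp: nonneg_vec_def less_imp_le)
      show "y (fjump (tsfrom T t0) t) \<le> (1 - \<epsilon> * graininess (tsfrom T t0) t) * y t"
        using has_delta_jump[OF D[OF t]] mult_left_mono[OF Dle[OF t] graininess_nonneg[of t]]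
        by (simp add: algebra_simps)
      assume "fjump (tsfrom T t0) t = t"
      from has_delta_dense[OF D[OF t] this]
      have "(y has_real_derivative (\<Sum>j<n. (\<Sum>i<n. w i * M $$ (i, j)) * x t $ j)) (at t within tsfrom T t0)"
        by (simp only: has_real_derivative_iff_has_vector_derivative)
      with Dle[OF t] show "\<exists>D\<le>- \<epsilon> * y t. (y has_real_derivative D) (at t within tsfrom T t0)"
        by (intro exI conjI)
    qed (rule t)
    have dim: "dim_vec (x t) = n" "dim_vec x0 = n" "x t0 = x0"
      using nn[OF t] x0 x by (auto simp: nonneg_vec_def aut_sol_def)
    have "e * vnorm (x t) \<le> e * (\<Sum>i<n. \<bar>x t $ i\<bar>)"
      using vnorm_le_sum_abs[of "x t"] dim e by (intro mult_left_mono) auto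
    also have "\<dots> \<le> y t"
      unfolding y_def sum_distrib_left using nn[OF t] e w by (intro sum_mono mult_mono) (auto simp: nonneg_vec_def less_imp_le)
    also have "\<dots> \<le> exp (- (\<epsilon> / 2) * (t - t0)) * y t0" by fact
    also have "\<dots> \<le> exp (- (\<epsilon> / 2) * (t - t0)) * (W * vnorm x0)"
    proof (intro mult_left_mono)
      have "x0 $ i \<le> vnorm x0" if "i < n" for i
        using vnorm_component_le[of i x0] dim(2) that by simp
      then have "y t0 \<le> (\<Sum>i<n. w i * vnorm x0)"
        unfolding y_def dim(3) using w by (intro sum_mono mult_left_mono) (auto simp: less_imp_le)
      then show "y t0 \<le> W * vnorm x0" by (simp add: W_def sum_distrib_right)
    qed simp
    finally have "vnorm (x t) \<le> exp (- (\<epsilon> / 2) * (t - t0)) * (W * vnorm x0) / e"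
      using e(1) by (simp only: pos_le_divide_eq mult.commute)
    then have "vnorm (x t) \<le> (W / e) * exp (- (\<epsilon> / 2) * (t - t0)) * vnorm x0"
      by (simp only: divide_inverse mult_ac)
    also have "\<dots> \<le> K * exp (- (\<epsilon> / 2) * (t - t0)) * vnorm x0"
      by (intro mult_right_mono) (auto simp: K_def vnorm_nonneg)
    finally show ?thesis .
  qed
  have "vec_open n (carrier_vec n)" by (auto simp: vec_open_def intro: exI[of _ 1])
  moreover have "\<epsilon> / 2 > 0" "K \<ge> 1" using \<open>\<epsilon> > 0\<close> by (auto simp: K_def)
  ultimately show ?thesis
    unfolding pos_unif_exp_stable_def
    by (intro exI[of _ K] exI[of _ "\<epsilon> / 2"] exI[of _ "carrier_vec n"] conjI ballI allI impI)
      (simp_all only: zero_carrier_vec main)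
qed

text \<open>Along nonnegative solutions the delta derivative s w^T x is nonnegative, so w^T x cannot
  fall below its positive initial value, whereas stability would drive it to 0.\<close>

lemma metzler_unstable:
  fixes w :: "nat \<Rightarrow> real"
  assumes T: "time_scale T" "\<not> bdd_above T" and M: "M \<in> carrier_mat n n" "ts_metzler T n M"
    and w: "\<And>i. i < n \<Longrightarrow> 0 \<le> w i" "l < n" "w l > 0"
    and "s \<ge> 0" and eig: "\<And>j. j < n \<Longrightarrow> (\<Sum>i<n. w i * M $$ (i, j)) = s * w j"
  shows "\<not> pos_unif_exp_stable T n M"
proof
  assume "pos_unif_exp_stable T n M"
  then obtain K \<alpha> V where V: "\<alpha> > 0" "vec_open n V" "0\<^sub>v n \<in> V"
    and stab: "\<forall>t0\<in>T. \<forall>x0 x. x0 \<in> V \<and> nonneg_vec n x0 \<and> aut_sol T n M t0 x0 x \<longrightarrow>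
      (\<forall>t\<in>tsfrom T t0. vnorm (x t) \<le> K * exp (- \<alpha> * (t - t0)) * vnorm x0)"
    unfolding pos_unif_exp_stable_def by (elim exE conjE) (rule that)
  obtain e where e: "e > 0" "\<And>y. y \<in> carrier_vec n \<Longrightarrow> vnorm (y - 0\<^sub>v n) < e \<Longrightarrow> y \<in> V"
    using V(2,3) unfolding vec_open_def by blast
  \<comment> \<open>Half the radius keeps the start inside the neighbourhood, and the direction l
    makes w^T x0 positive.\<close>
  define x0 where "x0 = (e / 2) \<cdot>\<^sub>v unit_vec n l"
  have x0: "x0 \<in> carrier_vec n" by (simp add: x0_def)
  have "vnorm x0 \<le> (\<Sum>i<n. \<bar>x0 $ i\<bar>)" using vnorm_le_sum_abs[of x0] x0 by simp
  also have "\<dots> = (\<Sum>i<n. if i = l then e / 2 else 0)"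
    using e(1) w(2) by (intro sum.cong) (auto simp: x0_def)
  also have "\<dots> = e / 2" using w(2) by simp
  finally have "vnorm x0 < e" using e(1) by simp
  moreover have "x0 - 0\<^sub>v n = x0" using x0 by (intro eq_vecI) auto
  ultimately have xV: "x0 \<in> V" using e(2) x0 by simp
  have nn0: "nonneg_vec n x0" using e(1) w(2) by (auto simp: nonneg_vec_def x0_def)
  obtain t0 where t0: "t0 \<in> T" using T by (auto simp: time_scale_def)
  interpret half_time_scale "tsfrom T t0" t0 by (rule tsfrom_half_time_scale) fact+
  obtain x where x: "aut_sol T n M t0 x0 x" using aut_sol_exists[OF T M(1) t0 x0] .
  have nn: "nonneg_vec n (x t)" if "t \<in> tsfrom T t0" for t
    by (rule aut_sol_nonneg[OF T M t0 nn0 x that])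
  define y where "y s = (\<Sum>i<n. w i * x s $ i)" for s
  have ge: "y t0 \<le> y t" if "t \<in> tsfrom T t0" for t
  proof (rule delta_nonneg_imp_ge_start[OF _ _ that])
    fix t assume t: "t \<in> tsfrom T t0"
    show "has_delta (tsfrom T t0) y (\<Sum>j<n. (\<Sum>i<n. w i * M $$ (i, j)) * x t $ j) t"
      unfolding y_def by (rule aut_sol_functional[OF M(1) x t])
    show "0 \<le> (\<Sum>j<n. (\<Sum>i<n. w i * M $$ (i, j)) * x t $ j)"
      using nn[OF t] w(1) eig \<open>s \<ge> 0\<close> by (intro sum_nonneg) (auto simp: nonneg_vec_def)
  qed
  have le: "y t \<le> (\<Sum>i<n. w i) * (K * exp (- \<alpha> * (t - t0)) * vnorm x0)" if "t \<in> tsfrom T t0" for t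
  proof -
    have "y t \<le> (\<Sum>i<n. w i * vnorm (x t))"
      unfolding y_def using vnorm_component_le[of _ "x t"] nn[OF that] w(1)
      by (intro sum_mono mult_left_mono) (auto simp: nonneg_vec_def intro: order_trans[OF abs_ge_self])
    also have "\<dots> \<le> (\<Sum>i<n. w i) * (K * exp (- \<alpha> * (t - t0)) * vnorm x0)"
      unfolding sum_distrib_right[symmetric]
      using stab[rule_format, of t0 x0 x t] t0 xV nn0 x that w(1) by (intro mult_left_mono sum_nonneg) auto
    finally show ?thesis .
  qed
  have "y t0 > 0"
  proof -
    have "y t0 = (\<Sum>i<n. if i = l then w l * (e / 2) else 0)"
      unfolding y_def using x w(2) by (intro sum.cong) (auto simp: aut_sol_def x0_def)
    then have "y t0 = w l * (e / 2)" using w(2) by simp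
    then show ?thesis using mult_pos_pos[OF w(3), of "e / 2"] e(1) by simp
  qed
  obtain t where t: "t \<in> tsfrom T t0" "((\<Sum>i<n. w i) * K * vnorm x0) * exp (- \<alpha> * (t - t0)) < y t0"
    using exp_decay_eventually_less[OF V(1) \<open>y t0 > 0\<close>] by blast
  then show False using ge[OF t(1)] le[OF t(1)] by (simp add: mult_ac)
qed

text \<open>|x|^2 is real-valued and fits the scalar decay estimate: a jump multiplies it by at most
  (1 - \<epsilon>\<mu>)^2 \<le> 1 - \<epsilon>\<mu>, and at a right-dense point its derivative is 2
  Re z |x|^2. One halving of the rate comes from that estimate, another from the square
  root.\<close>

lemma stab_regionI:
  assumes T: "time_scale T" "\<not> bdd_above T" and "\<epsilon> > 0" and re: "Re z \<le> - \<epsilon>"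
    and le: "\<And>t. t \<in> T \<Longrightarrow> cmod (1 + of_real (graininess T t) * z) \<le> 1 - \<epsilon> * graininess T t"
  shows "z \<in> stab_region T"
proof -
  have main: "cmod (x t) \<le> 1 * exp (- (\<epsilon> / 4) * (t - t0)) * cmod (x t0)"
    if t0: "t0 \<in> T" and x: "\<And>t. t \<in> tsfrom T t0 \<Longrightarrow> has_delta (tsfrom T t0) x (z * x t) t"
      and t: "t \<in> tsfrom T t0" for t0 x t
  proof -
    interpret half_time_scale "tsfrom T t0" t0 by (rule tsfrom_half_time_scale) fact+
    define y where "y s = (Re (x s))\<^sup>2 + (Im (x s))\<^sup>2" for s
    have y: "y s = (cmod (x s))\<^sup>2" for s by (simp add: y_def cmod_power2)
    have "y t \<le> exp (- (\<epsilon> / 2) * (t - t0)) * y t0"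
    proof (rule exp_decay[OF \<open>\<epsilon> > 0\<close>])
      fix t assume t: "t \<in> tsfrom T t0"
      show "continuous (at t within tsfrom T t0) y"
        unfolding y_def using has_delta_continuous[OF x[OF t]] by (intro continuous_intros continuous_Re continuous_Im)
      show "0 \<le> y t" by (simp add: y)
      define \<mu> where "\<mu> = graininess (tsfrom T t0) t"
      have \<mu>: "\<mu> \<ge> 0" "cmod (1 + of_real \<mu> * z) \<le> 1 - \<epsilon> * \<mu>"
        using graininess_nonneg[of t] le[of t] t tsfromD(1)[OF t] by (auto simp: \<mu>_def graininess_tsfrom)
      have "x (fjump (tsfrom T t0) t) = (1 + of_real \<mu> * z) * x t"
        using has_delta_jump[OF x[OF t]] by (simp add: \<mu>_def scaleR_conv_of_real algebra_simps)
      then have "y (fjump (tsfrom T t0) t) = (cmod (1 + of_real \<mu> * z))\<^sup>2 * y t"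
        by (simp add: y norm_mult power_mult_distrib)
      also have "\<dots> \<le> (1 - \<epsilon> * \<mu>) * y t"
      proof (rule mult_right_mono)
        have "0 \<le> 1 - \<epsilon> * \<mu>" "1 - \<epsilon> * \<mu> \<le> 1"
          using \<mu> \<open>\<epsilon> > 0\<close> norm_ge_zero[of "1 + of_real \<mu> * z"] by (linarith, simp)
        then have "(cmod (1 + of_real \<mu> * z))\<^sup>2 \<le> (1 - \<epsilon> * \<mu>) * 1"
          unfolding power2_eq_square using \<mu>(2) by (intro mult_mono) auto
        then show "(cmod (1 + of_real \<mu> * z))\<^sup>2 \<le> 1 - \<epsilon> * \<mu>" by simp
      qed (simp add: y)
      finally show "y (fjump (tsfrom T t0) t) \<le> (1 - \<epsilon> * graininess (tsfrom T t0) t) * y t"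
        by (simp add: \<mu>_def)
      assume "fjump (tsfrom T t0) t = t"
      then have d: "(x has_vector_derivative z * x t) (at t within tsfrom T t0)"
        by (rule has_delta_dense[OF x[OF t]])
      have dR: "((\<lambda>s. Re (x s)) has_real_derivative Re (z * x t)) (at t within tsfrom T t0)"
        and dI: "((\<lambda>s. Im (x s)) has_real_derivative Im (z * x t)) (at t within tsfrom T t0)"
        unfolding has_real_derivative_iff_has_vector_derivative
        using bounded_linear.has_vector_derivative[OF bounded_linear_Re d]
          bounded_linear.has_vector_derivative[OF bounded_linear_Im d] by auto
      have dy: "(y has_real_derivative 2 * Re (x t) * Re (z * x t) + 2 * Im (x t) * Im (z * x t)) (at t within tsfrom T t0)"
        unfolding y_def
        by (rule DERIV_cong[OF DERIV_add[OF DERIV_power[OF dR] DERIV_power[OF dI]]]) simp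
      have eq: "2 * Re (x t) * Re (z * x t) + 2 * Im (x t) * Im (z * x t) = 2 * Re z * y t"
        by (simp add: y_def algebra_simps power2_eq_square)
      have "2 * Re z * y t \<le> - \<epsilon> * y t"
        using re \<open>\<epsilon> > 0\<close> by (intro mult_right_mono) (auto simp: y)
      then show "\<exists>D\<le>- \<epsilon> * y t. (y has_real_derivative D) (at t within tsfrom T t0)"
        using dy unfolding eq by (intro exI conjI)
    qed (rule t)
    also have "\<dots> = (exp (- (\<epsilon> / 4) * (t - t0)) * cmod (x t0))\<^sup>2"
    proof -
      have "exp (- (\<epsilon> / 2) * (t - t0)) = exp (- (\<epsilon> / 4) * (t - t0)) * exp (- (\<epsilon> / 4) * (t - t0))"
        unfolding exp_add[symmetric] by simp
      then show ?thesis unfolding y power_mult_distrib power2_eq_square by (simp only: mult_ac)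
    qed
    finally have "(cmod (x t))\<^sup>2 \<le> (exp (- (\<epsilon> / 4) * (t - t0)) * cmod (x t0))\<^sup>2" by (simp add: y)
    then have "cmod (x t) \<le> exp (- (\<epsilon> / 4) * (t - t0)) * cmod (x t0)"
      by (rule power2_le_imp_le) simp
    then show ?thesis by simp
  qed
  show ?thesis
    unfolding stab_region_def mem_Collect_eq
  proof (intro exI conjI ballI allI impI)
    fix t0 x0 x t
    assume "t0 \<in> T" "x0 \<in> UNIV \<and> x t0 = x0 \<and>
        (\<forall>t\<in>tsfrom T t0. has_delta (tsfrom T t0) x (z * x t) t)" "t \<in> tsfrom T t0"
    then show "cmod (x t) \<le> 1 * exp (- (\<epsilon> / 4) * (t - t0)) * cmod x0" using main[of t0 x t] by simp
  qed (use \<open>\<epsilon> > 0\<close> in simp_all)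
qed

text \<open>Read as a 1 by 1 positive system, the scalar equation has a nonnegative real solution
  that never falls below its start; embedded in the complex plane it contradicts decay.\<close>

lemma nonneg_real_not_in_stab_region:
  assumes T: "time_scale T" "\<not> bdd_above T" and "s \<ge> 0"
  shows "complex_of_real s \<notin> stab_region T"
proof
  assume "complex_of_real s \<in> stab_region T"
  then obtain K \<alpha> V where V: "\<alpha> > 0" "open V" "0 \<in> V"
    and stab: "\<forall>t0\<in>T. \<forall>x0 x. x0 \<in> V \<and> x t0 = x0 \<and>
      (\<forall>t\<in>tsfrom T t0. has_delta (tsfrom T t0) x (complex_of_real s * x t) t) \<longrightarrow>
      (\<forall>t\<in>tsfrom T t0. cmod (x t) \<le> K * exp (- \<alpha> * (t - t0)) * cmod x0)"
    unfolding stab_region_def mem_Collect_eq by (elim exE conjE) (rule that)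
  obtain e where e: "e > 0" "ball 0 e \<subseteq> V" using V(2,3) by (meson openE)
  obtain t0 where t0: "t0 \<in> T" using T by (auto simp: time_scale_def)
  interpret half_time_scale "tsfrom T t0" t0 by (rule tsfrom_half_time_scale) fact+
  define M where "M = mat 1 1 (\<lambda>_. s)"
  have M: "M \<in> carrier_mat 1 1" by (simp add: M_def)
  have met: "ts_metzler T 1 M"
    unfolding ts_metzler_def
  proof (intro conjI allI impI ballI)
    fix t j assume "t \<in> T" "j < (1 :: nat)"
    interpret t: half_time_scale "tsfrom T t" t by (rule tsfrom_half_time_scale) fact+
    have "graininess T t \<ge> 0" using t.graininess_nonneg[of t] graininess_tsfrom[OF t.start_in] by simp
    then show "0 \<le> 1 + graininess T t * M $$ (j, j)" using \<open>j < 1\<close> \<open>s \<ge> 0\<close> by (simp add: M_def)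
  qed auto
  define x0 where "x0 = vec 1 (\<lambda>_. e / 2)"
  have x0: "x0 \<in> carrier_vec 1" "nonneg_vec 1 x0" using e by (auto simp: x0_def nonneg_vec_def)
  obtain x where x: "aut_sol T 1 M t0 x0 x" using aut_sol_exists[OF T M t0 x0(1)] .
  have nn: "0 \<le> x t $ 0" if "t \<in> tsfrom T t0" for t
    using aut_sol_nonneg[OF T M met t0 x0(2) x that] by (simp add: nonneg_vec_def)
  have D: "has_delta (tsfrom T t0) (\<lambda>t. x t $ 0) (s * x t $ 0) t" if "t \<in> tsfrom T t0" for t
    using aut_sol_functional[OF M x that, of "\<lambda>_. 1"] by (simp add: M_def)
  have ge: "x t0 $ 0 \<le> x t $ 0" if "t \<in> tsfrom T t0" for t
    by (rule delta_nonneg_imp_ge_start[where y = "\<lambda>t. x t $ 0", OF D _ that]) (use nn \<open>s \<ge> 0\<close> in auto)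
  have xt0: "x t0 $ 0 = e / 2" using x by (simp add: aut_sol_def x0_def)
  define z where "z t = complex_of_real (x t $ 0)" for t
  have dz: "has_delta (tsfrom T t0) z (complex_of_real s * z t) t" if "t \<in> tsfrom T t0" for t
  proof -
    have "norm (z u - z r - (u - r) *\<^sub>R (complex_of_real s * z t)) = norm (x u $ 0 - x r $ 0 - (u - r) *\<^sub>R (s * x t $ 0))" for u r
    proof -
      have "z u - z r - (u - r) *\<^sub>R (complex_of_real s * z t) = complex_of_real (x u $ 0 - x r $ 0 - (u - r) *\<^sub>R (s * x t $ 0))"
        by (simp add: z_def scaleR_conv_of_real)
      then show ?thesis by (simp only: norm_of_real real_norm_def)
    qed
    then show ?thesis using D[OF that] unfolding has_delta_def by simp
  qed
  have "z t0 \<in> V" using e by (auto simp: z_def xt0)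
  then have le: "cmod (z t) \<le> K * exp (- \<alpha> * (t - t0)) * cmod (z t0)" if "t \<in> tsfrom T t0" for t
    using stab[rule_format, of t0 "z t0" z t] t0 dz that by simp
  obtain t where t: "t \<in> tsfrom T t0" "(K * (e / 2)) * exp (- \<alpha> * (t - t0)) < e / 2"
    using exp_decay_eventually_less[OF V(1), of "e / 2" "K * (e / 2)"] e(1) half_gt_zero by blast
  have "e / 2 \<le> cmod (z t)" using ge[OF t(1)] xt0 nn[OF t(1)] by (simp add: z_def)
  moreover have "cmod (z t0) = e / 2" using e(1) by (simp add: z_def xt0)
  ultimately show False using le[OF t(1)] t(2) by (simp only: mult_ac not_le[symmetric])
qed

text \<open>I + \<mu>M is entrywise nonnegative and, by \<open>dec\<close>, shrinks the w-weighted
  sum of moduli by the factor 1 - \<epsilon>\<mu>; taking moduli in the eigenvector equation gives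
  the disc bound. The bound on Re z is the same estimate at one auxiliary step size.\<close>

lemma metzler_eigenvalue_bounds:
  fixes w :: "nat \<Rightarrow> real"
  assumes M: "M \<in> carrier_mat n n" and off: "\<And>i j. i < n \<Longrightarrow> j < n \<Longrightarrow> i \<noteq> j \<Longrightarrow> 0 \<le> M $$ (i, j)"
    and w: "\<And>i. i < n \<Longrightarrow> 0 < w i"
    and dec: "\<And>j. j < n \<Longrightarrow> (\<Sum>i<n. w i * M $$ (i, j)) \<le> - \<epsilon> * w j"
    and z: "eigenvalue (map_mat complex_of_real M) z"
  shows "\<And>\<mu>. 0 \<le> \<mu> \<Longrightarrow> (\<And>j. j < n \<Longrightarrow> 0 \<le> 1 + \<mu> * M $$ (j, j)) \<Longrightarrow> cmod (1 + of_real \<mu> * z) \<le> 1 - \<epsilon> * \<mu>"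
    and "Re z \<le> - \<epsilon>"
proof -
  have MC: "map_mat complex_of_real M \<in> carrier_mat n n" using M by simp
  obtain v where v: "v \<in> carrier_vec n" "v \<noteq> 0\<^sub>v n" "map_mat complex_of_real M *\<^sub>v v = z \<cdot>\<^sub>v v"
    using z M unfolding eigenvalue_def eigenvector_def by auto
  have vi: "z * v $ i = (\<Sum>j<n. of_real (M $$ (i, j)) * v $ j)" if "i < n" for i
  proof -
    have "z * v $ i = (map_mat complex_of_real M *\<^sub>v v) $ i" using v that by simp
    also have "\<dots> = (\<Sum>j<n. of_real (M $$ (i, j)) * v $ j)"
      unfolding mult_mat_vec_sum[OF MC v(1) that] using M that by (intro sum.cong) auto
    finally show ?thesis .
  qed
  define S where "S = (\<Sum>i<n. w i * cmod (v $ i))"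
  have "S > 0"
  proof -
    obtain l where l: "l < n" "v $ l \<noteq> 0" using v by (metis carrier_vecD eq_vecI index_zero_vec)
    have "0 < w l * cmod (v $ l)" using l w by simp
    also have "\<dots> \<le> S" unfolding S_def
      using l w by (intro member_le_sum) (auto simp: less_imp_le)
    finally show ?thesis .
  qed
  show bound: "cmod (1 + of_real \<mu> * z) \<le> 1 - \<epsilon> * \<mu>"
    if "0 \<le> \<mu>" and diag: "\<And>j. j < n \<Longrightarrow> 0 \<le> 1 + \<mu> * M $$ (j, j)" for \<mu>
  proof -
    define a where "a i j = (if j = i then 1 else 0) + \<mu> * M $$ (i, j)" for i j
    have a: "0 \<le> a i j" if "i < n" "j < n" for i j
      using off[of i j] diag[of j] that \<open>0 \<le> \<mu>\<close> by (auto simp: a_def)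
    have row: "cmod (1 + of_real \<mu> * z) * cmod (v $ i) \<le> (\<Sum>j<n. a i j * cmod (v $ j))" if "i < n" for i
    proof -
      have "(1 + of_real \<mu> * z) * v $ i = v $ i + of_real \<mu> * (z * v $ i)" by (simp add: algebra_simps)
      also have "\<dots> = (\<Sum>j<n. of_real (a i j) * v $ j)"
        unfolding vi[OF that] using that
        by (simp add: a_def distrib_right sum.distrib sum_distrib_left mult.assoc if_distrib[of of_real] if_distrib[of "\<lambda>u. u * _"] cong: if_cong)
      finally have "cmod (1 + of_real \<mu> * z) * cmod (v $ i) = cmod (\<Sum>j<n. of_real (a i j) * v $ j)"
        by (metis norm_mult)
      also have "\<dots> \<le> (\<Sum>j<n. a i j * cmod (v $ j))"
        using a that by (intro sum_norm_le) (simp add: norm_mult)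
      finally show ?thesis .
    qed
    have "cmod (1 + of_real \<mu> * z) * S = (\<Sum>i<n. w i * (cmod (1 + of_real \<mu> * z) * cmod (v $ i)))"
      by (simp add: S_def sum_distrib_left mult_ac)
    also have "\<dots> \<le> (\<Sum>i<n. w i * (\<Sum>j<n. a i j * cmod (v $ j)))"
      using row w by (intro sum_mono mult_left_mono) (auto intro: less_imp_le)
    also have "\<dots> = (\<Sum>j<n. (\<Sum>i<n. w i * a i j) * cmod (v $ j))"
      unfolding sum_distrib_left sum_distrib_right by (subst sum.swap) (simp add: mult.assoc)
    also have "\<dots> \<le> (\<Sum>j<n. ((1 - \<epsilon> * \<mu>) * w j) * cmod (v $ j))"
    proof (intro sum_mono mult_right_mono)
      fix j assume j: "j \<in> {..<n}"
      have "(\<Sum>i<n. w i * a i j) = w j + \<mu> * (\<Sum>i<n. w i * M $$ (i, j))"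
        using j by (simp add: a_def distrib_left sum.distrib sum_distrib_left mult_ac if_distrib[of "(*) _"] cong: if_cong)
      also have "\<dots> \<le> w j + \<mu> * (- \<epsilon> * w j)"
        using dec[of j] j \<open>0 \<le> \<mu>\<close> by (intro add_left_mono mult_left_mono) auto
      finally show "(\<Sum>i<n. w i * a i j) \<le> (1 - \<epsilon> * \<mu>) * w j" by (simp add: algebra_simps)
    qed simp
    also have "\<dots> = (1 - \<epsilon> * \<mu>) * S" by (simp add: S_def sum_distrib_left mult.assoc)
    finally show ?thesis using \<open>S > 0\<close> by simp
  qed
  \<comment> \<open>Not a graininess value but a step so small that all 1 + \<mu> M_jj are
    nonnegative; it is available even on a scale without jumps.\<close>
  define \<mu> where "\<mu> = 1 / (1 + (\<Sum>i<n. \<Sum>j<n. \<bar>M $$ (i, j)\<bar>))"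
  have "\<mu> > 0" by (simp add: \<mu>_def sum_nonneg add_pos_nonneg)
  have "0 \<le> 1 + \<mu> * M $$ (j, j)" if "j < n" for j
  proof -
    have "\<bar>M $$ (j, j)\<bar> \<le> (\<Sum>l<n. \<bar>M $$ (j, l)\<bar>)"
      using that by (intro member_le_sum) auto
    also have "\<dots> \<le> (\<Sum>i<n. \<Sum>j<n. \<bar>M $$ (i, j)\<bar>)" by (rule abs_entry_le_total[OF that])
    also have "\<dots> \<le> 1 / \<mu>" by (simp add: \<mu>_def)
    finally have "\<mu> * \<bar>M $$ (j, j)\<bar> \<le> 1" using \<open>\<mu> > 0\<close> by (simp add: field_simps)
    moreover have "- (\<mu> * \<bar>M $$ (j, j)\<bar>) \<le> \<mu> * M $$ (j, j)"
      using mult_left_mono[of "- \<bar>M $$ (j, j)\<bar>" "M $$ (j, j)" \<mu>] \<open>\<mu> > 0\<close> by simp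
    ultimately show ?thesis by linarith
  qed
  then have "cmod (1 + of_real \<mu> * z) \<le> 1 - \<epsilon> * \<mu>" using bound \<open>\<mu> > 0\<close> by simp
  then have "Re (1 + of_real \<mu> * z) \<le> 1 - \<epsilon> * \<mu>" using complex_Re_le_cmod order_trans by blast
  then have "\<mu> * Re z \<le> \<mu> * (- \<epsilon>)" by (simp add: mult.commute)
  then show "Re z \<le> - \<epsilon>" using \<open>\<mu> > 0\<close> by (rule mult_left_le_imp_le)
qed

section \<open>A Perron-Frobenius alternative for Metzler matrices\<close>

lemma injective_mat_solvable:
  fixes B :: "'a::field mat"
  assumes B: "B \<in> carrier_mat n n" and u: "u \<in> carrier_vec n"
    and inj: "\<And>v. v \<in> carrier_vec n \<Longrightarrow> B *\<^sub>v v = 0\<^sub>v n \<Longrightarrow> v = 0\<^sub>v n"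
  obtains y where "y \<in> carrier_vec n" "B *\<^sub>v y = u"
proof -
  have "det B \<noteq> 0" using det_0_iff_vec_prod_zero[OF B] inj by blast
  define y where "y = adj_mat B *\<^sub>v (inverse (det B) \<cdot>\<^sub>v u)"
  have y: "y \<in> carrier_vec n" unfolding y_def using u by (intro mult_mat_vec_carrier[OF adj_mat(1)[OF B]]) simp
  have "B *\<^sub>v y = (B * adj_mat B) *\<^sub>v (inverse (det B) \<cdot>\<^sub>v u)"
    unfolding y_def using B adj_mat(1)[OF B] u by (intro assoc_mult_mat_vec[symmetric]) auto
  also have "\<dots> = det B \<cdot>\<^sub>v (inverse (det B) \<cdot>\<^sub>v u)"
    unfolding adj_mat(2)[OF B] using u by auto
  also have "\<dots> = u" using \<open>det B \<noteq> 0\<close> u by (simp add: smult_smult_assoc)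
  finally show thesis using that y by blast
qed

text \<open>Bolzano-Weierstrass, one coordinate at a time: each further coordinate thins out the
  subsequence already found.\<close>

lemma bounded_coordinates_subsequence:
  fixes f :: "nat \<Rightarrow> nat \<Rightarrow> real"
  assumes "\<And>m i. i < n \<Longrightarrow> \<bar>f m i\<bar> \<le> C"
  shows "\<exists>r l. strict_mono r \<and> (\<forall>i<n. (\<lambda>m. f (r m) i) \<longlonglongrightarrow> l i)"
  using assms
proof (induction n)
  case 0
  then show ?case by (intro exI[of _ id]) (auto simp: strict_mono_def)
next
  case (Suc n)
  have "\<exists>r l. strict_mono r \<and> (\<forall>i<n. (\<lambda>m. f (r m) i) \<longlonglongrightarrow> l i)"
    by (rule Suc.IH) (use Suc.prems in auto)
  then obtain r l where r: "strict_mono r" "\<And>i. i < n \<Longrightarrow> (\<lambda>m. f (r m) i) \<longlonglongrightarrow> l i"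
    by blast
  have "bounded (range (\<lambda>m. f (r m) n))"
    using Suc.prems[of n] by (intro boundedI[of _ C]) auto
  then obtain l' r' where r': "strict_mono r'" "((\<lambda>m. f (r m) n) \<circ> r') \<longlonglongrightarrow> l'"
    using bounded_imp_convergent_subsequence by blast
  have "(\<lambda>m. f (r (r' m)) i) \<longlonglongrightarrow> (l(n := l')) i" if "i < Suc n" for i
  proof (cases "i = n")
    case True
    then show ?thesis using r' by (simp add: o_def)
  next
    case False
    then show ?thesis
      using LIMSEQ_subseq_LIMSEQ[OF r(2) r'(1), of i] that by (simp add: o_def)
  qed
  moreover have "strict_mono (r \<circ> r')" using r r' by (simp add: strict_mono_o)
  ultimately show ?case
    by (intro exI[of _ "r \<circ> r'"] exI[of _ "l(n := l')"]) (simp add: o_def)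
qed

text \<open>For Metzler M a Collatz-Wielandt certificate that the rightmost eigenvalue lies left of
  s. Row vectors are functions of which only the values below n matter.\<close>

definition subinvariant :: "real mat \<Rightarrow> nat \<Rightarrow> real \<Rightarrow> (nat \<Rightarrow> real) \<Rightarrow> bool" where
  "subinvariant M n s w \<longleftrightarrow>
    (\<forall>i<n. 0 < w i) \<and> (\<forall>j<n. (\<Sum>i<n. w i * M $$ (i, j)) < s * w j)"

context
  fixes M :: "real mat" and n :: nat
  assumes off: "\<And>i j. i < n \<Longrightarrow> j < n \<Longrightarrow> i \<noteq> j \<Longrightarrow> 0 \<le> M $$ (i, j)"
begin

text \<open>Let c be the minimum of x_j / w_j, attained at l. If c < 0, then x - c w is nonnegative
  and zero at l, so column l of x^T M dominates that of c w^T M; the inequality for x then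
  contradicts the strict one for w, reversed by the factor c.\<close>

lemma subinvariant_min_principle:
  assumes w: "subinvariant M n s w" and x: "\<And>j. j < n \<Longrightarrow> (\<Sum>i<n. x i * M $$ (i, j)) \<le> s * x j"
    and "i < n"
  shows "0 \<le> x i"
proof (rule ccontr)
  assume neg: "\<not> 0 \<le> x i"
  have wpos: "w j > 0" if "j < n" for j using w that by (simp add: subinvariant_def)
  define c where "c = Min ((\<lambda>j. x j / w j) ` {..<n})"
  have ne: "(\<lambda>j. x j / w j) ` {..<n} \<noteq> {}" using \<open>i < n\<close> by auto
  obtain l where l: "l < n" "c = x l / w l" using Min_in[OF _ ne] unfolding c_def by auto
  have cle: "c \<le> x j / w j" if "j < n" for j using that unfolding c_def by (intro Min_le) auto
  have "x i / w i < 0" using neg wpos[OF \<open>i < n\<close>] by (intro divide_neg_pos) auto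
  then have "c < 0" using cle[OF \<open>i < n\<close>] by linarith
  have xl: "x l = c * w l" using l(2) wpos[OF l(1)] by simp
  have ge: "c * w j \<le> x j" if "j < n" for j
    using cle[OF that] wpos[OF that] by (simp add: pos_le_divide_eq)
  have "(\<Sum>i<n. (c * w i) * M $$ (i, l)) \<le> (\<Sum>i<n. x i * M $$ (i, l))"
  proof (rule sum_mono)
    fix j assume "j \<in> {..<n}"
    then show "c * w j * M $$ (j, l) \<le> x j * M $$ (j, l)"
      using ge[of j] off[of j l] l(1) xl by (cases "j = l") (auto intro: mult_right_mono)
  qed
  also have "\<dots> \<le> s * x l" by (rule x[OF l(1)])
  also have "\<dots> = c * (s * w l)" by (simp add: xl)
  also have "\<dots> < c * (\<Sum>i<n. w i * M $$ (i, l))"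
    using w l(1) \<open>c < 0\<close> by (auto simp: subinvariant_def)
  finally show False by (simp add: sum_distrib_left mult.assoc)
qed

text \<open>y is the all-ones row vector times the inverse of sI - M. The minimum principle gives
  injectivity when applied to v and -v, and the sign when applied to y.\<close>

lemma subinvariant_resolvent:
  assumes w: "subinvariant M n s w"
  obtains y where "\<And>j. j < n \<Longrightarrow> s * y j - (\<Sum>i<n. y i * M $$ (i, j)) = 1"
    "\<And>j. j < n \<Longrightarrow> 0 \<le> y j"
proof -
  \<comment> \<open>The transpose of sI - M, since the equation is one for row vectors.\<close>
  define B where "B = mat n n (\<lambda>(j, i). (if i = j then s else 0) - M $$ (i, j))"
  have B: "B \<in> carrier_mat n n" by (simp add: B_def)
  have Bv: "(B *\<^sub>v v) $ j = s * v $ j - (\<Sum>i<n. v $ i * M $$ (i, j))" if "v \<in> carrier_vec n" "j < n" for v j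
  proof -
    have "(B *\<^sub>v v) $ j = (\<Sum>i<n. ((if i = j then s else 0) - M $$ (i, j)) * v $ i)"
      unfolding mult_mat_vec_sum[OF B that] using that by (simp add: B_def)
    also have "\<dots> = (\<Sum>i<n. (if i = j then s * v $ i else 0) - v $ i * M $$ (i, j))"
      by (intro sum.cong) (auto simp: algebra_simps)
    finally show ?thesis using that by (simp add: sum_subtractf)
  qed
  have "v = 0\<^sub>v n" if v: "v \<in> carrier_vec n" "B *\<^sub>v v = 0\<^sub>v n" for v
  proof (rule eq_vecI)
    have eq: "s * v $ j - (\<Sum>i<n. v $ i * M $$ (i, j)) = 0" if "j < n" for j
      using Bv[OF v(1) that] v(2) that by simp
    fix i assume i: "i < dim_vec (0\<^sub>v n :: real vec)"
    have "0 \<le> v $ i" using subinvariant_min_principle[OF w, of "\<lambda>i. v $ i"] eq i by force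
    moreover have "0 \<le> - v $ i"
      using subinvariant_min_principle[OF w, of "\<lambda>i. - v $ i"] eq i by (force simp: sum_negf)
    ultimately show "v $ i = 0\<^sub>v n $ i" using i by simp
  qed (use v in simp)
  then obtain y where y: "y \<in> carrier_vec n" "B *\<^sub>v y = vec n (\<lambda>_. 1)"
    using injective_mat_solvable[OF B, of "vec n (\<lambda>_. 1)"] by auto
  have eq: "s * y $ j - (\<Sum>i<n. y $ i * M $$ (i, j)) = 1" if "j < n" for j
    using Bv[OF y(1) that] y(2) that by simp
  moreover have "0 \<le> y $ j" if "j < n" for j
    using subinvariant_min_principle[OF w, of "\<lambda>i. y $ i"] eq that by force
  ultimately show thesis by (rule that)
qed

lemma subinvariant_mono: "subinvariant M n s w \<Longrightarrow> s \<le> s' \<Longrightarrow> subinvariant M n s' w"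
  unfolding subinvariant_def by (auto intro: less_le_trans mult_right_mono less_imp_le)

text \<open>A vanishing coordinate would leave only nonnegative off-diagonal terms in its column
  sum, which then could not be negative.\<close>

lemma nonneg_strict_imp_subinvariant:
  assumes nonneg: "\<And>j. j < n \<Longrightarrow> 0 \<le> v j"
    and less: "\<And>j. j < n \<Longrightarrow> (\<Sum>i<n. v i * M $$ (i, j)) < s * v j"
  shows "subinvariant M n s v"
proof -
  have "v j \<noteq> 0" if j: "j < n" for j
  proof
    assume z: "v j = 0"
    have "0 \<le> (\<Sum>i<n. v i * M $$ (i, j))"
    proof (rule sum_nonneg)
      fix i assume "i \<in> {..<n}"
      then show "0 \<le> v i * M $$ (i, j)"
        using nonneg[of i] off[of i j] j z by (cases "i = j") auto
    qed
    then show False using less[OF j] z by simp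
  qed
  then show ?thesis using nonneg less unfolding subinvariant_def by (simp add: order_less_le)
qed

lemma subinvariant_decrease:
  assumes w: "subinvariant M n s w"
  shows "\<exists>e>0. \<forall>d<e. subinvariant M n (s - d) w"
proof -
  have wpos: "0 < w j" and less: "(\<Sum>i<n. w i * M $$ (i, j)) < s * w j" if "j < n" for j
    using w that unfolding subinvariant_def by blast+
  define g where "g j = (s * w j - (\<Sum>i<n. w i * M $$ (i, j))) / w j" for j
  have "0 < g j" if "j < n" for j
    unfolding g_def by (rule divide_pos_pos) (use less[OF that] wpos[OF that] in linarith)+
  then obtain e where e: "e > 0" "\<And>j. j < n \<Longrightarrow> e \<le> g j"
    using finite_pos_lower_bound[of n g] by blast
  have "subinvariant M n (s - d) w" if "d < e" for d
    unfolding subinvariant_def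
  proof (intro conjI allI impI)
    fix j assume j: "j < n"
    show "0 < w j" by (rule wpos[OF j])
    have "e * w j \<le> s * w j - (\<Sum>i<n. w i * M $$ (i, j))"
      using e(2)[OF j] unfolding g_def pos_le_divide_eq[OF wpos[OF j]] .
    moreover have "d * w j < e * w j" by (rule mult_strict_right_mono[OF that wpos[OF j]])
    ultimately show "(\<Sum>i<n. w i * M $$ (i, j)) < (s - d) * w j"
      unfolding left_diff_distrib by linarith
  qed
  then show ?thesis using e(1) by blast
qed

text \<open>At the infimum of all levels admitting a strictly subinvariant vector the normalised
  resolvents accumulate at a left eigenvector.\<close>

lemma metzler_dichotomy:
  obtains (stable) w where "subinvariant M n 0 w"
  | (unstable) w s l where "\<And>i. i < n \<Longrightarrow> 0 \<le> w i" "l < n" "0 < w l" "0 \<le> s"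
      "\<And>j. j < n \<Longrightarrow> (\<Sum>i<n. w i * M $$ (i, j)) = s * w j"
proof (cases "\<exists>w. subinvariant M n 0 w")
  case False
  have "n > 0" using False by (auto simp: subinvariant_def)
  define S where "S = {s. s \<ge> 0 \<and> (\<exists>w. subinvariant M n s w)}"
  \<comment> \<open>The all-ones vector is strictly subinvariant as soon as s exceeds all column
    sums.\<close>
  have SI: "s \<in> S" if "s > 1 + (\<Sum>i<n. \<Sum>j<n. \<bar>M $$ (i, j)\<bar>)" for s
  proof -
    have "(\<Sum>i<n. 1 * M $$ (i, j)) < s * 1" if "j < n" for j
    proof -
      have "(\<Sum>i<n. M $$ (i, j)) \<le> (\<Sum>i<n. \<Sum>j<n. \<bar>M $$ (i, j)\<bar>)"
      proof (rule sum_mono)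
        fix i assume "i \<in> {..<n}"
        have "\<bar>M $$ (i, j)\<bar> \<le> (\<Sum>j<n. \<bar>M $$ (i, j)\<bar>)"
          using that by (intro member_le_sum) auto
        then show "M $$ (i, j) \<le> (\<Sum>j<n. \<bar>M $$ (i, j)\<bar>)" by linarith
      qed
      then show ?thesis using \<open>s > _\<close> by simp
    qed
    moreover have "0 \<le> (\<Sum>i<n. \<Sum>j<n. \<bar>M $$ (i, j)\<bar>)" by (simp add: sum_nonneg)
    ultimately show ?thesis
      unfolding S_def using that by (auto simp: subinvariant_def intro!: exI[of _ "\<lambda>_. 1"])
  qed
  have ne: "S \<noteq> {}" using SI[of "2 + (\<Sum>i<n. \<Sum>j<n. \<bar>M $$ (i, j)\<bar>)"] by auto
  have bdd: "bdd_below S" by (auto simp: S_def intro: bdd_belowI[of _ 0])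
  define s where "s = Inf S"
  have "s \<ge> 0" unfolding s_def by (rule cInf_greatest[OF ne]) (auto simp: S_def)
  \<comment> \<open>The condition is open in s, so an attained level could be lowered below the
    infimum; level 0 is excluded by the case assumption.\<close>
  have not_s: "\<not> subinvariant M n s w" for w
  proof
    assume w: "subinvariant M n s w"
    then have "s \<noteq> 0" using False by auto
    then have "s > 0" using \<open>s \<ge> 0\<close> by simp
    obtain e where e: "e > 0" "\<And>d. d < e \<Longrightarrow> subinvariant M n (s - d) w"
      using subinvariant_decrease[OF w] by blast
    define d where "d = min (e / 2) s"
    have "d > 0" "d < e" "d \<le> s" using e(1) \<open>s > 0\<close> by (auto simp: d_def)
    have "subinvariant M n (s - d) w" by (rule e(2)[OF \<open>d < e\<close>])
    then have "s - d \<in> S" using \<open>d \<le> s\<close> by (auto simp: S_def)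
    then have "s \<le> s - d" unfolding s_def by (rule cInf_lower[OF _ bdd])
    then show False using \<open>d > 0\<close> by simp
  qed
  define \<sigma> where "\<sigma> m = s + 1 / (real m + 1)" for m
  have \<sigma>: "\<sigma> m > s" "\<sigma> m \<le> s + 1" for m by (auto simp: \<sigma>_def field_simps)
  have "\<exists>y. (\<forall>j<n. \<sigma> m * y j - (\<Sum>i<n. y i * M $$ (i, j)) = 1) \<and> (\<forall>j<n. 0 \<le> y j)" for m
  proof -
    obtain s' where s': "s' \<in> S" "s' < \<sigma> m"
      using cInf_lessD[OF ne, of "\<sigma> m"] \<sigma>(1)[of m] unfolding s_def by blast
    then obtain w where "subinvariant M n s' w" by (auto simp: S_def)
    then have "subinvariant M n (\<sigma> m) w" using subinvariant_mono[of s' w "\<sigma> m"] s'(2) by simp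
    then show ?thesis using subinvariant_resolvent by blast
  qed
  then obtain y where y: "\<And>m j. j < n \<Longrightarrow> \<sigma> m * y m j - (\<Sum>i<n. y m i * M $$ (i, j)) = 1"
    "\<And>m j. j < n \<Longrightarrow> 0 \<le> y m j" by metis
  define Y where "Y m = (\<Sum>i<n. y m i)" for m
  have "Y m > 0" for m
  proof -
    have "Y m \<ge> 0" using y(2) by (auto simp: Y_def intro!: sum_nonneg)
    moreover have "Y m \<noteq> 0"
    proof
      assume "Y m = 0"
      then have "y m i = 0" if "i < n" for i
        using that y(2)[of _ m] sum_nonneg_eq_0_iff[of "{..<n}" "y m"] by (auto simp: Y_def)
      then show False using y(1)[OF \<open>n > 0\<close>, of m] \<open>n > 0\<close> by simp
    qed
    ultimately show ?thesis by simp
  qed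
  \<comment> \<open>The resolvent vectors normalised to sum 1. Slot n stores 1 / Y m, so that one
    subsequence serves both the vector and the normalising factor.\<close>
  define u where "u m i = (if i < n then y m i / Y m else 1 / Y m)" for m i
  have u_sum: "(\<Sum>i<n. u m i) = 1" for m
    using \<open>Y m > 0\<close> by (simp add: u_def Y_def sum_divide_distrib[symmetric])
  have u_nonneg: "0 \<le> u m i" for m i
    using y(2) \<open>Y m > 0\<close> by (auto simp: u_def less_imp_le)
  have u_le: "u m i \<le> 1" if "i < n" for m i
    using member_le_sum[of i "{..<n}" "u m"] u_nonneg that u_sum by simp
  have u_eq: "\<sigma> m * u m j - (\<Sum>i<n. u m i * M $$ (i, j)) = u m n" if "j < n" for m j
  proof -
    have "\<sigma> m * u m j - (\<Sum>i<n. u m i * M $$ (i, j)) = (\<sigma> m * y m j - (\<Sum>i<n. y m i * M $$ (i, j))) / Y m"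
      using that by (simp add: u_def sum_divide_distrib diff_divide_distrib)
    then show ?thesis using y(1)[OF that] by (simp add: u_def)
  qed
  define C where "C = s + 1 + \<bar>M $$ (0, 0)\<bar>"
  have "\<bar>u m i\<bar> \<le> C + 1" if "i < Suc n" for m i
  proof (cases "i < n")
    case True
    then show ?thesis using u_le[OF True, of m] u_nonneg[of m i] \<open>s \<ge> 0\<close> by (simp add: C_def)
  next
    case False
    then have "i = n" using that by simp
    have "u m 0 * M $$ (0, 0) + (\<Sum>i\<in>{..<n} - {0}. u m i * M $$ (i, 0)) = (\<Sum>i<n. u m i * M $$ (i, 0))"
      using \<open>n > 0\<close> by (subst sum.remove[of "{..<n}" 0]) auto
    moreover have "0 \<le> (\<Sum>i\<in>{..<n} - {0}. u m i * M $$ (i, 0))"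
      using u_nonneg off \<open>n > 0\<close> by (intro sum_nonneg) auto
    ultimately have "u m n \<le> (\<sigma> m - M $$ (0, 0)) * u m 0"
      using u_eq[OF \<open>n > 0\<close>, of m] by (simp add: algebra_simps)
    also have "\<dots> \<le> C * 1"
      using \<sigma>(2)[of m] u_le[OF \<open>n > 0\<close>, of m] u_nonneg[of m 0] \<open>s \<ge> 0\<close>
      by (intro mult_mono) (auto simp: C_def)
    finally show ?thesis using u_nonneg[of m n] \<open>i = n\<close> by simp
  qed
  then obtain r v where r: "strict_mono r" and v: "\<And>i. i < Suc n \<Longrightarrow> (\<lambda>m. u (r m) i) \<longlonglongrightarrow> v i"
    using bounded_coordinates_subsequence[of "Suc n" u "C + 1"] by blast
  have "\<sigma> \<longlonglongrightarrow> s"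
  proof -
    have "(\<lambda>m. s + 1 / (real m + 1)) \<longlonglongrightarrow> s + 0"
      using LIMSEQ_inverse_real_of_nat
      by (intro tendsto_add tendsto_const) (simp add: inverse_eq_divide add.commute)
    then show ?thesis by (simp add: \<sigma>_def[abs_def])
  qed
  then have \<sigma>r: "(\<lambda>m. \<sigma> (r m)) \<longlonglongrightarrow> s" using LIMSEQ_subseq_LIMSEQ[of \<sigma> s r] r by (simp add: o_def)
  have v_nonneg: "0 \<le> v i" if "i < Suc n" for i
    by (rule LIMSEQ_le_const[OF v[OF that]]) (simp add: u_nonneg)
  have v_sum: "(\<Sum>i<n. v i) = 1"
  proof (rule LIMSEQ_unique)
    show "(\<lambda>m. \<Sum>i<n. u (r m) i) \<longlonglongrightarrow> (\<Sum>i<n. v i)" by (intro tendsto_sum v) auto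
    show "(\<lambda>m. \<Sum>i<n. u (r m) i) \<longlonglongrightarrow> 1" by (simp add: u_sum)
  qed
  have v_eq: "s * v j - (\<Sum>i<n. v i * M $$ (i, j)) = v n" if "j < n" for j
  proof (rule LIMSEQ_unique)
    show "(\<lambda>m. \<sigma> (r m) * u (r m) j - (\<Sum>i<n. u (r m) i * M $$ (i, j))) \<longlonglongrightarrow>
        s * v j - (\<Sum>i<n. v i * M $$ (i, j))"
      using that by (intro tendsto_diff tendsto_mult tendsto_sum tendsto_const \<sigma>r v) auto
    show "(\<lambda>m. \<sigma> (r m) * u (r m) j - (\<Sum>i<n. u (r m) i * M $$ (i, j))) \<longlonglongrightarrow> v n"
      unfolding u_eq[OF that] by (rule v) simp
  qed
  \<comment> \<open>A positive limit of the factor 1 / Y m would make v strictly subinvariant at the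
    infimum itself. With limit 0 the resolvent equation becomes the eigenvector equation.\<close>
  have "v n = 0"
  proof (rule ccontr)
    assume "v n \<noteq> 0"
    then have vn: "v n > 0" using v_nonneg[of n] by simp
    have "subinvariant M n s v"
    proof (rule nonneg_strict_imp_subinvariant)
      fix j assume "j < n"
      then show "0 \<le> v j" using v_nonneg by simp
      show "(\<Sum>i<n. v i * M $$ (i, j)) < s * v j" using v_eq[OF \<open>j < n\<close>] vn by linarith
    qed
    then show False using not_s by blast
  qed
  have "\<exists>l<n. 0 < v l"
  proof (rule ccontr)
    assume "\<not> ?thesis"
    then have "v i \<le> 0" if "i < n" for i using that not_less by blast
    then have "(\<Sum>i<n. v i) \<le> 0" by (intro sum_nonpos) simp
    then show False using v_sum by simp
  qed
  then obtain l where l: "l < n" "0 < v l" by blast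
  show thesis
  proof (rule unstable[of v l s, OF _ l \<open>s \<ge> 0\<close>])
    show "0 \<le> v i" if "i < n" for i using v_nonneg that by simp
    show "(\<Sum>i<n. v i * M $$ (i, j)) = s * v j" if "j < n" for j
      using v_eq[OF that] \<open>v n = 0\<close> by linarith
  qed
next
  case True
  then show thesis using stable by blast
qed

end

section \<open>Rank conditions and Hurwitz polynomials\<close>

context vec_space
begin

lemma rank_le_of_cols_in_span:
  assumes A: "A \<in> carrier_mat n p" and B: "B \<in> carrier_mat n q"
    and sub: "set (cols A) \<subseteq> span (set (cols B))"
  shows "rank A \<le> rank B"
proof -
  have cA: "set (cols A) \<subseteq> carrier_vec n" and cB: "set (cols B) \<subseteq> carrier_vec n"
    using cols_dim A B by blast+
  have sA: "subspace class_ring (span (set (cols A))) V" and sB: "subspace class_ring (span (set (cols B))) V"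
    using span_is_subspace cA cB by auto
  have le: "span (set (cols A)) \<subseteq> span (set (cols B))"
    using span_subsetI[OF cB sub] .
  have vB: "vectorspace class_ring (vs (span (set (cols B))))" by (rule subspace_is_vs[OF sB])
  have "subspace class_ring (span (set (cols A))) (vs (span (set (cols B))))"
    by (rule nested_subspaces[OF sB sA le])
  from vectorspace.subspace_dim[OF vB this fin_dim_span_cols[OF B]]
  show ?thesis unfolding rank_def using fin_dim_span_cols[OF A] by simp
qed

lemma mult_mat_vec_in_span_cols:
  assumes "B \<in> carrier_mat n q" "x \<in> carrier_vec q"
  shows "B *\<^sub>v x \<in> span (set (cols B))"
  using col_space_eq[OF assms(1)] assms unfolding col_space_def by auto

lemma rank_one_mat: "rank (1\<^sub>m n :: 'a mat) = n"
  using det_rank_iff[of "1\<^sub>m n"] by simp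

text \<open>Columns annihilated by a nonzero y are fixed by a singular projection, so they lie in
  its column space, whose dimension is less than n.\<close>

lemma rank_eq_n_imp_left_kernel_trivial:
  assumes H: "H \<in> carrier_mat n m" and rk: "rank H = n"
    and y: "\<And>j. j < m \<Longrightarrow> (\<Sum>i<n. y i * H $$ (i, j)) = 0" and l: "l < n"
  shows "y l = 0"
proof (rule ccontr)
  assume yl: "y l \<noteq> 0"
  \<comment> \<open>the projection along the unit vector \<open>l\<close> onto the hyperplane annihilated by \<open>y\<close>\<close>
  define P where "P = mat n n (\<lambda>(i, j). (if i = j then 1 else 0) - (if i = l then y j / y l else 0))"
  have P: "P \<in> carrier_mat n n" by (simp add: P_def)
  have Pv: "(P *\<^sub>v v) $ i = v $ i - (if i = l then (\<Sum>j<n. y j * v $ j) / y l else 0)"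
    if v: "v \<in> carrier_vec n" and i: "i < n" for v i
  proof -
    have "(P *\<^sub>v v) $ i = (\<Sum>j<n. P $$ (i, j) * v $ j)"
      using P v i by (simp add: scalar_prod_def atLeast0LessThan)
    also have "\<dots> = (\<Sum>j<n. (if j = i then v $ j else 0) - (if i = l then y j * v $ j / y l else 0))"
      using i by (intro sum.cong) (auto simp: P_def algebra_simps)
    finally show ?thesis using i by (simp add: sum_subtractf sum_divide_distrib)
  qed
  have "P *\<^sub>v unit_vec n l = 0\<^sub>v n"
  proof (rule eq_vecI)
    fix i assume i: "i < dim_vec (0\<^sub>v n :: 'a vec)"
    have "(\<Sum>j<n. y j * unit_vec n l $ j) = (\<Sum>j<n. if j = l then y j else 0)"
      using l by (intro sum.cong) auto
    then have "(\<Sum>j<n. y j * unit_vec n l $ j) = y l" using l by simp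
    then show "(P *\<^sub>v unit_vec n l) $ i = 0\<^sub>v n $ i"
      using Pv[of "unit_vec n l" i] i l yl by simp
  qed (use P in simp)
  moreover have "unit_vec n l \<noteq> (0\<^sub>v n :: 'a vec)"
  proof
    assume "unit_vec n l = (0\<^sub>v n :: 'a vec)"
    then have "unit_vec n l $ l = (0\<^sub>v n :: 'a vec) $ l" by simp
    then show False using l by simp
  qed
  ultimately have "det P = 0" using det_0_iff_vec_prod_zero[OF P] unit_vec_carrier by blast
  then have "rank P \<noteq> n" using det_rank_iff[OF P] by blast
  then have "rank P < n" using rank_le_nc[OF P] by simp
  have "set (cols H) \<subseteq> span (set (cols P))"
  proof
    fix h assume "h \<in> set (cols H)"
    then obtain j where j: "j < m" "h = col H j" using H by (auto simp: cols_def)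
    have h: "h \<in> carrier_vec n" using H j by auto
    have "(\<Sum>i<n. y i * h $ i) = 0" using y[OF j(1)] H j by simp
    then have "P *\<^sub>v h = h" using h P Pv[OF h] by (intro eq_vecI) auto
    then show "h \<in> span (set (cols P))" using mult_mat_vec_in_span_cols[OF P h] by simp
  qed
  then have "rank H \<le> rank P" by (rule rank_le_of_cols_in_span[OF H P])
  then show False using rk \<open>rank P < n\<close> by simp
qed

end

text \<open>Let G be H times its adjoint. If G v = 0, the image u of v under the adjoint has squared
  norm equal to the inner product of v with G v, so u = 0 and the conjugate of v lies in the left
  kernel of H. Hence G is invertible, and every vector is H applied to something.\<close>

lemma left_kernel_trivial_imp_rank_eq_n:
  fixes H :: "complex mat"
  assumes H: "H \<in> carrier_mat n m"
    and inj: "\<And>y. (\<And>j. j < m \<Longrightarrow> (\<Sum>i<n. y i * H $$ (i, j)) = 0) \<Longrightarrow> (\<forall>i<n. y i = 0)"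
  shows "vec_space.rank n H = n"
proof -
  interpret vec_space "TYPE(complex)" n .
  define Hs where "Hs = mat m n (\<lambda>(j, i). cnj (H $$ (i, j)))"
  have Hs: "Hs \<in> carrier_mat m n" by (simp add: Hs_def)
  define G where "G = H * Hs"
  have G: "G \<in> carrier_mat n n" using H Hs by (simp add: G_def)
  have G_inj: "v = 0\<^sub>v n" if v: "v \<in> carrier_vec n" "G *\<^sub>v v = 0\<^sub>v n" for v
  proof -
    define u where "u = Hs *\<^sub>v v"
    have u: "u \<in> carrier_vec m" using Hs v by (simp add: u_def)
    have uj: "u $ j = (\<Sum>i<n. cnj (H $$ (i, j)) * v $ i)" if "j < m" for j
      using that v Hs by (simp add: u_def Hs_def scalar_prod_def atLeast0LessThan)
    have "H *\<^sub>v u = 0\<^sub>v n"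
      unfolding u_def using v H Hs assoc_mult_mat_vec[OF H Hs v(1)] by (simp add: G_def)
    then have Hu: "(\<Sum>j<m. H $$ (i, j) * u $ j) = 0" if "i < n" for i
      using mult_mat_vec_sum[OF H u that] that by simp
    have cuj: "cnj (u $ j) = (\<Sum>i<n. cnj (v $ i) * H $$ (i, j))" if "j < m" for j
      by (simp add: uj[OF that] mult.commute)
    have "(\<Sum>j<m. (cmod (u $ j))\<^sup>2) = 0"
    proof -
      have "complex_of_real (\<Sum>j<m. (cmod (u $ j))\<^sup>2) = (\<Sum>j<m. cnj (u $ j) * u $ j)"
        by (simp add: complex_norm_square mult.commute del: of_real_power)
      also have "\<dots> = (\<Sum>j<m. \<Sum>i<n. cnj (v $ i) * (H $$ (i, j) * u $ j))"
        by (intro sum.cong) (auto simp: cuj sum_distrib_right mult.assoc)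
      also have "\<dots> = (\<Sum>i<n. cnj (v $ i) * (\<Sum>j<m. H $$ (i, j) * u $ j))"
        by (subst sum.swap) (simp add: sum_distrib_left)
      also have "\<dots> = 0" using Hu by simp
      finally show ?thesis by (simp only: of_real_eq_0_iff)
    qed
    then have u0: "u $ j = 0" if "j < m" for j
      using that by (simp add: sum_nonneg_eq_0_iff)
    have "\<forall>i<n. cnj (v $ i) = 0"
    proof (rule inj)
      fix j assume "j < m"
      then show "(\<Sum>i<n. cnj (v $ i) * H $$ (i, j)) = 0" using u0 cuj[of j] by simp
    qed
    then show ?thesis using v by (intro eq_vecI) auto
  qed
  have "set (cols (1\<^sub>m n)) \<subseteq> span (set (cols H))"
  proof
    fix h :: "complex vec" assume "h \<in> set (cols (1\<^sub>m n))"
    then have h: "h \<in> carrier_vec n" using cols_dim[of "1\<^sub>m n"] by auto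
    obtain y where y: "y \<in> carrier_vec n" "G *\<^sub>v y = h" using injective_mat_solvable[OF G h G_inj] by blast
    have "h = H *\<^sub>v (Hs *\<^sub>v y)" using y(2) assoc_mult_mat_vec[OF H Hs y(1)] by (simp add: G_def)
    then show "h \<in> span (set (cols H))" using mult_mat_vec_in_span_cols[OF H] Hs y(1) by simp
  qed
  then have "n \<le> rank H" using rank_le_of_cols_in_span[OF one_carrier_mat H] rank_one_mat by simp
  moreover have "rank H \<le> n"
  proof -
    have "set (cols H) \<subseteq> span (set (cols (1\<^sub>m n)))"
    proof
      fix h assume "h \<in> set (cols H)"
      then have "h \<in> carrier_vec n" using cols_dim[of H] H by auto
      then show "h \<in> span (set (cols (1\<^sub>m n)))"
        using mult_mat_vec_in_span_cols[OF one_carrier_mat, of h] by simp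
    qed
    then show ?thesis using rank_le_of_cols_in_span[OF H one_carrier_mat] rank_one_mat by simp
  qed
  ultimately show ?thesis by simp
qed

text \<open>The Popov-Belevitch-Hautus test: the left kernel of [zI - A, b] consists of 0 and the
  left eigenvectors of A for z that annihilate b.\<close>

lemma hautus_rank_iff:
  assumes A: "A \<in> carrier_mat n n" and b: "b \<in> carrier_vec n"
  shows "vec_space.rank n (hautus n A b z) = n \<longleftrightarrow>
    (\<forall>y. (\<forall>j<n. (\<Sum>i<n. y i * of_real (A $$ (i, j))) = z * y j) \<and> (\<Sum>i<n. y i * of_real (b $ i)) = 0
      \<longrightarrow> (\<forall>i<n. y i = 0))"
proof -
  let ?H = "hautus n A b z"
  have H: "?H \<in> carrier_mat n (Suc n)" by (simp add: hautus_def)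
  have ent: "(\<Sum>i<n. y i * ?H $$ (i, j)) = z * y j - (\<Sum>i<n. y i * of_real (A $$ (i, j)))" if "j < n" for y j
  proof -
    have "(\<Sum>i<n. y i * ?H $$ (i, j)) = (\<Sum>i<n. (if i = j then z * y i else 0) - y i * of_real (A $$ (i, j)))"
      using that by (intro sum.cong) (auto simp: hautus_def algebra_simps)
    then show ?thesis using that by (simp add: sum_subtractf)
  qed
  have last: "(\<Sum>i<n. y i * ?H $$ (i, n)) = (\<Sum>i<n. y i * of_real (b $ i))" for y
    by (simp add: hautus_def)
  have ker: "(\<forall>j<Suc n. (\<Sum>i<n. y i * ?H $$ (i, j)) = 0) \<longleftrightarrow>
      (\<forall>j<n. (\<Sum>i<n. y i * of_real (A $$ (i, j))) = z * y j) \<and> (\<Sum>i<n. y i * of_real (b $ i)) = 0" for y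
    using ent last by (auto simp: less_Suc_eq)
  show ?thesis
    unfolding ker[symmetric]
  proof (intro iffI allI impI)
    fix y i
    assume "vec_space.rank n ?H = n" "\<forall>j<Suc n. (\<Sum>i<n. y i * ?H $$ (i, j)) = 0" "i < n"
    then show "y i = 0" by (intro vec_space.rank_eq_n_imp_left_kernel_trivial[OF H, of y]) auto
  next
    assume triv: "\<forall>y. (\<forall>j<Suc n. (\<Sum>i<n. y i * ?H $$ (i, j)) = 0) \<longrightarrow> (\<forall>i<n. y i = 0)"
    show "vec_space.rank n ?H = n"
      by (rule left_kernel_trivial_imp_rank_eq_n[OF H]) (use triv in blast)
  qed
qed

lemma pow_mat_Suc_mult_vec:
  assumes A: "A \<in> carrier_mat n n" and b: "b \<in> carrier_vec n"
  shows "(A ^\<^sub>m Suc j) *\<^sub>v b = A *\<^sub>v ((A ^\<^sub>m j) *\<^sub>v b)"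
proof -
  have "A ^\<^sub>m Suc j = A * A ^\<^sub>m j"
  proof (induction j)
    case (Suc j)
    then show ?case
      using A by (metis assoc_mult_mat pow_carrier_mat pow_mat.simps(2))
  qed (use A in simp)
  then show ?thesis using assoc_mult_mat_vec[OF A pow_carrier_mat[OF A] b] by simp
qed

text \<open>Once one power is a combination of its predecessors, multiplication by A keeps all later
  ones in the same span. Its use is contrapositive: rank k makes A^(k-1) b independent of the lower
  powers.\<close>

lemma krylov_rank_le:
  fixes A :: "real mat"
  assumes A: "A \<in> carrier_mat n n" and b: "b \<in> carrier_vec n"
    and d: "\<And>i. i < n \<Longrightarrow> ((A ^\<^sub>m m) *\<^sub>v b) $ i = (\<Sum>j<m. d j * ((A ^\<^sub>m j) *\<^sub>v b) $ i)"
  shows "vec_space.rank n (krylov n A b) \<le> m"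
proof -
  interpret vec_space "TYPE(real)" n .
  define p where "p j = (A ^\<^sub>m j) *\<^sub>v b" for j
  have p: "p j \<in> carrier_vec n" for j
    unfolding p_def by (rule mult_mat_vec_carrier[OF pow_carrier_mat[OF A] b])
  have pS: "p (Suc j) $ i = (\<Sum>l<n. A $$ (i, l) * p j $ l)" if "i < n" for i j
    using pow_mat_Suc_mult_vec[OF A b, of j] mult_mat_vec_sum[OF A p that] by (simp add: p_def)
  have low: "\<exists>e. \<forall>i<n. p (Suc j) $ i = (\<Sum>l<m. e l * p l $ i)" if "j < m" for j
  proof (cases "Suc j = m")
    case True
    then show ?thesis using d by (auto simp: p_def)
  next
    case False
    then have "Suc j < m" using that by simp
    then have "p (Suc j) $ i = (\<Sum>l<m. (if l = Suc j then 1 else 0) * p l $ i)" for i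
      by (simp add: if_distrib[of "\<lambda>u. u * _"] cong: if_cong)
    then show ?thesis by (intro exI[of _ "\<lambda>l. if l = Suc j then 1 else 0"]) simp
  qed
  have all: "\<exists>c. \<forall>i<n. p j $ i = (\<Sum>l<m. c l * p l $ i)" for j
  proof (induction j)
    case 0
    show ?case
    proof (cases "m = 0")
      case True
      then show ?thesis using d by (auto simp: p_def)
    next
      case False
      then have "p 0 $ i = (\<Sum>l<m. (if l = 0 then 1 else 0) * p l $ i)" for i
        by (simp add: if_distrib[of "\<lambda>u. u * _"] cong: if_cong)
      then show ?thesis by (intro exI[of _ "\<lambda>l. if l = 0 then 1 else 0"]) simp
    qed
  next
    case (Suc j)
    then obtain c where c: "\<And>i. i < n \<Longrightarrow> p j $ i = (\<Sum>l<m. c l * p l $ i)" by blast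
    obtain e where e: "\<And>q i. q < m \<Longrightarrow> i < n \<Longrightarrow> p (Suc q) $ i = (\<Sum>l<m. e q l * p l $ i)"
    proof -
      have "\<forall>q. \<exists>e. q < m \<longrightarrow> (\<forall>i<n. p (Suc q) $ i = (\<Sum>l<m. e l * p l $ i))" using low by blast
      then obtain e where "\<forall>q. q < m \<longrightarrow> (\<forall>i<n. p (Suc q) $ i = (\<Sum>l<m. e q l * p l $ i))"
        by (rule exE[OF choice])
      then show thesis using that by blast
    qed
    have "p (Suc j) $ i = (\<Sum>l<m. (\<Sum>q<m. c q * e q l) * p l $ i)" if i: "i < n" for i
    proof -
      have "p (Suc j) $ i = (\<Sum>l<n. \<Sum>q<m. c q * (A $$ (i, l) * p q $ l))"
        unfolding pS[OF i] by (intro sum.cong) (auto simp: c sum_distrib_left mult_ac)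
      also have "\<dots> = (\<Sum>q<m. c q * p (Suc q) $ i)"
        by (subst sum.swap) (simp add: pS[OF i] sum_distrib_left)
      also have "\<dots> = (\<Sum>q<m. \<Sum>l<m. c q * e q l * p l $ i)"
        using e i by (intro sum.cong) (auto simp: sum_distrib_left mult.assoc)
      also have "\<dots> = (\<Sum>l<m. (\<Sum>q<m. c q * e q l) * p l $ i)"
        by (subst sum.swap) (simp add: sum_distrib_right)
      finally show ?thesis .
    qed
    then show ?case by (intro exI[of _ "\<lambda>l. \<Sum>q<m. c q * e q l"] allI impI)
  qed
  define B where "B = mat n m (\<lambda>(i, j). p j $ i)"
  have B: "B \<in> carrier_mat n m" by (simp add: B_def)
  have K: "krylov n A b \<in> carrier_mat n n" by (simp add: krylov_def)
  have "set (cols (krylov n A b)) \<subseteq> span (set (cols B))"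
  proof
    fix h assume "h \<in> set (cols (krylov n A b))"
    then obtain j where j: "j < n" "h = col (krylov n A b) j" using K by (auto simp: cols_def)
    have h: "h $ i = p j $ i" if "i < n" for i using j that by (simp add: krylov_def p_def)
    obtain c where c: "\<And>i. i < n \<Longrightarrow> p j $ i = (\<Sum>l<m. c l * p l $ i)" using all by blast
    have "h = B *\<^sub>v vec m c"
    proof (rule eq_vecI)
      fix i assume "i < dim_vec (B *\<^sub>v vec m c)"
      then have i: "i < n" using B by simp
      show "h $ i = (B *\<^sub>v vec m c) $ i"
        unfolding h[OF i] c[OF i] using i by (simp add: B_def scalar_prod_def atLeast0LessThan mult.commute)
    qed (use j K B in simp)
    then show "h \<in> span (set (cols B))" using mult_mat_vec_in_span_cols[OF B, of "vec m c"] by simp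
  qed
  then have "rank (krylov n A b) \<le> rank B" by (rule rank_le_of_cols_in_span[OF K B])
  also have "\<dots> \<le> m" by (rule rank_le_nc[OF B])
  finally show ?thesis .
qed

section \<open>Real Hurwitz polynomials\<close>

definition pos_coeffs :: "real poly \<Rightarrow> bool" where
  "pos_coeffs p \<longleftrightarrow> (\<forall>i\<le>degree p. 0 < coeff p i)"

lemma pos_coeffs_mult:
  assumes p: "pos_coeffs p" and q: "pos_coeffs q"
  shows "pos_coeffs (p * q)"
  unfolding pos_coeffs_def
proof (intro allI impI)
  fix m assume m: "m \<le> degree (p * q)"
  have "p \<noteq> 0" "q \<noteq> 0" using p q by (auto simp: pos_coeffs_def)
  then have m': "m \<le> degree p + degree q" using m by (simp add: degree_mult_eq)
  have nonneg: "0 \<le> coeff r i" if "pos_coeffs r" for r i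
    using that by (cases "i \<le> degree r") (auto simp: pos_coeffs_def less_imp_le coeff_eq_0)
  \<comment> \<open>An index at which both factors stay within their degrees, so this summand is
    strictly positive while the others are nonnegative.\<close>
  define i where "i = min m (degree p)"
  have i: "i \<le> m" "i \<le> degree p" "m - i \<le> degree q" using m' by (auto simp: i_def)
  have "0 < coeff p i * coeff q (m - i)" using i p q by (simp add: pos_coeffs_def)
  also have "\<dots> \<le> (\<Sum>i\<le>m. coeff p i * coeff q (m - i))"
    using i(1) nonneg p q by (intro member_le_sum) auto
  finally show "0 < coeff (p * q) m" by (simp add: coeff_mult)
qed

lemma map_poly_of_real_mult:
  "map_poly complex_of_real (p * q) = map_poly complex_of_real p * map_poly complex_of_real q"
proof -
  interpret map_poly_comm_semiring_hom complex_of_real ..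
  show ?thesis by (simp add: hom_distribs)
qed

lemma poly_map_of_real_linear:
  "poly (map_poly complex_of_real [:a, c:]) z = of_real a + z * of_real c"
  by (simp add: of_real_hom.map_poly_pCons_hom)

text \<open>Split off a real root or a conjugate pair of roots z: both x - z and x^2 - 2 Re z x +
  |z|^2 have positive coefficients when Re z < 0, and products preserve positivity of
  coefficients.\<close>

lemma hurwitz_imp_pos_coeffs:
  fixes p :: "real poly"
  assumes "0 < lead_coeff p"
    and "\<And>z. poly (map_poly complex_of_real p) z = 0 \<Longrightarrow> Re z < 0"
  shows "pos_coeffs p"
  using assms
proof (induction "degree p" arbitrary: p rule: less_induct)
  case less
  have "p \<noteq> 0" using less.prems(1) by auto
  show ?case
  proof (cases "degree p = 0")
    case True
    then show ?thesis using less.prems(1) by (simp add: pos_coeffs_def)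
  next
    case False
    have "\<not> constant (poly (map_poly complex_of_real p))"
      using False by (simp add: constant_degree degree_map_poly)
    then obtain z where z: "poly (map_poly complex_of_real p) z = 0"
      using fundamental_theorem_of_algebra by blast
    have "Re z < 0" by (rule less.prems(2)[OF z])
    have "\<exists>d q. p = d * q \<and> pos_coeffs d \<and> lead_coeff d = 1 \<and> 0 < degree d"
    proof (cases "Im z = 0")
      case True
      then have zr: "z = complex_of_real (Re z)" by (simp add: complex_eq_iff)
      have "complex_of_real (poly p (Re z)) = 0"
        using z zr by (metis of_real_hom.poly_map_poly)
      then have "[:- Re z, 1:] dvd p" by (simp add: poly_eq_0_iff_dvd)
      then obtain q where "p = [:- Re z, 1:] * q" by (auto simp: dvd_def)
      moreover have "pos_coeffs [:- Re z, 1:]"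
        using \<open>Re z < 0\<close> by (auto simp: pos_coeffs_def le_Suc_eq)
      ultimately show ?thesis by (intro exI[of _ "[:- Re z, 1:]"] exI[of _ q]) auto
    next
      case False
      define d where "d = [:(Re z)\<^sup>2 + (Im z)\<^sup>2, - 2 * Re z, 1:]"
      have degd: "degree d = 2" by (simp add: d_def)
      have dz: "poly (map_poly complex_of_real d) z = 0"
      proof -
        have "poly (map_poly complex_of_real d) z = of_real ((Re z)\<^sup>2 + (Im z)\<^sup>2) + z * (of_real (- 2 * Re z) + z)"
          by (simp add: d_def of_real_hom.map_poly_pCons_hom)
        also have "\<dots> = 0"
          by (simp add: complex_eq_iff power2_eq_square algebra_simps)
        finally show ?thesis .
      qed
      \<comment> \<open>A real remainder of degree below 2 with a nonreal root is zero, so d divides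
        p.\<close>
      define r where "r = p mod d"
      have "d \<noteq> 0" using degd by auto
      then have "r = 0 \<or> degree r < 2" using degree_mod_less[of d p] degd by (simp add: r_def)
      then have r: "r = [:coeff r 0, coeff r 1:]"
        by (intro poly_eqI) (auto simp: coeff_pCons coeff_eq_0 split: nat.split)
      have "poly (map_poly complex_of_real r) z = 0"
      proof -
        have "map_poly complex_of_real p = map_poly complex_of_real (d * (p div d) + r)" by (simp add: r_def)
        also have "\<dots> = map_poly complex_of_real d * map_poly complex_of_real (p div d) + map_poly complex_of_real r"
          by (simp add: of_real_hom.map_poly_hom_add map_poly_of_real_mult)
        finally show ?thesis using z dz by simp
      qed
      then have "of_real (coeff r 0) + z * of_real (coeff r 1) = 0"
        using poly_map_of_real_linear[of "coeff r 0" "coeff r 1" z] r by simp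
      then have "coeff r 0 + Re z * coeff r 1 = 0" "Im z * coeff r 1 = 0"
        by (auto simp: complex_eq_iff)
      then have "coeff r 1 = 0" "coeff r 0 = 0" using False by auto
      then have "r = 0" using r by simp
      then have "p = d * (p div d)" by (simp add: r_def mod_eq_0_iff_dvd)
      moreover have "pos_coeffs d"
        using \<open>Re z < 0\<close> sum_power2_gt_zero_iff[of "Re z" "Im z"] unfolding pos_coeffs_def degd
        by (auto simp: d_def coeff_pCons numeral_2_eq_2 le_Suc_eq split: nat.split)
      moreover have "lead_coeff d = 1" by (simp add: d_def)
      ultimately show ?thesis using degd by (intro exI[of _ d] exI[of _ "p div d"]) auto
    qed
    then obtain d q where d: "p = d * q" "pos_coeffs d" "lead_coeff d = 1" "0 < degree d" by blast
    have "q \<noteq> 0" using \<open>p \<noteq> 0\<close> d(1) by auto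
    have "pos_coeffs q"
    proof (rule less.hyps)
      show "degree q < degree p" 
      proof -
        have "d \<noteq> 0" using d(4) by auto
        then show ?thesis unfolding d(1) using d(4) \<open>q \<noteq> 0\<close> by (simp add: degree_mult_eq)
      qed
      show "0 < lead_coeff q" using less.prems(1) d by (simp add: lead_coeff_mult)
      show "Re z < 0" if "poly (map_poly complex_of_real q) z = 0" for z
        using that by (intro less.prems(2)) (simp add: d(1) map_poly_of_real_mult)
    qed
    then show ?thesis using pos_coeffs_mult d by simp
  qed
qed

section \<open>State feedback\<close>

text \<open>Left eigenvectors are eigenvectors of the transpose, which has the same characteristic
  polynomial.\<close>

lemma left_eigenvector_imp_eigenvalue:
  fixes N :: "'a::field mat"
  assumes N: "N \<in> carrier_mat n n" and eig: "\<And>j. j < n \<Longrightarrow> (\<Sum>i<n. y i * N $$ (i, j)) = z * y j"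
    and l: "l < n" "y l \<noteq> 0"
  shows "eigenvalue N z"
proof -
  have NT: "N\<^sup>T \<in> carrier_mat n n" using N by simp
  define v where "v = vec n y"
  have v: "v \<in> carrier_vec n" by (simp add: v_def)
  have "N\<^sup>T *\<^sub>v v = z \<cdot>\<^sub>v v"
  proof (rule eq_vecI)
    fix j assume "j < dim_vec (z \<cdot>\<^sub>v v)"
    then have j: "j < n" using v by simp
    have "(N\<^sup>T *\<^sub>v v) $ j = (\<Sum>i<n. y i * N $$ (i, j))"
      unfolding mult_mat_vec_sum[OF NT v j] using j N by (simp add: v_def mult.commute)
    then show "(N\<^sup>T *\<^sub>v v) $ j = (z \<cdot>\<^sub>v v) $ j" using eig[OF j] j by (simp add: v_def)
  qed (use NT v in simp)
  moreover have "v \<noteq> 0\<^sub>v n"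
  proof
    assume "v = 0\<^sub>v n"
    then have "v $ l = 0\<^sub>v n $ l" by simp
    then show False using l by (simp add: v_def)
  qed
  ultimately have "eigenvalue (N\<^sup>T) z"
    unfolding eigenvalue_def eigenvector_def using v NT by auto
  then show ?thesis
    using eigenvalue_root_char_poly[OF NT] eigenvalue_root_char_poly[OF N] char_poly_transpose_mat[OF N] by simp
qed

lemma feedback_carrier:
  "A \<in> carrier_mat n n \<Longrightarrow> b \<in> carrier_vec n \<Longrightarrow> K \<in> carrier_vec n \<Longrightarrow> A + outer b K \<in> carrier_mat n n"
  by (auto simp: outer_def)

lemma feedback_index:
  assumes "A \<in> carrier_mat n n" "b \<in> carrier_vec n" "K \<in> carrier_vec n" "i < n" "j < n"
  shows "(A + outer b K) $$ (i, j) = A $$ (i, j) + b $ i * K $ j"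
  using assms by (auto simp: outer_def)

section \<open>The gain bounds as entrywise conditions\<close>

context
  fixes T :: "real set"
  assumes T: "time_scale T" "\<not> bdd_above T" and bdd: "bdd_above (graininess T ` T)"
begin

lemma graininess_bounds: "t \<in> T \<Longrightarrow> 0 \<le> graininess T t" "t \<in> T \<Longrightarrow> graininess T t \<le> mubar T"
proof -
  assume t: "t \<in> T"
  interpret half_time_scale "tsfrom T t" t by (rule tsfrom_half_time_scale) fact+
  show "0 \<le> graininess T t" using graininess_nonneg[of t] graininess_tsfrom[OF start_in] by simp
  show "graininess T t \<le> mubar T" unfolding mubar_def using t bdd by (intro cSup_upper) auto
qed

lemma mubar_nonneg: "0 \<le> mubar T"
proof -
  obtain t where "t \<in> T" using T(1) by (auto simp: time_scale_def)
  then show ?thesis using graininess_bounds[of t] by linarith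
qed

text \<open>1 + \<mu>m is affine in \<mu> with value 1 at 0, so the supremum of the graininess
  decides. It need not be attained; for negative m the pointwise bound \<mu> \<le> 1/(-m) passes to
  the supremum.\<close>

lemma graininess_diag_iff:
  "(\<forall>t\<in>T. 0 \<le> 1 + graininess T t * m) \<longleftrightarrow> (mubar T = 0 \<or> - 1 / mubar T \<le> m)"
proof
  assume all: "\<forall>t\<in>T. 0 \<le> 1 + graininess T t * m"
  show "mubar T = 0 \<or> - 1 / mubar T \<le> m"
  proof (rule ccontr)
    assume "\<not> ?thesis"
    then have pos: "0 < mubar T" and lt: "m < - 1 / mubar T" using mubar_nonneg by auto
    have "- 1 / mubar T < 0" using pos by simp
    then have "m < 0" using lt by linarith
    have "graininess T t \<le> 1 / (- m)" if "t \<in> T" for t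
    proof -
      have "graininess T t * (- m) \<le> 1" using all that by auto
      then show ?thesis using \<open>m < 0\<close> by (simp only: pos_le_divide_eq neg_0_less_iff_less)
    qed
    then have "mubar T \<le> 1 / (- m)"
      unfolding mubar_def using T(1) by (intro cSup_least) (auto simp: time_scale_def)
    then have "mubar T * (- m) \<le> 1" using \<open>m < 0\<close> by (simp only: pos_le_divide_eq neg_0_less_iff_less)
    moreover have "m * mubar T < - 1" using lt unfolding pos_less_divide_eq[OF pos] .
    ultimately show False by (simp add: mult.commute)
  qed
next
  assume D: "mubar T = 0 \<or> - 1 / mubar T \<le> m"
  show "\<forall>t\<in>T. 0 \<le> 1 + graininess T t * m"
  proof
    fix t assume t: "t \<in> T"
    note g = graininess_bounds[OF t]
    show "0 \<le> 1 + graininess T t * m"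
    proof (cases "mubar T = 0")
      case True
      then have "graininess T t = 0" using g by simp
      then show ?thesis by simp
    next
      case False
      then have pos: "0 < mubar T" using mubar_nonneg by simp
      have "graininess T t * (- 1 / mubar T) \<le> graininess T t * m"
        using D False g(1) by (intro mult_left_mono) auto
      moreover have "graininess T t / mubar T \<le> 1" using g(2) pos by simp
      ultimately show ?thesis by simp
    qed
  qed
qed

text \<open>An index without any constraint has supremum -\<infinity> and is bounded by every c;
  \<open>mubar T = 0\<close> is the case of infinite \<open>gammaT\<close>.\<close>

lemma alpha_bound_le_iff:
  "alpha_bound T n A b j \<le> ereal c \<longleftrightarrow>
    (\<forall>i<n. i \<noteq> j \<longrightarrow> b $ i \<noteq> 0 \<longrightarrow> - A $$ (i, j) / b $ i \<le> c) \<and>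
    (b $ j \<noteq> 0 \<longrightarrow> mubar T \<noteq> 0 \<longrightarrow> (- A $$ (j, j) - 1 / mubar T) / b $ j \<le> c)"
proof -
  have "gammaT T < PInfty \<longleftrightarrow> mubar T \<noteq> 0" by (simp add: gammaT_def)
  then show ?thesis unfolding alpha_bound_def Sup_le_iff by auto
qed

text \<open>Entry (i, j) changes by b_i k_j, so each constraint involves a single k_j: for b_i > 0
  it is a lower bound on k_j, for b_i = 0 it is inherited from A.\<close>

lemma ts_metzler_feedback_iff:
  assumes A: "A \<in> carrier_mat n n" "ts_metzler T n A" and b: "b \<in> carrier_vec n" "\<And>i. i < n \<Longrightarrow> 0 \<le> b $ i"
    and K: "K \<in> carrier_vec n"
  shows "ts_metzler T n (A + outer b K) \<longleftrightarrow> (\<forall>j<n. alpha_bound T n A b j \<le> ereal (K $ j))"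
proof -
  have off: "0 \<le> A $$ (i, j) + b $ i * c \<longleftrightarrow> (b $ i \<noteq> 0 \<longrightarrow> - A $$ (i, j) / b $ i \<le> c)"
    if "i < n" "j < n" "i \<noteq> j" for i j c
  proof (cases "b $ i = 0")
    case True
    then show ?thesis using A(2) that by (simp add: ts_metzler_def)
  next
    case False
    then have "0 < b $ i" using b(2)[OF that(1)] by simp
    then have "- A $$ (i, j) / b $ i \<le> c \<longleftrightarrow> - A $$ (i, j) \<le> b $ i * c"
      by (simp only: pos_divide_le_eq mult.commute)
    then show ?thesis using False by auto
  qed
  have diag: "(\<forall>t\<in>T. 0 \<le> 1 + graininess T t * (A $$ (j, j) + b $ j * c)) \<longleftrightarrow>
      (b $ j \<noteq> 0 \<longrightarrow> mubar T \<noteq> 0 \<longrightarrow> (- A $$ (j, j) - 1 / mubar T) / b $ j \<le> c)" if "j < n" for j c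
  proof (cases "b $ j = 0")
    case True
    then show ?thesis using A(2) that by (simp add: ts_metzler_def)
  next
    case False
    then have "0 < b $ j" using b(2)[OF that] by simp
    then have "(- A $$ (j, j) - 1 / mubar T) / b $ j \<le> c \<longleftrightarrow> - A $$ (j, j) - 1 / mubar T \<le> b $ j * c"
      by (simp only: pos_divide_le_eq mult.commute)
    then show ?thesis unfolding graininess_diag_iff using False by auto
  qed
  have "ts_metzler T n (A + outer b K) \<longleftrightarrow>
      (\<forall>i<n. \<forall>j<n. i \<noteq> j \<longrightarrow> 0 \<le> A $$ (i, j) + b $ i * K $ j) \<and>
      (\<forall>j<n. \<forall>t\<in>T. 0 \<le> 1 + graininess T t * (A $$ (j, j) + b $ j * K $ j))"
    unfolding ts_metzler_def using feedback_index[OF A(1) b(1) K] by auto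
  also have "\<dots> \<longleftrightarrow> (\<forall>j<n. alpha_bound T n A b j \<le> ereal (K $ j))"
    unfolding alpha_bound_le_iff using off diag by auto
  finally show ?thesis .
qed

end

section \<open>The Krylov chain v_k, ..., v_0 under feedback\<close>

definition lower_krylov :: "nat \<Rightarrow> real mat \<Rightarrow> real vec \<Rightarrow> nat \<Rightarrow> (nat \<Rightarrow> real) \<Rightarrow> bool" where
  "lower_krylov n A b k u \<longleftrightarrow>
    (\<exists>d. \<forall>r<n. u r = (\<Sum>j<k - 1. d j * ((A ^\<^sub>m j) *\<^sub>v b) $ r))"

context
  fixes n :: nat and A :: "real mat" and b :: "real vec" and a :: "nat \<Rightarrow> real" and k :: nat
  assumes A: "A \<in> carrier_mat n n" and b: "b \<in> carrier_vec n"
    and k: "k = vec_space.rank n (krylov n A b)"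
    and rel: "(A ^\<^sub>m k) *\<^sub>v b = - vec n (\<lambda>r. \<Sum>i\<in>{1..k}. a i * ((A ^\<^sub>m (i - 1)) *\<^sub>v b) $ r)"
begin

lemma vv_carrier: "vv n A b a k m \<in> carrier_vec n"
  by (simp add: vv_def Let_def)

lemma vv_top: "vv n A b a k k = b"
  using A b by (intro eq_vecI) (auto simp: vv_def)

text \<open>v_0 is the annihilating polynomial of b evaluated at A and applied to b; the relation
  for A^k b says exactly that it vanishes.\<close>

lemma vv_zero: "r < n \<Longrightarrow> vv n A b a k 0 $ r = 0"
proof -
  assume r: "r < n"
  have "(\<Sum>j\<in>{1..k}. a (k - j + 1) * ((A ^\<^sub>m (k - j)) *\<^sub>v b) $ r) = (\<Sum>i\<in>{1..k}. a i * ((A ^\<^sub>m (i - 1)) *\<^sub>v b) $ r)"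
    by (rule sum.reindex_bij_witness[of _ "\<lambda>i. k - i + 1" "\<lambda>j. k - j + 1"]) auto
  then show ?thesis using r arg_cong[OF rel, of "\<lambda>v. v $ r"] by (simp add: vv_def Let_def)
qed

text \<open>Horner's scheme: v_(m-1) arises from v_m by applying A and adding a_m times b.\<close>

lemma mult_vv:
  assumes m: "1 \<le> m" "m \<le> k" and r: "r < n"
  shows "(\<Sum>l<n. A $$ (r, l) * vv n A b a k m $ l) = vv n A b a k (m - 1) $ r - a m * b $ r"
proof -
  define p where "p j = (A ^\<^sub>m j) *\<^sub>v b" for j
  have p: "p j \<in> carrier_vec n" for j
    unfolding p_def by (rule mult_mat_vec_carrier[OF pow_carrier_mat[OF A] b])
  have pS: "(\<Sum>l<n. A $$ (r, l) * p j $ l) = p (Suc j) $ r" for j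
    using pow_mat_Suc_mult_vec[OF A b, of j] mult_mat_vec_sum[OF A p r] by (simp add: p_def)
  define i where "i = k - m"
  \<comment> \<open>Lowering m by one raises the power by one, and the coefficient of the newly
    added summand is a_m.\<close>
  have i: "k - (m - 1) = Suc i" "k - Suc i + 1 = m" using m by (auto simp: i_def)
  have "(\<Sum>l<n. A $$ (r, l) * vv n A b a k m $ l)
      = (\<Sum>l<n. A $$ (r, l) * p i $ l + (\<Sum>j\<in>{1..i}. a (k - j + 1) * (A $$ (r, l) * p (i - j) $ l)))"
    by (intro sum.cong) (auto simp: vv_def Let_def i_def[symmetric] p_def[symmetric] distrib_left sum_distrib_left mult_ac)
  also have "\<dots> = p (Suc i) $ r + (\<Sum>j\<in>{1..i}. a (k - j + 1) * p (Suc (i - j)) $ r)"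
    unfolding sum.distrib pS by (subst sum.swap) (simp add: pS sum_distrib_left[symmetric])
  also have "(\<Sum>j\<in>{1..i}. a (k - j + 1) * p (Suc (i - j)) $ r) = (\<Sum>j\<in>{1..i}. a (k - j + 1) * p (Suc i - j) $ r)"
    by (intro sum.cong) (auto simp: Suc_diff_le)
  finally have lhs: "(\<Sum>l<n. A $$ (r, l) * vv n A b a k m $ l)
      = p (Suc i) $ r + (\<Sum>j\<in>{1..i}. a (k - j + 1) * p (Suc i - j) $ r)" .
  have "vv n A b a k (m - 1) $ r = p (Suc i) $ r + (\<Sum>j\<in>{1..Suc i}. a (k - j + 1) * p (Suc i - j) $ r)"
    unfolding vv_def Let_def i(1) using r by (simp add: p_def)
  also have "(\<Sum>j\<in>{1..Suc i}. a (k - j + 1) * p (Suc i - j) $ r)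
      = (\<Sum>j\<in>{1..i}. a (k - j + 1) * p (Suc i - j) $ r) + a m * p 0 $ r"
    using i(2) by simp
  also have "p 0 = b" using A b by (simp add: p_def)
  finally show ?thesis using lhs by simp
qed

lemma feedback_mult_vv:
  assumes K: "K \<in> carrier_vec n" and m: "1 \<le> m" "m \<le> k" and r: "r < n"
  shows "(\<Sum>l<n. (A + outer b K) $$ (r, l) * vv n A b a k m $ l)
    = vv n A b a k (m - 1) $ r - (a m - K \<bullet> vv n A b a k m) * b $ r"
proof -
  have dot: "K \<bullet> vv n A b a k m = (\<Sum>l<n. K $ l * vv n A b a k m $ l)"
    using vv_carrier[of m] by (simp add: scalar_prod_def atLeast0LessThan)
  have "(\<Sum>l<n. (A + outer b K) $$ (r, l) * vv n A b a k m $ l)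
      = (\<Sum>l<n. A $$ (r, l) * vv n A b a k m $ l + b $ r * (K $ l * vv n A b a k m $ l))"
    using feedback_index[OF A b K r] by (intro sum.cong) (auto simp: algebra_simps)
  also have "\<dots> = vv n A b a k (m - 1) $ r - a m * b $ r + b $ r * (K \<bullet> vv n A b a k m)"
    unfolding sum.distrib mult_vv[OF m r] dot sum_distrib_left ..
  finally show ?thesis by (simp add: algebra_simps)
qed

lemma nonneg_left_eigenvector_annihilates_input:
  fixes w :: "nat \<Rightarrow> real"
  assumes K: "K \<in> carrier_vec n" and c: "\<And>i. i \<in> {1..k} \<Longrightarrow> K \<bullet> vv n A b a k i < a i"
    and "s \<ge> 0" and eig: "\<And>j. j < n \<Longrightarrow> (\<Sum>i<n. w i * (A + outer b K) $$ (i, j)) = s * w j"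
    and nonneg: "0 \<le> (\<Sum>i<n. w i * b $ i)"
  shows "(\<Sum>i<n. w i * b $ i) = 0"
proof (rule ccontr)
  define \<beta> where "\<beta> = (\<Sum>i<n. w i * b $ i)"
  assume "(\<Sum>i<n. w i * b $ i) \<noteq> 0"
  then have "\<beta> > 0" using nonneg by (simp add: \<beta>_def)
  define W where "W m = (\<Sum>r<n. w r * vv n A b a k m $ r)" for m
  \<comment> \<open>Pairing the closed-loop recursion with the left eigenvector gives a scalar
    recursion, which is run downwards from v_k = b.\<close>
  have step: "W (m - 1) = s * W m + (a m - K \<bullet> vv n A b a k m) * \<beta>" if m: "1 \<le> m" "m \<le> k" for m
  proof -
    have "s * W m = (\<Sum>l<n. (\<Sum>r<n. w r * (A + outer b K) $$ (r, l)) * vv n A b a k m $ l)"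
      using eig by (simp add: W_def sum_distrib_left mult.assoc)
    also have "\<dots> = (\<Sum>r<n. w r * (\<Sum>l<n. (A + outer b K) $$ (r, l) * vv n A b a k m $ l))"
      unfolding sum_distrib_left sum_distrib_right by (subst sum.swap) (simp add: mult.assoc)
    also have "\<dots> = (\<Sum>r<n. w r * vv n A b a k (m - 1) $ r - (a m - K \<bullet> vv n A b a k m) * (w r * b $ r))"
    proof (intro sum.cong refl)
      fix r assume "r \<in> {..<n}"
      then have "r < n" by simp
      then show "w r * (\<Sum>l<n. (A + outer b K) $$ (r, l) * vv n A b a k m $ l)
          = w r * vv n A b a k (m - 1) $ r - (a m - K \<bullet> vv n A b a k m) * (w r * b $ r)"
        unfolding feedback_mult_vv[OF K m \<open>r < n\<close>] by (simp add: algebra_simps)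
    qed
    also have "\<dots> = W (m - 1) - (a m - K \<bullet> vv n A b a k m) * \<beta>"
      by (simp add: sum_subtractf W_def \<beta>_def sum_distrib_left)
    finally show ?thesis by simp
  qed
  have "W (k - i) > 0" if "i \<le> k" for i
    using that
  proof (induction i)
    case 0
    then show ?case using \<open>\<beta> > 0\<close> by (simp add: W_def vv_top \<beta>_def)
  next
    case (Suc i)
    then have m: "1 \<le> k - i" "k - i \<le> k" by auto
    have "0 < (a (k - i) - K \<bullet> vv n A b a k (k - i)) * \<beta>" using c[of "k - i"] m \<open>\<beta> > 0\<close> by simp
    moreover have "0 \<le> s * W (k - i)" using Suc \<open>s \<ge> 0\<close> by simp
    moreover have "W (k - Suc i) = s * W (k - i) + (a (k - i) - K \<bullet> vv n A b a k (k - i)) * \<beta>"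
      using step[OF m] by simp
    ultimately show ?case by linarith
  qed
  from this[of k] have "W 0 > 0" by simp
  then show False by (simp add: W_def vv_zero)
qed

lemma lower_krylov_pow: "j < k - 1 \<Longrightarrow> lower_krylov n A b k (\<lambda>r. ((A ^\<^sub>m j) *\<^sub>v b) $ r)"
  unfolding lower_krylov_def
  by (intro exI[of _ "\<lambda>l. if l = j then 1 else 0"]) (simp add: if_distrib[of "\<lambda>u. u * _"] cong: if_cong)

lemma lower_krylov_add: "lower_krylov n A b k u \<Longrightarrow> lower_krylov n A b k v \<Longrightarrow> lower_krylov n A b k (\<lambda>r. u r + v r)"
proof -
  assume "lower_krylov n A b k u" "lower_krylov n A b k v"
  then obtain d e where "\<forall>r<n. u r = (\<Sum>j<k - 1. d j * ((A ^\<^sub>m j) *\<^sub>v b) $ r)"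
    "\<forall>r<n. v r = (\<Sum>j<k - 1. e j * ((A ^\<^sub>m j) *\<^sub>v b) $ r)" unfolding lower_krylov_def by blast
  then show ?thesis
    unfolding lower_krylov_def
    by (intro exI[of _ "\<lambda>j. d j + e j"]) (simp add: distrib_right sum.distrib)
qed

lemma lower_krylov_scale: "lower_krylov n A b k u \<Longrightarrow> lower_krylov n A b k (\<lambda>r. c * u r)"
proof -
  assume "lower_krylov n A b k u"
  then obtain d where "\<forall>r<n. u r = (\<Sum>j<k - 1. d j * ((A ^\<^sub>m j) *\<^sub>v b) $ r)"
    unfolding lower_krylov_def by blast
  then show ?thesis
    unfolding lower_krylov_def
    by (intro exI[of _ "\<lambda>j. c * d j"]) (simp add: sum_distrib_left mult.assoc)
qed

lemma lower_krylov_sum: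
  "finite I \<Longrightarrow> (\<And>i. i \<in> I \<Longrightarrow> lower_krylov n A b k (f i)) \<Longrightarrow> lower_krylov n A b k (\<lambda>r. \<Sum>i\<in>I. f i r)"
proof (induction I rule: finite_induct)
  case empty
  show ?case unfolding lower_krylov_def by (intro exI[of _ "\<lambda>_. 0"]) simp
next
  case (insert i I)
  then show ?case using lower_krylov_add[of "f i" "\<lambda>r. \<Sum>i\<in>I. f i r"] by simp
qed

lemma lower_krylov_cong: "lower_krylov n A b k u \<Longrightarrow> (\<And>r. r < n \<Longrightarrow> u r = v r) \<Longrightarrow> lower_krylov n A b k v"
  unfolding lower_krylov_def by simp

text \<open>\<open>lower_krylov\<close> describes the span of b, ..., A^(k-2) b. If it contained
  A^(k-1) b, the Krylov rank would drop below k.\<close>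

lemma not_lower_krylov_pow:
  assumes "k > 0"
  shows "\<not> lower_krylov n A b k (\<lambda>r. ((A ^\<^sub>m (k - 1)) *\<^sub>v b) $ r)"
proof
  assume "lower_krylov n A b k (\<lambda>r. ((A ^\<^sub>m (k - 1)) *\<^sub>v b) $ r)"
  then obtain d where "\<And>r. r < n \<Longrightarrow> ((A ^\<^sub>m (k - 1)) *\<^sub>v b) $ r = (\<Sum>j<k - 1. d j * ((A ^\<^sub>m j) *\<^sub>v b) $ r)"
    unfolding lower_krylov_def by blast
  then have "vec_space.rank n (krylov n A b) \<le> k - 1" by (rule krylov_rank_le[OF A b])
  then show False using k assms by simp
qed

lemma lower_krylov_vv_tail:
  assumes "1 \<le> m" "m \<le> k"
  shows "lower_krylov n A b k (\<lambda>r. \<Sum>j\<in>{1..k - m}. a (k - j + 1) * ((A ^\<^sub>m (k - m - j)) *\<^sub>v b) $ r)"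
  using assms by (intro lower_krylov_sum lower_krylov_scale lower_krylov_pow) auto

lemma lower_krylov_vv:
  assumes "2 \<le> m" "m \<le> k"
  shows "lower_krylov n A b k (\<lambda>r. vv n A b a k m $ r)"
proof (rule lower_krylov_cong)
  show "lower_krylov n A b k (\<lambda>r. ((A ^\<^sub>m (k - m)) *\<^sub>v b) $ r +
      (\<Sum>j\<in>{1..k - m}. a (k - j + 1) * ((A ^\<^sub>m (k - m - j)) *\<^sub>v b) $ r))"
    using assms by (intro lower_krylov_add lower_krylov_vv_tail lower_krylov_pow) auto
qed (simp add: vv_def Let_def)

text \<open>Only v_1 involves A^(k-1) b, with coefficient 1; v_2, ..., v_k lie in the span of the
  lower powers. A vanishing combination with e 0 = 1 would therefore express A^(k-1) b by lower
  powers.\<close>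

lemma vv_combination_nonzero:
  assumes "k > 0" and e: "e 0 = (1::real)"
  shows "\<exists>r<n. (\<Sum>q<k. e q * vv n A b a k (Suc q) $ r) \<noteq> 0"
proof (rule ccontr)
  assume "\<not> ?thesis"
  then have z: "(\<Sum>q<k. e q * vv n A b a k (Suc q) $ r) = 0" if "r < n" for r using that by blast
  have "lower_krylov n A b k (\<lambda>r. (- 1) * (\<Sum>q\<in>{1..<k}. e q * vv n A b a k (Suc q) $ r) +
      (- 1) * (\<Sum>j\<in>{1..k - 1}. a (k - j + 1) * ((A ^\<^sub>m (k - 1 - j)) *\<^sub>v b) $ r))"
    using assms(1)
    by (intro lower_krylov_add lower_krylov_scale lower_krylov_sum lower_krylov_vv lower_krylov_vv_tail) auto
  then have "lower_krylov n A b k (\<lambda>r. ((A ^\<^sub>m (k - 1)) *\<^sub>v b) $ r)"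
  proof (rule lower_krylov_cong)
    fix r assume r: "r < n"
    have "{..<k} = insert 0 {1..<k}" using assms(1) by auto
    then have "(\<Sum>q<k. e q * vv n A b a k (Suc q) $ r)
        = vv n A b a k 1 $ r + (\<Sum>q\<in>{1..<k}. e q * vv n A b a k (Suc q) $ r)"
      by (simp add: e)
    moreover have "vv n A b a k 1 $ r = ((A ^\<^sub>m (k - 1)) *\<^sub>v b) $ r +
        (\<Sum>j\<in>{1..k - 1}. a (k - j + 1) * ((A ^\<^sub>m (k - 1 - j)) *\<^sub>v b) $ r)"
      using r by (simp add: vv_def Let_def)
    ultimately show "(- 1) * (\<Sum>q\<in>{1..<k}. e q * vv n A b a k (Suc q) $ r) +
        (- 1) * (\<Sum>j\<in>{1..k - 1}. a (k - j + 1) * ((A ^\<^sub>m (k - 1 - j)) *\<^sub>v b) $ r)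
        = ((A ^\<^sub>m (k - 1)) *\<^sub>v b) $ r"
      using z[OF r] by linarith
  qed
  then show False using not_lower_krylov_pow[OF assms(1)] by blast
qed

text \<open>The polynomial is the characteristic polynomial of the closed loop restricted to the
  Krylov space; a root yields the eigenvector obtained by Horner's scheme.\<close>

lemma restricted_char_poly_root_imp_eigenvalue:
  fixes z :: complex
  assumes K: "K \<in> carrier_vec n" and "k > 0"
    and root: "z ^ k + (\<Sum>q<k. of_real (a (Suc q) - K \<bullet> vv n A b a k (Suc q)) * z ^ q) = 0"
  shows "eigenvalue (map_mat complex_of_real (A + outer b K)) z"
proof -
  define M where "M = A + outer b K"
  have M: "M \<in> carrier_mat n n" unfolding M_def by (rule feedback_carrier[OF A b K])
  have MC: "map_mat complex_of_real M \<in> carrier_mat n n" using M by simp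
  define V where "V m r = vv n A b a k m $ r" for m r
  define c where "c q = a (Suc q) - K \<bullet> vv n A b a k (Suc q)" for q
  define x where "x = vec n (\<lambda>r. \<Sum>q<k. z ^ q * of_real (V (Suc q) r))"
  have x: "x \<in> carrier_vec n" by (simp add: x_def)
  have Mv: "(\<Sum>l<n. M $$ (r, l) * V (Suc q) l) = V q r - c q * b $ r" if "r < n" "q < k" for r q
    using feedback_mult_vv[OF K, of "Suc q" r] that by (simp add: M_def V_def c_def)
  have "map_mat complex_of_real M *\<^sub>v x = z \<cdot>\<^sub>v x"
  proof (rule eq_vecI)
    fix r assume "r < dim_vec (z \<cdot>\<^sub>v x)"
    then have r: "r < n" using x by simp
    have "(map_mat complex_of_real M *\<^sub>v x) $ r = (\<Sum>l<n. of_real (M $$ (r, l)) * x $ l)"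
      unfolding mult_mat_vec_sum[OF MC x r] using M r by (intro sum.cong) auto
    also have "\<dots> = (\<Sum>l<n. \<Sum>q<k. z ^ q * of_real (M $$ (r, l) * V (Suc q) l))"
      by (intro sum.cong) (auto simp: x_def sum_distrib_left mult_ac)
    also have "\<dots> = (\<Sum>q<k. z ^ q * of_real (\<Sum>l<n. M $$ (r, l) * V (Suc q) l))"
      by (subst sum.swap) (simp add: sum_distrib_left)
    also have "\<dots> = (\<Sum>q<k. z ^ q * of_real (V q r - c q * b $ r))"
      using Mv[OF r] by simp
    also have "\<dots> = (\<Sum>q<k. z ^ q * of_real (V q r) - z ^ Suc q * of_real (V (Suc q) r))
        + z * x $ r - of_real (b $ r) * (\<Sum>q<k. of_real (c q) * z ^ q)"
      using r by (simp add: x_def sum_distrib_left sum.distrib sum_subtractf algebra_simps)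
    \<comment> \<open>The sum telescopes between v_0 = 0 and v_k = b.\<close>
    also have "(\<Sum>q<k. z ^ q * of_real (V q r) - z ^ Suc q * of_real (V (Suc q) r)) = - (z ^ k * of_real (b $ r))"
      using sum_lessThan_telescope'[of "\<lambda>q. z ^ q * complex_of_real (V q r)" k] r
      by (simp add: V_def vv_zero vv_top)
    also have "- (z ^ k * of_real (b $ r)) + z * x $ r - of_real (b $ r) * (\<Sum>q<k. of_real (c q) * z ^ q)
        = z * x $ r - of_real (b $ r) * (z ^ k + (\<Sum>q<k. of_real (c q) * z ^ q))"
      by (simp add: algebra_simps)
    also have "\<dots> = (z \<cdot>\<^sub>v x) $ r" using root r x by (simp add: c_def)
    finally show "(map_mat complex_of_real M *\<^sub>v x) $ r = (z \<cdot>\<^sub>v x) $ r" .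
  qed (use M x in simp)
  moreover have "x \<noteq> 0\<^sub>v n"
  proof
    assume x0: "x = 0\<^sub>v n"
    \<comment> \<open>Taking real parts leaves coefficient Re (z^0) = 1 at v_1, so independence over
      the reals suffices for the complex vector.\<close>
    obtain r where r: "r < n" "(\<Sum>q<k. Re (z ^ q) * vv n A b a k (Suc q) $ r) \<noteq> 0"
      using vv_combination_nonzero[OF \<open>k > 0\<close>, of "\<lambda>q. Re (z ^ q)"] by auto
    have "Re (x $ r) = (\<Sum>q<k. Re (z ^ q) * vv n A b a k (Suc q) $ r)"
      using r(1) by (simp add: x_def V_def)
    then show False using r x0 by simp
  qed
  ultimately show ?thesis
    unfolding eigenvalue_def eigenvector_def M_def[symmetric] using x M by auto
qed

lemma stable_imp_coefficient_bounds:
  assumes K: "K \<in> carrier_vec n"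
    and re: "\<And>z. eigenvalue (map_mat complex_of_real (A + outer b K)) z \<Longrightarrow> Re z < 0"
    and i: "i \<in> {1..k}"
  shows "K \<bullet> vv n A b a k i < a i"
proof -
  have "k > 0" using i by auto
  \<comment> \<open>Indices are shifted by one: the gap belonging to v_i is the coefficient of
    z^(i-1).\<close>
  define c where "c q = a (Suc q) - K \<bullet> vv n A b a k (Suc q)" for q
  define p where "p = monom 1 k + (\<Sum>q<k. monom (c q) q)"
  have coeff: "coeff p j = (if j = k then 1 else if j < k then c j else 0)" for j
    by (auto simp: p_def coeff_sum coeff_monom)
  have deg: "degree p = k"
  proof (rule antisym)
    show "degree p \<le> k" by (rule degree_le) (auto simp: coeff)
    show "k \<le> degree p" by (rule le_degree) (simp add: coeff)
  qed
  have "pos_coeffs p"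
  proof (rule hurwitz_imp_pos_coeffs)
    show "0 < lead_coeff p" by (simp add: deg coeff)
    fix z assume "poly (map_poly complex_of_real p) z = 0"
    then have "(\<Sum>j\<le>k. of_real (coeff p j) * z ^ j) = 0"
      by (simp add: poly_altdef deg)
    then have "z ^ k + (\<Sum>q<k. of_real (c q) * z ^ q) = 0"
      by (simp add: lessThan_Suc_atMost[symmetric] coeff add.commute)
    then show "Re z < 0"
      unfolding c_def by (intro re restricted_char_poly_root_imp_eigenvalue[OF K \<open>k > 0\<close>])
  qed
  then have "0 < coeff p (i - 1)" using i by (auto simp: pos_coeffs_def deg)
  moreover have "coeff p (i - 1) = a i - K \<bullet> vv n A b a k i" using i by (auto simp: coeff c_def)
  ultimately show ?thesis by simp
qed

text \<open>Both sides are decided by the same dichotomy for M: a strictly subinvariant vector at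
  level 0 makes both true, a nonnegative left eigenvector with s \<ge> 0 makes both false.\<close>

lemma feedback_stable_iff:
  assumes T: "time_scale T" "\<not> bdd_above T" and bpos: "\<And>i. i < n \<Longrightarrow> 0 \<le> b $ i"
    and K: "K \<in> carrier_vec n" and met: "ts_metzler T n (A + outer b K)"
  shows "pos_unif_exp_stable T n (A + outer b K) \<longleftrightarrow>
    (\<forall>z\<in>spectrum (map_mat complex_of_real A). z \<notin> stab_region T \<longrightarrow> vec_space.rank n (hautus n A b z) = n) \<and>
    (\<forall>i\<in>{1..k}. K \<bullet> vv n A b a k i < a i)"
proof -
  define M where "M = A + outer b K"
  have M: "M \<in> carrier_mat n n" unfolding M_def by (rule feedback_carrier[OF A b K])
  have Mij: "M $$ (i, j) = A $$ (i, j) + b $ i * K $ j" if "i < n" "j < n" for i j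
    unfolding M_def by (rule feedback_index[OF A b K that])
  have metM: "ts_metzler T n M" using met by (simp add: M_def)
  have off: "0 \<le> M $$ (i, j)" if "i < n" "j < n" "i \<noteq> j" for i j
    using metM that by (simp add: ts_metzler_def)
  have stable_case: "pos_unif_exp_stable T n M \<and>
      (\<forall>z. vec_space.rank n (hautus n A b z) \<noteq> n \<longrightarrow> z \<in> stab_region T) \<and>
      (\<forall>i\<in>{1..k}. K \<bullet> vv n A b a k i < a i)" if sub: "subinvariant M n 0 w" for w
  proof -
    obtain e where "e > 0" and e: "\<And>d. d < e \<Longrightarrow> subinvariant M n (0 - d) w"
      using subinvariant_decrease[OF off sub] by blast
    \<comment> \<open>Half of the admissible shift: the strict inequalities at level 0 become a
      uniform decay margin.\<close>
    define \<epsilon> where "\<epsilon> = e / 2"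
    have "\<epsilon> > 0" using \<open>e > 0\<close> by (simp add: \<epsilon>_def)
    have "subinvariant M n (0 - \<epsilon>) w" using \<open>e > 0\<close> by (intro e) (simp add: \<epsilon>_def)
    then have w: "\<And>i. i < n \<Longrightarrow> 0 < w i"
      and dec: "\<And>j. j < n \<Longrightarrow> (\<Sum>i<n. w i * M $$ (i, j)) \<le> - \<epsilon> * w j"
      by (auto simp: subinvariant_def less_imp_le)
    have re: "Re z \<le> - \<epsilon>" if "eigenvalue (map_mat complex_of_real M) z" for z
      by (rule metzler_eigenvalue_bounds(2)[OF M off w dec that])
    have "pos_unif_exp_stable T n M" by (rule metzler_stable[OF T M metM w \<open>\<epsilon> > 0\<close> dec])
    moreover have "z \<in> stab_region T" if rk: "vec_space.rank n (hautus n A b z) \<noteq> n" for z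
    proof -
      obtain y l where y: "\<And>j. j < n \<Longrightarrow> (\<Sum>i<n. y i * of_real (A $$ (i, j))) = z * y j"
        "(\<Sum>i<n. y i * of_real (b $ i)) = 0" "l < n" "y l \<noteq> 0"
        using rk unfolding hautus_rank_iff[OF A b] by blast
      have ev: "eigenvalue (map_mat complex_of_real M) z"
      proof (rule left_eigenvector_imp_eigenvalue[where y = y, OF _ _ y(3,4)])
        fix j assume j: "j < n"
        \<comment> \<open>The feedback term contributes a multiple of y^T b, which is zero.\<close>
        have "(\<Sum>i<n. y i * map_mat complex_of_real M $$ (i, j))
            = (\<Sum>i<n. y i * of_real (A $$ (i, j)) + of_real (K $ j) * (y i * of_real (b $ i)))"
          using M j by (intro sum.cong) (auto simp: Mij algebra_simps)
        also have "\<dots> = z * y j"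
          unfolding sum.distrib sum_distrib_left[symmetric] y(1)[OF j] y(2) by simp
        finally show "(\<Sum>i<n. y i * map_mat complex_of_real M $$ (i, j)) = z * y j" .
      qed (use M in simp)
      show ?thesis
      proof (rule stab_regionI[OF T \<open>\<epsilon> > 0\<close> re[OF ev]])
        fix t assume t: "t \<in> T"
        interpret half_time_scale "tsfrom T t" t by (rule tsfrom_half_time_scale) fact+
        have g: "0 \<le> graininess T t" using graininess_nonneg[of t] graininess_tsfrom[OF start_in] by simp
        have d: "0 \<le> 1 + graininess T t * M $$ (j, j)" if "j < n" for j
          using metM t that by (simp add: ts_metzler_def)
        show "cmod (1 + of_real (graininess T t) * z) \<le> 1 - \<epsilon> * graininess T t"
          by (rule metzler_eigenvalue_bounds(1)[OF M off w dec ev g d])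
      qed
    qed
    moreover have "K \<bullet> vv n A b a k i < a i" if "i \<in> {1..k}" for i
    proof (rule stable_imp_coefficient_bounds[OF K _ that])
      fix z assume "eigenvalue (map_mat complex_of_real (A + outer b K)) z"
      then have "Re z \<le> - \<epsilon>" unfolding M_def[symmetric] by (rule re)
      then show "Re z < 0" using \<open>\<epsilon> > 0\<close> by simp
    qed
    ultimately show ?thesis by blast
  qed
  have unstable_case: "\<not> pos_unif_exp_stable T n M \<and>
      \<not> ((\<forall>z\<in>spectrum (map_mat complex_of_real A). z \<notin> stab_region T \<longrightarrow> vec_space.rank n (hautus n A b z) = n) \<and>
         (\<forall>i\<in>{1..k}. K \<bullet> vv n A b a k i < a i))"
    if w: "\<And>i. i < n \<Longrightarrow> 0 \<le> w i" "l < n" "0 < w l" "0 \<le> s"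
      and eig: "\<And>j. j < n \<Longrightarrow> (\<Sum>i<n. w i * M $$ (i, j)) = s * w j" for w s l
  proof (intro conjI notI)
    assume "pos_unif_exp_stable T n M"
    then show False using metzler_unstable[OF T M metM w eig] by blast
  next
    assume "(\<forall>z\<in>spectrum (map_mat complex_of_real A). z \<notin> stab_region T \<longrightarrow> vec_space.rank n (hautus n A b z) = n) \<and>
      (\<forall>i\<in>{1..k}. K \<bullet> vv n A b a k i < a i)"
    then have hautus: "\<forall>z\<in>spectrum (map_mat complex_of_real A). z \<notin> stab_region T \<longrightarrow> vec_space.rank n (hautus n A b z) = n"
      and c: "\<forall>i\<in>{1..k}. K \<bullet> vv n A b a k i < a i" by blast+
    have wb: "(\<Sum>i<n. w i * b $ i) = 0"
    proof (rule nonneg_left_eigenvector_annihilates_input[OF K _ \<open>0 \<le> s\<close>])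
      show "0 \<le> (\<Sum>i<n. w i * b $ i)" using w(1) bpos by (intro sum_nonneg) auto
    qed (use c eig in \<open>auto simp: M_def\<close>)
    have wA: "(\<Sum>i<n. w i * A $$ (i, j)) = s * w j" if j: "j < n" for j
    proof -
      have "s * w j = (\<Sum>i<n. w i * A $$ (i, j) + K $ j * (w i * b $ i))"
        unfolding eig[OF j, symmetric] using j by (intro sum.cong) (auto simp: Mij algebra_simps)
      also have "\<dots> = (\<Sum>i<n. w i * A $$ (i, j))"
        unfolding sum.distrib sum_distrib_left[symmetric] wb by simp
      finally show ?thesis by simp
    qed
    have wAc: "(\<Sum>i<n. of_real (w i) * complex_of_real (A $$ (i, j))) = of_real s * of_real (w j)" if "j < n" for j
      using arg_cong[OF wA[OF that], of complex_of_real] by simp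
    have "eigenvalue (map_mat complex_of_real A) (of_real s)"
    proof (rule left_eigenvector_imp_eigenvalue[where y = "\<lambda>i. of_real (w i)" and l = l])
      fix j assume j: "j < n"
      have "(\<Sum>i<n. of_real (w i) * map_mat complex_of_real A $$ (i, j))
          = (\<Sum>i<n. of_real (w i) * complex_of_real (A $$ (i, j)))"
        using A j by (intro sum.cong) auto
      then show "(\<Sum>i<n. of_real (w i) * map_mat complex_of_real A $$ (i, j)) = of_real s * of_real (w j)"
        using wAc[OF j] by simp
    qed (use A w in auto)
    moreover have "complex_of_real s \<notin> stab_region T"
      by (rule nonneg_real_not_in_stab_region[OF T \<open>0 \<le> s\<close>])
    ultimately have rk: "vec_space.rank n (hautus n A b (of_real s)) = n"
      using hautus by (simp add: spectrum_def)
    have "(\<Sum>i<n. of_real (w i) * complex_of_real (b $ i)) = 0"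
      using arg_cong[OF wb, of complex_of_real] by simp
    then have "\<forall>i<n. complex_of_real (w i) = 0"
      using rk[unfolded hautus_rank_iff[OF A b], rule_format, of "\<lambda>i. of_real (w i)"] wAc by blast
    then show False using w by auto
  qed
  show ?thesis
  proof (rule metzler_dichotomy[OF off])
    fix w assume "subinvariant M n 0 w"
    from stable_case[OF this] show ?thesis unfolding M_def[symmetric] by blast
  next
    fix w s l
    assume "\<And>i. i < n \<Longrightarrow> 0 \<le> w i" "l < n" "0 < w l" "0 \<le> s"
      "\<And>j. j < n \<Longrightarrow> (\<Sum>i<n. w i * M $$ (i, j)) = s * w j"
    from unstable_case[OF this] show ?thesis unfolding M_def[symmetric] by blast
  qed
qed

end

theorem mainTheorem6:
  fixes T :: "real set" and n :: nat and A :: "real mat" and b :: "real vec"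
    and a :: "nat \<Rightarrow> real"
  assumes "time_scale T"
    and "\<not> bdd_above T"
    and "bdd_above (graininess T ` T)"
    and "A \<in> carrier_mat n n" and "b \<in> carrier_vec n"
    and "positive_ctrl_system T n A b"
    and "k = vec_space.rank n (krylov n A b)"
    and "(A ^\<^sub>m k) *\<^sub>v b = - vec n (\<lambda>r. \<Sum>i\<in>{1..k}. a i * ((A ^\<^sub>m (i - 1)) *\<^sub>v b) $ r)"
  shows "positively_stabilizable T n A b \<longleftrightarrow>
    ((\<forall>z\<in>spectrum (map_mat complex_of_real A). z \<notin> stab_region T \<longrightarrow>
        vec_space.rank n (hautus n A b z) = n) \<and>
     (\<exists>K\<in>carrier_vec n. (\<forall>j<n. ereal (K $ j) \<ge> alpha_bound T n A b j) \<and>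
        (\<forall>i\<in>{1..k}. K \<bullet> vv n A b a k i < a i)))"
proof -
  note T = assms(1,2) and A = assms(4) and b = assms(5)
  note pos = positive_ctrl_system_imp[OF T A b assms(6)]
  \<comment> \<open>The rank condition does not depend on K and can be pulled out of the existential
    quantifier afterwards.\<close>
  have "positive_aut T n (A + outer b K) \<and> pos_unif_exp_stable T n (A + outer b K) \<longleftrightarrow>
      (\<forall>z\<in>spectrum (map_mat complex_of_real A). z \<notin> stab_region T \<longrightarrow> vec_space.rank n (hautus n A b z) = n) \<and>
      (\<forall>j<n. ereal (K $ j) \<ge> alpha_bound T n A b j) \<and> (\<forall>i\<in>{1..k}. K \<bullet> vv n A b a k i < a i)"
    if K: "K \<in> carrier_vec n" for K
    using positive_aut_iff[OF T feedback_carrier[OF A b K]]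
      ts_metzler_feedback_iff[OF T assms(3) A pos(1) b pos(2) K]
      feedback_stable_iff[OF A b assms(7,8) T pos(2) K]
    by blast
  then show ?thesis unfolding positively_stabilizable_def by blast
qed

end
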